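(* Let $p\ge2$ be an integer, $r\in\mathbb{Z}$, $1\le s\le p-1$, and $\varepsilon=(\varepsilon_0+ik)/\sqrt{2p}$ with $k\in\mathbb{Z}$, $\varepsilon_0=u_0+iv_0$, $u_0,v_0\in\mathbb{R}$, $-1/2<v_0\le1/2$. As $t\to0^+$, for every $N\in\mathbb{N}_0$: (i) If $\operatorname{Re}(\varepsilon)<0$, or ($\operatorname{Re}(\varepsilon)>0$ and $|v_0|>|u_0|$), or ($u_0=0$ and $v_0\ne0$), then $$\mathcal{C}_{r,s}(\varepsilon;it)=\sum_{a=0}^N\mathcal{D}_\varepsilon^{2a}\left(\frac{e^{\pi\sqrt{2p}(1-r)\varepsilon}\sinh\left(\sqrt{\frac2p}\pi s\varepsilon\right)}{\sinh\left(\sqrt{2p}\pi\varepsilon\right)}\right)\frac{(\pi t)^a}{a!}+O\left(t^{N+1}\right).$$ (ii) If $\operatorname{Re}(\varepsilon)>0$ and $|v_0|\le|u_0|$, then $$\mathcal{C}_{r,s}(\varepsilon;it)=-2i(2pt)^{-\frac12}e^{\frac{\pi\varepsilon_0^2}{2pt}}\sum_{\substack{n\in\mathbb{Z}\\|n+v_0|\le|u_0|}}(-1)^{r(k+n)}\sin\left(\frac{\pi s(k-n)}{p}\right)e^{-\frac{\pi n^2}{2pt}+\frac{2\pi i\varepsilon_0n}{t}}+\sum_{a=0}^N\mathcal{D}_\varepsilon^{2a}\left(\frac{e^{\pi\sqrt{2p}(1-r)\varepsilon}\sinh\left(\sqrt{\frac2p}\pi s\varepsilon\right)}{\sinh\left(\sqrt{2p}\pi\varepsilon\right)}\right)\frac{(\pi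 t)^a}{a!}+O\left(t^{N+1}\right).$$ (iii) If $\varepsilon_0=0$, then $$\mathcal{C}_{r,s}(\varepsilon;it)=-i(-1)^{rk}\sin\left(\frac{\pi ks}{p}\right)(2pt)^{-\frac12}+(-1)^{kr}\sum_{a=0}^N\left(e^{\frac{\pi isk}{p}}B_{2a+1}\left(\frac{s+p(r-2)}{2p}\right)-e^{-\frac{\pi isk}{p}}B_{2a+1}\left(-\frac{s+p(r-2)}{2p}\right)\right)\frac{(-2\pi pt)^a}{(2a+1)a!}-\sum_{a=0}^N\mathcal{D}_\varepsilon^{2a}\left(e^{2\pi\varepsilon\frac{s-p}{\sqrt{2p}}}\frac{\sinh(\sqrt{2p}(r-2)\pi\varepsilon)}{\sinh(\sqrt{2p}\pi\varepsilon)}\right)\frac{(\pi t)^a}{a!}+O\left(t^{N+1}\right).$$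
   Context: For $\tau$ in the upper half-plane, $q^x:=e^{2\pi ix\tau}$. Define $$\mathcal{C}_{r,s}(\varepsilon;\tau):=\sum_{n\ge0}\left(e^{\frac{2\pi\varepsilon}{\sqrt{2p}}(2pn-s-pr+2p)}q^{\frac1{4p}(2pn-s-pr+2p)^2}-e^{\frac{2\pi\varepsilon}{\sqrt{2p}}(2pn+s-pr+2p)}q^{\frac1{4p}(2pn+s-pr+2p)^2}\right)$$ (this is $\eta(\tau)$ times the regularized atypical character of the $(1,p)$-singlet algebra). $\mathcal{D}_\varepsilon:=\frac1{2\pi i}\frac{\partial}{\partial\varepsilon}$, and expressions $\mathcal{D}_\varepsilon^{2a}(\cdots)$ are evaluated at the given $\varepsilon$. $B_n$ are Bernoulli polynomials. Powers of positive reals are positive.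
   Formalization: In (ii) the exponent term 2πiε₀n/t is corrected to 2πiε₀n/(2pt), since the printed form fails (e.g. p=2, r=0, s=1, k=0, ε₀=1); in (iii) the quotient of sinh's, which is 0/0 at ε, is read as its holomorphic extension. *)

theory Defs
  imports
    "HOL-Complex_Analysis.Complex_Analysis"
    "HOL-Library.Landau_Symbols"
    "HOL-Computational_Algebra.Formal_Power_Series"
begin

definition qpow :: "complex \<Rightarrow> real \<Rightarrow> complex" where
  "qpow \<tau> x = exp (2 * of_real pi * \<i> * of_real x * \<tau>)"

text \<open>
  The series converges absolutely whenever \<open>Im \<tau> > 0\<close>.
\<close>
definition singlet_C :: "nat \<Rightarrow> int \<Rightarrow> nat \<Rightarrow> complex \<Rightarrow> complex \<Rightarrow> complex" where
  "singlet_C p r s \<epsilon> \<tau> =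
     (\<Sum>n::nat.
        (let m = 2 * real p * real n - real s - real p * of_int r + 2 * real p
         in exp (2 * of_real pi * \<epsilon> / of_real (sqrt (2 * real p)) * of_real m)
              * qpow \<tau> (m\<^sup>2 / (4 * real p)))
      - (let m = 2 * real p * real n + real s - real p * of_int r + 2 * real p
         in exp (2 * of_real pi * \<epsilon> / of_real (sqrt (2 * real p)) * of_real m)
              * qpow \<tau> (m\<^sup>2 / (4 * real p))))"

definition D_eps :: "(complex \<Rightarrow> complex) \<Rightarrow> complex \<Rightarrow> complex" where
  "D_eps f = (\<lambda>\<epsilon>. 1 / (2 * of_real pi * \<i>) * deriv f \<epsilon>)"

definition sinh_quot :: "nat \<Rightarrow> int \<Rightarrow> nat \<Rightarrow> complex \<Rightarrow> complex" where
  "sinh_quot p r s \<epsilon> =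
     exp (of_real pi * of_real (sqrt (2 * real p)) * (1 - of_int r) * \<epsilon>)
       * sinh (of_real (sqrt (2 / real p)) * of_real pi * of_nat s * \<epsilon>)
       / sinh (of_real (sqrt (2 * real p)) * of_real pi * \<epsilon>)"

text \<open>
  For \<open>\<epsilon> = \<i> k / sqrt (2 p)\<close> with \<open>k\<close> an integer, numerator and denominator of this quotient both
  vanish.  The singularity is removable (the quotient is a finite sum of exponentials), and
  the mathematical function is the holomorphic one; \<^const>\<open>remove_sings\<close> supplies it, since
  division by zero would yield the value \<open>0\<close> there.
\<close>
definition sinh_quot_corr :: "nat \<Rightarrow> int \<Rightarrow> nat \<Rightarrow> complex \<Rightarrow> complex" where
  "sinh_quot_corr p r s = remove_sings (\<lambda>\<epsilon>.
     exp (2 * of_real pi * \<epsilon> * ((of_nat s - of_nat p) / of_real (sqrt (2 * real p))))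
       * (sinh (of_real (sqrt (2 * real p)) * (of_int r - 2) * of_real pi * \<epsilon>)
            / sinh (of_real (sqrt (2 * real p)) * of_real pi * \<epsilon>)))"

text \<open>
  Bernoulli polynomials, by the generating function
  \<open>z e^(x z) / (e^z - 1) = (\<Sum>n. B_n(x) z^n / n!)\<close>.
\<close>
definition bernoulli_poly :: "nat \<Rightarrow> real \<Rightarrow> real" where
  "bernoulli_poly n x = fact n * fps_nth (fps_X * fps_exp x / (fps_exp 1 - 1)) n"

lemma bernoulli_poly_gf:
  "Abs_fps (\<lambda>n. bernoulli_poly n x / fact n) * (fps_exp 1 - 1) = fps_X * fps_exp x"
proof -
  have ne: "fps_exp (1::real) - 1 \<noteq> 0"
  proof
    assume "fps_exp (1::real) - 1 = 0"
    then have "fps_nth (fps_exp (1::real) - 1) 1 = 0" by simp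
    then show False by simp
  qed
  have "subdegree (fps_exp (1::real) - 1) = 1"
    by (rule subdegreeI) auto
  moreover have "subdegree (fps_X * fps_exp x) = 1"
    by (rule subdegreeI) auto
  ultimately have "fps_exp 1 - 1 dvd fps_X * fps_exp x"
    using ne by (subst fps_dvd_iff) auto
  then have "fps_X * fps_exp x / (fps_exp 1 - 1) * (fps_exp 1 - 1) = fps_X * fps_exp x"
    by simp
  moreover have "Abs_fps (\<lambda>n. bernoulli_poly n x / fact n)
      = fps_X * fps_exp x / (fps_exp 1 - 1)"
    by (simp add: fps_eq_iff bernoulli_poly_def)
  ultimately show ?thesis by simp
qed

text \<open>
  The exponent below is the expansion of \<open>\<pi> (\<epsilon>0 + \<i> n)\<^sup>2 / (2 p t)\<close>, as produced by Poisson
  summation.  In print the mixed term appears as \<open>2 \<pi> \<i> \<epsilon>0 n / t\<close>, without the factor \<open>2 p\<close> in the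
  denominator; with that exponent the expansion fails as soon as indices \<open>n \<noteq> 0\<close> contribute
  (for instance \<open>p = 2, r = 0, s = 1, k = 0, \<epsilon>0 = 1\<close>).
\<close>
definition theta_main :: "nat \<Rightarrow> int \<Rightarrow> nat \<Rightarrow> int \<Rightarrow> real \<Rightarrow> real \<Rightarrow> real \<Rightarrow> complex" where
  "theta_main p r s k u0 v0 t =
     (let \<epsilon>0 = of_real u0 + \<i> * of_real v0 in
      - 2 * \<i> * of_real ((2 * real p * t) powr (- 1 / 2))
        * exp (of_real pi * \<epsilon>0\<^sup>2 / of_real (2 * real p * t))
        * (\<Sum>n | \<bar>of_int n + v0\<bar> \<le> \<bar>u0\<bar>.
             (- 1) powi (r * (k + n)) * of_real (sin (pi * real s * of_int (k - n) / real p))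
             * exp (- of_real pi * (of_int n)\<^sup>2 / of_real (2 * real p * t)
                    + 2 * of_real pi * \<i> * \<epsilon>0 * of_int n / of_real (2 * real p * t))))"

end

theory Submission
  imports Defs "HOL-Probability.Probability"
begin

text \<open>
  With \<open>\<tau> = 2\<pi>pt\<close> and \<open>w = 2\<pi>(\<epsilon>\<^sub>0 + ik)\<close> the character is a difference of two partial theta functions
  \<open>\<Sum>n\<ge>0. exp (w(n+x) - \<tau>(n+x)\<^sup>2)\<close>. For \<open>Re w < 0\<close> the expansion follows by expanding \<open>exp (-\<tau>(n+x)\<^sup>2)\<close>
  term by term, with an error \<open>O(\<tau>\<^bsup>N+1\<^esup> \<bar>Re w\<bar>\<^bsup>-2N-3\<^esup>)\<close>. For \<open>Re w > 0\<close> one completes the sum to all integers: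
  the extra half is a partial theta function at \<open>-w\<close>, and Poisson summation turns the full sum into
  Gaussians of which only those with \<open>\<bar>n + v\<^sub>0\<bar> \<le> \<bar>u\<^sub>0\<bar>\<close> are not exponentially small. On the imaginary axis
  the two one-sided bounds are glued by the maximum principle on a small circle, after multiplication
  by a power of a function that vanishes where the circle meets the axis. For \<open>w \<in> 2\<pi>i\<int>\<close> this is
  applied to the difference of the partial theta functions at \<open>x\<close> and \<open>1 - x\<close>, in which the polar terms
  cancel, while their sum is a full theta function.
\<close>

section \<open>Gaussian integrals and the partial theta function\<close>

text \<open>The bounds in the two half planes blow up at the axis only like |Re w|^(-2N-3), with an
  exponent independent of \<tau>; hence one fixed power of the vanishing factor works for all
  \<tau>. In the right half of the circle the discarded Gaussians must be small uniformly in w, so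
  the truncation constant of the Poisson sum may depend only on a gap in the exponents. Near 2 pi i
  v with v an integer, the Gaussian of index v is not small. It drops out of a difference of shifts
  x and y when e^(2 pi i v x) = e^(2 pi i v y), which is also the condition for the poles to cancel.
  The shifts 1 - r/2 - s/(2p) and 1 - r/2 + s/(2p) of the character violate it in general. Each
  partial theta function is therefore carried to w = 0, where the condition is trivial and x can be
  paired with 1 - x; odd Bernoulli polynomials enter because B(1 - x) = -B(x). The extra sinh
  quotient in the statement at these points only converts B at 1 - r/2 + s/(2p) into B at a point
  that differs from it by the integer r - 2.\<close>

lemma has_bochner_integral_gaussian:
  fixes \<tau> :: real and c :: complex
  assumes "\<tau> > 0"
  shows "has_bochner_integral lborel (\<lambda>y. exp (c * of_real y - of_real \<tau> * (of_real y)\<^sup>2))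
           (of_real (sqrt (pi / \<tau>)) * exp (c\<^sup>2 / (4 * of_real \<tau>)))"
proof -
  define a b where "a = Re c" and "b = Im c"
  \<comment> \<open>With this scale, x |-> d x - a/d carries half a square to
    \<open>\<tau> * x\<^sup>2 - a * x\<close> plus a constant, so the real part of \<open>c\<close>
    only moves the mean of a normal law.\<close>
  define d where "d = sqrt (2 * \<tau>)"
  have d: "d > 0" "d\<^sup>2 = 2 * \<tau>" using assms by (auto simp: d_def)
  have c: "c = of_real a + \<i> * of_real b" by (simp add: a_def b_def complex_eq_iff)
  \<comment> \<open>The imaginary part of \<open>c\<close> becomes the frequency at which the
    characteristic function is taken: T d x = b x.\<close>
  define T where "T = b / d"
  have "integrable std_normal_distribution (\<lambda>x. iexp (T * x))"
    using prob_space.finite_measure[OF prob_space_normal_density[of 1 0]]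
    by (intro finite_measure.integrable_const_bound[where B=1]) auto
  then have "has_bochner_integral std_normal_distribution (\<lambda>x. iexp (T * x)) (exp (- (T^2) / 2))"
    using fun_cong[OF char_std_normal_distribution, of T]
    by (simp add: has_bochner_integral_iff char_def)
  then have "has_bochner_integral lborel (\<lambda>x. std_normal_density x *\<^sub>R iexp (T * x)) (exp (- (T^2) / 2))"
    by (subst (asm) has_bochner_integral_iff, subst has_bochner_integral_iff)
       (auto simp: integrable_density integral_density)
  then have "has_bochner_integral lborel
      (\<lambda>x. std_normal_density (- a / d + d * x) *\<^sub>R iexp (T * (- a / d + d * x))) (complex_of_real (exp (- (T^2) / 2)) /\<^sub>R \<bar>d\<bar>)"
    using d by (subst (asm) lborel_has_bochner_integral_real_affine_iff[where c=d and t="-a/d"]) auto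
  then have *: "has_bochner_integral lborel
      (\<lambda>x. (of_real (sqrt (2 * pi)) * exp (of_real (a\<^sup>2/(4*\<tau>)) + \<i> * of_real (a * b / (2*\<tau>))))
         * (std_normal_density (- a / d + d * x) *\<^sub>R iexp (T * (- a / d + d * x))))
      ((of_real (sqrt (2 * pi)) * exp (of_real (a\<^sup>2/(4*\<tau>)) + \<i> * of_real (a * b / (2*\<tau>))))
         * (complex_of_real (exp (- (T^2) / 2)) /\<^sub>R \<bar>d\<bar>))"
    by (rule has_bochner_integral_mult_right)
  have 1: "(of_real (sqrt (2 * pi)) * exp (of_real (a\<^sup>2/(4*\<tau>)) + \<i> * of_real (a * b / (2*\<tau>))))
         * (std_normal_density (- a / d + d * x) *\<^sub>R iexp (T * (- a / d + d * x)))
      = exp (c * of_real x - of_real \<tau> * (of_real x)\<^sup>2)" for x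
  proof -
    have e1: "(- a / d + d * x)\<^sup>2 / 2 = a\<^sup>2/(4*\<tau>) - a * x + \<tau> * x\<^sup>2"
    proof -
      have "(- a / d + d * x)\<^sup>2 = a\<^sup>2 / d\<^sup>2 - 2 * a * x + d\<^sup>2 * x\<^sup>2"
        using d(1) by (simp add: power2_eq_square field_simps)
      then show ?thesis unfolding d(2) by (simp add: field_simps)
    qed
    have e2: "T * (- a / d + d * x) = - (a * b / (2*\<tau>)) + b * x"
      using d assms unfolding T_def d(2)[symmetric] by (simp add: field_simps power2_eq_square)
    have "std_normal_density (- a / d + d * x) = exp (- (a\<^sup>2/(4*\<tau>) - a * x + \<tau> * x\<^sup>2)) / sqrt (2 * pi)"
    proof -
      have "- (- a / d + d * x)\<^sup>2 / 2 = - (a\<^sup>2/(4*\<tau>) - a * x + \<tau> * x\<^sup>2)" using e1 by linarith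
      then show ?thesis unfolding std_normal_density_def by simp
    qed
    then have "complex_of_real (std_normal_density (- a / d + d * x)) = exp (of_real (- (a\<^sup>2/(4*\<tau>) - a * x + \<tau> * x\<^sup>2))) / of_real (sqrt (2 * pi))"
      by (simp only: exp_of_real[symmetric] of_real_divide)
    then show ?thesis unfolding e2 c scaleR_conv_of_real
      by (simp add: exp_add[symmetric] algebra_simps)
  qed
  have 2: "(of_real (sqrt (2 * pi)) * exp (of_real (a\<^sup>2/(4*\<tau>)) + \<i> * of_real (a * b / (2*\<tau>))))
         * (complex_of_real (exp (- (T^2) / 2)) /\<^sub>R \<bar>d\<bar>) = of_real (sqrt (pi / \<tau>)) * exp (c\<^sup>2 / (4 * of_real \<tau>))"
  proof -
    have "sqrt (2 * pi) / d = sqrt (pi / \<tau>)"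
      using assms by (simp add: d_def real_sqrt_divide[symmetric] del: real_sqrt_divide)
    then have s: "complex_of_real (sqrt (2*pi)) / of_real d = of_real (sqrt (pi/\<tau>))"
      by (metis of_real_divide)
    have T2: "T\<^sup>2 / 2 = b\<^sup>2 / (4 * \<tau>)" using d(2) by (simp add: T_def power_divide)
    have c2: "c\<^sup>2 / (4 * of_real \<tau>) = of_real (a\<^sup>2/(4*\<tau>)) + \<i> * of_real (a * b / (2*\<tau>)) + of_real (- (b\<^sup>2/(4*\<tau>)))"
      using assms by (simp add: c power2_sum power_mult_distrib field_simps)
    have "complex_of_real (exp (- (T^2) / 2)) = exp (of_real (- (b\<^sup>2/(4*\<tau>))))"
      using T2 by (simp add: exp_of_real[symmetric])
    then show ?thesis using d s unfolding c2 exp_add[of "_ + _"] scaleR_conv_of_real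
      by (simp add: field_simps)
  qed
  show ?thesis using * unfolding 1 2 .
qed

text \<open>Unfolding the theta series yields integrals over [-M, M] only; dominated convergence
  supplies the limit.\<close>

lemma LIMSEQ_integral_symmetric_interval:
  fixes f :: "real \<Rightarrow> complex"
  assumes "has_bochner_integral lborel f I"
  shows "(\<lambda>M. integral {- real M..real M} f) \<longlonglongrightarrow> I"
proof -
  have i: "integrable lborel f" and I: "integral\<^sup>L lborel f = I"
    using assms by (auto simp: has_bochner_integral_iff)
  have [measurable]: "f \<in> borel_measurable borel" using i by auto
  have "(\<lambda>M. \<integral>x. indicator {- real M..real M} x *\<^sub>R f x \<partial>lborel) \<longlonglongrightarrow> \<integral>x. f x \<partial>lborel"
  proof (rule integral_dominated_convergence[where w="\<lambda>x. norm (f x)"])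
    show "AE x in lborel. (\<lambda>M. indicator {- real M..real M} x *\<^sub>R f x) \<longlonglongrightarrow> f x"
    proof (rule AE_I2)
      fix x :: real
      have "\<forall>\<^sub>F M in sequentially. real M \<ge> \<bar>x\<bar>"
        using eventually_ge_at_top[of "nat \<lceil>\<bar>x\<bar>\<rceil>"] by eventually_elim linarith
      then have "\<forall>\<^sub>F M in sequentially. indicator {- real M..real M} x *\<^sub>R f x = f x"
        by eventually_elim (auto simp: indicator_def)
      then show "(\<lambda>M. indicator {- real M..real M} x *\<^sub>R f x) \<longlonglongrightarrow> f x"
        by (rule tendsto_eventually)
    qed
  qed (use i in \<open>auto simp: indicator_def\<close>)
  moreover have "(\<integral>x. indicator {- real M..real M} x *\<^sub>R f x \<partial>lborel) = integral {- real M..real M} f" for M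
  proof -
    have "set_integrable lborel {- real M..real M} f"
      using i unfolding set_integrable_def by (intro integrable_mult_indicator) auto
    from set_borel_integral_eq_integral(2)[OF this] show ?thesis
      by (simp add: set_lebesgue_integral_def)
  qed
  ultimately show ?thesis using I by simp
qed

text \<open>The shift \<open>y\<close> is complex because the Poisson argument works with an entire
  function of it.\<close>

definition partial_theta :: "real \<Rightarrow> complex \<Rightarrow> complex \<Rightarrow> complex" where
  "partial_theta \<tau> w y = (\<Sum>n. exp (w * (of_nat n + y) - of_real \<tau> * (of_nat n + y)\<^sup>2))"

lemma summable_gaussian_powser:
  fixes z :: complex
  assumes "\<tau> > 0"
  shows "summable (\<lambda>n. of_real (exp (- \<tau> * (real n)\<^sup>2)) * z ^ n)"
proof -
  \<comment> \<open>The n-th term is the n-th power of exp (-\<tau> n) |z| in modulus, and this base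
    tends to 0 for every z: a root test.\<close>
  have "eventually (\<lambda>n. exp (- \<tau> * real n) * norm z \<le> 1/2) sequentially"
  proof -
    have "((\<lambda>n. exp (- \<tau> * real n) * norm z) \<longlongrightarrow> 0 * norm z) sequentially"
      using assms by (intro tendsto_intros filterlim_compose[OF exp_at_bot]
         filterlim_tendsto_neg_mult_at_bot[OF tendsto_const] filterlim_real_sequentially) auto
    then show ?thesis by (intro order_tendstoD(2)[THEN eventually_mono, of _ 0 _ "1/2"]) auto
  qed
  then obtain K where K: "\<And>n. n \<ge> K \<Longrightarrow> exp (- \<tau> * real n) * norm z \<le> 1/2"
    by (auto simp: eventually_sequentially)
  show ?thesis
  proof (rule summable_comparison_test'[where N=K and g="\<lambda>n. (1/2) ^ n"])
    fix n assume "n \<ge> K"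
    have "exp (- \<tau> * (real n)\<^sup>2) = exp (- \<tau> * real n) ^ n"
      by (subst exp_of_nat_mult[symmetric]) (simp add: power2_eq_square)
    then have "norm (of_real (exp (- \<tau> * (real n)\<^sup>2)) * z ^ n) = (exp (- \<tau> * real n) * norm z) ^ n"
      by (simp only: norm_mult norm_power power_mult_distrib norm_of_real abs_exp_cancel abs_power2 power_abs)
    also have "\<dots> \<le> (1/2)^n" using K[OF \<open>n \<ge> K\<close>] by (intro power_mono) auto
    finally show "norm (of_real (exp (- \<tau> * (real n)\<^sup>2)) * z ^ n) \<le> (1/2)^n" .
  qed (simp add: summable_geometric)
qed

text \<open>Expanding the square isolates a factor free of \<open>n\<close> and a power of exp (w -
  2 \<tau> y). The theta function becomes an entire power series composed with an exponential, from
  which convergence and holomorphy in both arguments follow.\<close>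

lemma partial_theta_term:
  fixes w y :: complex
  shows
  "exp (w * (of_nat n + y) - of_real \<tau> * (of_nat n + y)\<^sup>2) =
     exp (w * y - of_real \<tau> * y\<^sup>2) * (of_real (exp (- \<tau> * (real n)\<^sup>2)) * exp (w - 2 * of_real \<tau> * y) ^ n)"
proof -
  have "complex_of_real (exp (- \<tau> * (real n)\<^sup>2)) = exp (- of_real \<tau> * (of_nat n)\<^sup>2)"
    by (simp flip: exp_of_real)
  moreover have "w * (of_nat n + y) - of_real \<tau> * (of_nat n + y)\<^sup>2
      = (w * y - of_real \<tau> * y\<^sup>2) + (- of_real \<tau> * (of_nat n)\<^sup>2 + of_nat n * (w - 2 * of_real \<tau> * y))"
    by (simp add: power2_eq_square algebra_simps)
  ultimately show ?thesis by (simp only: exp_add exp_of_nat_mult)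
qed

lemma partial_theta_sums:
  assumes "\<tau> > 0"
  shows "(\<lambda>n. exp (w * (of_nat n + y) - of_real \<tau> * (of_nat n + y)\<^sup>2)) sums partial_theta \<tau> w y"
  unfolding partial_theta_def
  by (rule summable_sums, subst partial_theta_term) (intro summable_mult summable_gaussian_powser assms)

lemma partial_theta_conv_powser:
  assumes "\<tau> > 0"
  shows "partial_theta \<tau> w y = exp (w * y - of_real \<tau> * y\<^sup>2)
           * (\<Sum>n. of_real (exp (- \<tau> * (real n)\<^sup>2)) * exp (w - 2 * of_real \<tau> * y) ^ n)"
  unfolding partial_theta_def
  by (subst partial_theta_term) (intro suminf_mult summable_gaussian_powser assms)

lemma holomorphic_on_gaussian_powser:
  assumes "\<tau> > 0"
  shows "(\<lambda>z::complex. \<Sum>n. of_real (exp (- \<tau> * (real n)\<^sup>2)) * z ^ n) holomorphic_on A"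
proof -
  have "(\<lambda>z::complex. \<Sum>n. of_real (exp (- \<tau> * (real n)\<^sup>2)) * z ^ n) field_differentiable at z" for z
    using termdiffs_strong_converges_everywhere[OF summable_gaussian_powser[OF assms], of z]
    by (auto simp: field_differentiable_def)
  then show ?thesis
    by (auto simp: holomorphic_on_def intro: field_differentiable_at_within)
qed

lemma holomorphic_on_partial_theta [holomorphic_intros]:
  assumes "\<tau> > 0" "f holomorphic_on A" "g holomorphic_on A"
  shows "(\<lambda>z. partial_theta \<tau> (f z) (g z)) holomorphic_on A"
  unfolding partial_theta_conv_powser[OF assms(1)]
  by (intro holomorphic_intros assms
        holomorphic_on_compose[OF _ holomorphic_on_gaussian_powser[OF assms(1)], unfolded o_def])

text \<open>The sum over all integers, cut between -1 and 0: replacing n by -n-1 turns the negative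
  half into a partial theta function at \<open>- w\<close> and \<open>1 - y\<close>. This form makes
  the reflection of remainders immediate.\<close>

definition full_theta :: "real \<Rightarrow> complex \<Rightarrow> complex \<Rightarrow> complex" where
  "full_theta \<tau> w y = partial_theta \<tau> w y + partial_theta \<tau> (- w) (1 - y)"

lemma full_theta_sums:
  fixes w y :: complex
  assumes "\<tau> > 0"
  defines "g \<equiv> \<lambda>y. exp (w * y - of_real \<tau> * y\<^sup>2)"
  shows "(\<lambda>n. g (y + of_nat n) + g (y - of_nat (Suc n))) sums full_theta \<tau> w y"
proof -
  have "- w * (of_nat n + (1 - y)) - of_real \<tau> * (of_nat n + (1 - y))\<^sup>2
       = w * (y - of_nat (Suc n)) - of_real \<tau> * (y - of_nat (Suc n))\<^sup>2" for n
    by (simp add: power2_eq_square algebra_simps)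
  with sums_add[OF partial_theta_sums[OF assms(1), of w y] partial_theta_sums[OF assms(1), of "-w" "1-y"]]
  show ?thesis unfolding g_def full_theta_def by (simp only: add.commute[of y])
qed

text \<open>Moving \<open>y\<close> by one moves the cut: the term at \<open>y\<close> leaves one
  half and enters the other.\<close>

lemma full_theta_plus_1:
  assumes "\<tau> > 0"
  shows "full_theta \<tau> w (y + 1) = full_theta \<tau> w y"
proof -
  define g where "g y = exp (w * y - of_real \<tau> * y\<^sup>2)" for y
  have 1: "partial_theta \<tau> w y = g y + partial_theta \<tau> w (y + 1)"
  proof -
    have "(\<lambda>n. exp (w * (of_nat (Suc n) + y) - of_real \<tau> * (of_nat (Suc n) + y)\<^sup>2)) sums partial_theta \<tau> w (y+1)"
      using partial_theta_sums[OF assms, of w "y+1"] by (simp add: algebra_simps)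
    from sums_Suc[OF this] partial_theta_sums[OF assms, of w y] show ?thesis
      by (auto simp: g_def dest: sums_unique2)
  qed
  have 2: "partial_theta \<tau> (-w) (1 - (y + 1)) = g y + partial_theta \<tau> (-w) (1 - y)"
  proof -
    have "(\<lambda>n. exp (- w * (of_nat (Suc n) + (1 - (y + 1))) - of_real \<tau> * (of_nat (Suc n) + (1 - (y + 1)))\<^sup>2)) sums partial_theta \<tau> (-w) (1 - y)"
      using partial_theta_sums[OF assms, of "-w" "1-y"] by (simp add: algebra_simps)
    from sums_Suc[OF this] partial_theta_sums[OF assms, of "-w" "1 - (y + 1)"] show ?thesis
      by (auto simp: g_def dest: sums_unique2)
  qed
  show ?thesis unfolding full_theta_def 1 2 by simp
qed

section \<open>Poisson summation\<close>

lemma exp_2pi_i_eq_1_iff: "exp (2 * of_real pi * \<i> * z) = 1 \<longleftrightarrow> z \<in> \<int>"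
proof -
  have "2 * of_real pi * \<i> * z = of_int (2 * n) * (of_real pi * \<i>) \<longleftrightarrow> z = of_int n" for n
    by auto
  then show ?thesis unfolding exp_eq_1
    by (auto simp: complex_eq_iff Ints_def)
qed

text \<open>The zeros of e^(2 pi i z) - 1 are the integers, all simple; the ball contains only 0 and
  1, and periodicity makes \<open>f\<close> vanish at 1 too. A neighbourhood of [0,1] suffices
  because only integrals over that interval are formed.\<close>

lemma entire_periodic_divide:
  fixes f :: "complex \<Rightarrow> complex"
  assumes f: "f holomorphic_on UNIV" and per: "\<And>z. f (z + 1) = f z" and "f 0 = 0"
  shows "\<exists>k. k holomorphic_on ball (1/2) 1 \<and>
    (\<forall>z\<in>ball (1/2) 1. f z = (exp (2 * of_real pi * \<i> * z) - 1) * k z)"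
proof -
  define E :: "complex \<Rightarrow> complex" where "E z = exp (2 * of_real pi * \<i> * z) - 1" for z
  \<comment> \<open>The same value serves at 0 and 1: it is the quotient of the derivatives at 0,
    and both \<open>f\<close> and the divisor have period 1.\<close>
  define k where "k z = (if z = 0 \<or> z = 1 then deriv f 0 / (2 * of_real pi * \<i>) else f z / E z)" for z
  have E0: "E z \<noteq> 0" if z: "z \<in> ball (1/2) 1 - {0, 1}" for z
  proof
    assume "E z = 0"
    then have "z \<in> \<int>" by (simp add: E_def exp_2pi_i_eq_1_iff)
    then obtain n where n: "z = of_int n" by (auto elim: Ints_cases)
    have "cmod (1/2 - z) = \<bar>1/2 - real_of_int n\<bar>"
      by (metis n norm_of_real of_real_1 of_real_diff of_real_divide of_real_numeral of_real_of_int_eq)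
    with z have "\<bar>1/2 - real_of_int n\<bar> < 1" by (simp add: dist_norm)
    then have "n = 0 \<or> n = 1" by linarith
    with z n show False by auto
  qed
  have f1: "f 1 = 0" using per[of 0] assms(3) by simp
  have lim0: "((\<lambda>z. f z / E z) \<longlongrightarrow> deriv f 0 / (2 * of_real pi * \<i>)) (at 0)"
  proof -
    have "(f has_field_derivative deriv f 0) (at 0)"
      using f by (intro holomorphic_derivI[of _ UNIV]) auto
    then have 1: "((\<lambda>z. f z / z) \<longlongrightarrow> deriv f 0) (at 0)"
      by (simp add: has_field_derivative_iff assms(3))
    have "(E has_field_derivative (2 * of_real pi * \<i>)) (at 0)"
      unfolding E_def by (auto intro!: derivative_eq_intros)
    then have 2: "((\<lambda>z. E z / z) \<longlongrightarrow> 2 * of_real pi * \<i>) (at 0)"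
      by (simp add: has_field_derivative_iff E_def)
    have "((\<lambda>z. (f z / z) / (E z / z)) \<longlongrightarrow> deriv f 0 / (2 * of_real pi * \<i>)) (at 0)"
      by (intro tendsto_intros 1 2) auto
    then show ?thesis
      by (rule Lim_transform_eventually) (auto simp: eventually_at_filter)
  qed
  have E_per: "E (z + 1) = E z" for z
    using exp_plus_2pin[of "2 * of_real pi * \<i> * z" 1] by (simp add: E_def algebra_simps)
  have lim1: "((\<lambda>z. f z / E z) \<longlongrightarrow> deriv f 0 / (2 * of_real pi * \<i>)) (at 1)"
    by (subst at_to_0) (use lim0 in \<open>simp add: filterlim_filtermap per E_per\<close>)
  have "k holomorphic_on ball (1/2) 1"
  proof (rule no_isolated_singularity'[where K="{0,1}"])
    fix z :: complex assume "z \<in> {0,1}"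
    then have "((\<lambda>z. f z / E z) \<longlongrightarrow> k z) (at z)" using lim0 lim1 by (auto simp: k_def)
    moreover have "\<forall>\<^sub>F x in at z. x \<noteq> 0 \<and> x \<noteq> 1"
      by (intro eventually_conj eventually_neq_at_within)
    then have "\<forall>\<^sub>F x in at z. f x / E x = k x"
      by eventually_elim (auto simp: k_def)
    ultimately have "(k \<longlongrightarrow> k z) (at z)" by (rule Lim_transform_eventually)
    then show "(k \<longlongrightarrow> k z) (at z within ball (1/2) 1)"
      by (rule tendsto_within_subset) auto
  next
    have "(\<lambda>z. f z / E z) holomorphic_on (ball (1/2) 1 - {0,1})"
      using E0 unfolding E_def by (intro holomorphic_intros holomorphic_on_subset[OF f]) auto
    then show "k holomorphic_on (ball (1/2) 1 - {0,1})"
      by (rule holomorphic_transform) (auto simp: k_def)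
  qed auto
  moreover have "f z = (exp (2 * of_real pi * \<i> * z) - 1) * k z" if "z \<in> ball (1/2) 1" for z
  proof (cases "z = 0 \<or> z = 1")
    case True
    then have "exp (2 * of_real pi * \<i> * z) = 1" by (subst exp_2pi_i_eq_1_iff) auto
    then show ?thesis using True f1 assms(3) by auto
  next
    case False
    then show ?thesis using E0[of z] that by (auto simp: k_def E_def)
  qed
  ultimately show ?thesis by blast
qed

text \<open>One integration by parts. Since \<open>k\<close> need not take equal values at 0 and 1,
  the boundary term \<open>k 1 - k 0\<close> stays and only the rate 1/|m| results; the telescoped
  sum needs no more.\<close>

lemma fourier_coeff_bound:
  fixes k :: "complex \<Rightarrow> complex"
  assumes k: "k holomorphic_on U" "open U" "of_real ` {0..1} \<subseteq> U"
  obtains C where "\<And>m::int. m \<noteq> 0 \<Longrightarrow>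
     norm (integral {0..1} (\<lambda>x. k (of_real x) * exp (- (2 * of_real pi * \<i> * of_int m * of_real x)))) \<le> C / \<bar>real_of_int m\<bar>"
proof -
  have c: "continuous_on {0..1} (\<lambda>x. k (of_real x))" "continuous_on {0..1} (\<lambda>x. deriv k (of_real x))"
    using k by (auto intro!: continuous_on_compose2[OF holomorphic_on_imp_continuous_on[OF k(1)]]
       continuous_on_compose2[OF holomorphic_on_imp_continuous_on[OF holomorphic_deriv[OF k(1,2)]]] continuous_intros)
  obtain B where B: "\<And>x. x \<in> {0..1} \<Longrightarrow> norm (deriv k (of_real x)) \<le> B"
    using compact_imp_bounded[OF compact_continuous_image[OF c(2)]]
    unfolding bounded_iff by auto (metis atLeastAtMost_iff)
  have "norm (integral {0..1} (\<lambda>x. k (of_real x) * exp (- (2 * of_real pi * \<i> * of_int m * of_real x))))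
      \<le> (B + norm (k 1 - k 0)) / (2 * pi) / \<bar>real_of_int m\<bar>" if m: "m \<noteq> 0" for m
  proof -
    define e where "e x = exp (- (2 * of_real pi * \<i> * of_int m * x))" for x :: complex
    define l where "l = 2 * of_real pi * \<i> * of_int m"
    have "((\<lambda>x. k x * e x) has_field_derivative (deriv k z * e z - l * (k z * e z))) (at z)" if "z \<in> U" for z
      unfolding e_def l_def
      by (auto intro!: derivative_eq_intros holomorphic_derivI[OF k(1,2) that] simp: algebra_simps)
    then have "((\<lambda>x. k (of_real x) * e (of_real x)) has_vector_derivative
         (deriv k (of_real x) * e (of_real x) - l * (k (of_real x) * e (of_real x)))) (at x within {0..1})" if "x \<in> {0..1}" for x :: real
      using that k(3) has_vector_derivative_real_field[of "\<lambda>x. k x * e x" _ x] by blast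
    from fundamental_theorem_of_calculus[OF _ this]
    have 1: "((\<lambda>x. deriv k (of_real x) * e (of_real x) - l * (k (of_real x) * e (of_real x))) has_integral
        (k 1 * e 1 - k 0 * e 0)) {0..1}" by simp
    have "e 1 = 1" using exp_2pi_i_eq_1_iff[of "of_int (-m)"] by (simp add: e_def)
    moreover have "e 0 = 1" by (simp add: e_def)
    moreover have ce: "continuous_on {0..1} (\<lambda>x::real. e (of_real x))"
      unfolding e_def by (intro continuous_intros)
    have i: "(\<lambda>x. deriv k (of_real x) * e (of_real x)) integrable_on {0..1}"
       "(\<lambda>x. k (of_real x) * e (of_real x)) integrable_on {0..1}"
      by (intro integrable_continuous_real continuous_intros c ce)+
    have "integral {0..1} (\<lambda>x. deriv k (of_real x) * e (of_real x) - l * (k (of_real x) * e (of_real x)))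
       = integral {0..1} (\<lambda>x. deriv k (of_real x) * e (of_real x)) - l * integral {0..1} (\<lambda>x. k (of_real x) * e (of_real x))"
      using i by (subst integral_diff) (auto intro: integrable_on_mult_right)
    ultimately have 3: "integral {0..1} (\<lambda>x. deriv k (of_real x) * e (of_real x)) - l * integral {0..1} (\<lambda>x. k (of_real x) * e (of_real x))
       = k 1 - k 0"
      using integral_unique[OF 1] by simp
    have 2: "l * integral {0..1} (\<lambda>x. k (of_real x) * e (of_real x))
       = integral {0..1} (\<lambda>x. deriv k (of_real x) * e (of_real x)) - (k 1 - k 0)"
      by (simp add: 3[symmetric])
    have ne: "norm (e (of_real x)) = 1" for x by (simp add: e_def)
    have "norm (integral {0..1} (\<lambda>x. deriv k (of_real x) * e (of_real x))) \<le> B * (1 - 0)"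
      by (rule integral_bound) (auto simp: norm_mult ne B intro!: continuous_intros c ce)
    then have "norm (l * integral {0..1} (\<lambda>x. k (of_real x) * e (of_real x))) \<le> B + norm (k 1 - k 0)"
      unfolding 2 by (intro order_trans[OF norm_triangle_ineq4]) auto
    moreover have "norm l = 2 * pi * \<bar>real_of_int m\<bar>" by (simp add: l_def norm_mult)
    ultimately show ?thesis using m by (simp add: norm_mult field_simps e_def)
  qed
  then show ?thesis using that by blast
qed

text \<open>Chernoff's trick: division by \<open>e\<^bsup>2\<pi>iz\<^esup> - 1\<close> turns the Fourier coefficients into
  differences of coefficients of a smooth function, so that their sum telescopes.\<close>

lemma fourier_series_at_zero:
  fixes f :: "complex \<Rightarrow> complex"
  assumes f: "f holomorphic_on UNIV" and per: "\<And>z. f (z + 1) = f z" and "f 0 = 0"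
  shows "(\<lambda>M. \<Sum>m\<in>{- int M<..int M}. integral {0..1}
            (\<lambda>x. f (of_real x) * exp (- (2 * of_real pi * \<i> * of_int m * of_real x)))) \<longlonglongrightarrow> 0"
proof -
  obtain k where k: "k holomorphic_on ball (1/2) 1"
    "\<And>z. z \<in> ball (1/2) 1 \<Longrightarrow> f z = (exp (2 * of_real pi * \<i> * z) - 1) * k z"
    using entire_periodic_divide[OF assms] by blast
  have sub: "complex_of_real x \<in> ball (1/2) 1" if "x \<in> {0..1}" for x
  proof -
    have "1/2 - complex_of_real x = of_real (1/2 - x)" by simp
    then have "cmod (1/2 - of_real x) = \<bar>1/2 - x\<bar>" by (simp only: norm_of_real)
    with that show ?thesis unfolding mem_ball dist_norm by auto
  qed
  have ck: "continuous_on {0..1} (\<lambda>x. k (of_real x))"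
    using sub by (auto intro!: continuous_on_compose2[OF holomorphic_on_imp_continuous_on[OF k(1)]] continuous_intros)
  define d where "d m = integral {0..1} (\<lambda>x. k (of_real x) * exp (- (2 * of_real pi * \<i> * of_int m * of_real x)))" for m :: int
  obtain C where C: "\<And>m::int. m \<noteq> 0 \<Longrightarrow> norm (d m) \<le> C / \<bar>real_of_int m\<bar>"
    using fourier_coeff_bound[OF k(1)] sub unfolding d_def by blast
  have a: "integral {0..1} (\<lambda>x. f (of_real x) * exp (- (2 * of_real pi * \<i> * of_int m * of_real x))) = d (m - 1) - d m" for m
  proof -
    have "integral {0..1} (\<lambda>x. f (of_real x) * exp (- (2 * of_real pi * \<i> * of_int m * of_real x)))
       = integral {0..1} (\<lambda>x. k (of_real x) * exp (- (2 * of_real pi * \<i> * of_int (m - 1) * of_real x))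
            - k (of_real x) * exp (- (2 * of_real pi * \<i> * of_int m * of_real x)))"
      by (rule integral_cong, subst k(2)[OF sub]) (auto simp: algebra_simps exp_add[symmetric])
    also have "\<dots> = d (m - 1) - d m" unfolding d_def
      by (rule integral_diff) (intro integrable_continuous_real continuous_intros ck)+
    finally show ?thesis .
  qed
  \<comment> \<open>The half-open range has 2M terms, so that the two ends left by telescoping are
    the indices -M and M.\<close>
  have tel: "(\<Sum>m\<in>{- int M<..int M}. d (m - 1) - d m) = d (- int M) - d (int M)" for M
  proof (induction M)
    case (Suc M)
    have "{- int (Suc M)<..int (Suc M)} = insert (- int M) (insert (int (Suc M)) {- int M<..int M})"
      by auto
    moreover have "d (- int M - 1) = d (- 1 - int M)" by (rule arg_cong[where f=d]) simp
    ultimately show ?case using Suc by simp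
  qed simp
  have "(\<lambda>M. d (- int M) - d (int M)) \<longlonglongrightarrow> 0"
  proof (rule Lim_null_comparison)
    show "\<forall>\<^sub>F M in sequentially. norm (d (- int M) - d (int M)) \<le> 2 * C / real M"
      using eventually_gt_at_top[of 0]
    proof eventually_elim
      case (elim M)
      then show ?case using C[of "int M"] C[of "- int M"]
          norm_triangle_ineq4[of "d (- int M)" "d (int M)"] by simp
    qed
    show "(\<lambda>M. 2 * C / real M) \<longlonglongrightarrow> 0"
      by (rule lim_const_over_n)
  qed
  then show ?thesis by (simp add: a tel)
qed

section \<open>Fourier coefficients of the full theta function\<close>

lemma partial_theta_summable_bound:
  fixes w :: complex
  assumes "\<tau> > 0" "compact K"
  obtains M where "summable M"
    "\<And>n z. z \<in> K \<Longrightarrow> norm (exp (w * (of_nat n + z) - of_real \<tau> * (of_nat n + z)\<^sup>2)) \<le> M n"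
proof -
  have "bounded ((\<lambda>z. exp (w * z - of_real \<tau> * z\<^sup>2)) ` K)" "bounded ((\<lambda>z. exp (w - 2 * of_real \<tau> * z)) ` K)"
    by (intro compact_imp_bounded compact_continuous_image assms continuous_intros)+
  then obtain A B where A: "\<And>z. z \<in> K \<Longrightarrow> norm (exp (w * z - of_real \<tau> * z\<^sup>2)) \<le> A"
    and B: "\<And>z. z \<in> K \<Longrightarrow> norm (exp (w - 2 * of_real \<tau> * z)) \<le> B"
    by (auto simp: bounded_iff)
  define M where "M n = \<bar>A\<bar> * (exp (- \<tau> * (real n)\<^sup>2) * \<bar>B\<bar> ^ n)" for n
  have "summable (\<lambda>n. complex_of_real (exp (- \<tau> * (real n)\<^sup>2) * \<bar>B\<bar> ^ n))"
    using summable_gaussian_powser[OF assms(1), of "of_real \<bar>B\<bar>"] by simp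
  then have "summable M" unfolding M_def summable_complex_of_real by (rule summable_mult)
  moreover have "norm (exp (w * (of_nat n + z) - of_real \<tau> * (of_nat n + z)\<^sup>2)) \<le> M n" if "z \<in> K" for n z
    unfolding partial_theta_term M_def norm_mult norm_power
    using A[OF that] B[OF that] by (intro mult_mono power_mono) auto
  ultimately show ?thesis using that by blast
qed

text \<open>Unfolding: translates of [0,1] tile the line and the exponential factor has period 1, so
  the coefficient is a Gaussian integral over the whole line.\<close>

lemma full_theta_fourier_coeff:
  fixes \<tau> y :: real and m :: int
  assumes "\<tau> > 0"
  shows "integral {0..1} (\<lambda>x. full_theta \<tau> w (of_real (y + x)) * exp (- (2 * of_real pi * \<i> * of_int m * of_real x)))
    = exp (2 * of_real pi * \<i> * of_int m * of_real y) * (of_real (sqrt (pi / \<tau>))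
        * exp ((w - 2 * of_real pi * \<i> * of_int m)\<^sup>2 / (4 * of_real \<tau>)))" (is "_ = ?R")
proof -
  define g where "g z = exp (w * z - of_real \<tau> * z\<^sup>2)" for z
  define e where "e x = exp (- (2 * of_real pi * \<i> * of_int m * of_real x))" for x :: real
  define G where "G x = g (of_real (y + x)) * e x" for x :: real
  have e_per: "e (x + of_int j) = e x" for x j
    using exp_plus_2pin[of "- (2 * of_real pi * \<i> * of_int m * of_real x)" "- m * j"] by (simp add: e_def algebra_simps)
  have ne: "norm (e x) = 1" for x by (simp add: e_def)
  have cG: "continuous_on A G" for A unfolding G_def g_def e_def by (intro continuous_intros)
  have "has_bochner_integral lborel G ?R"
  proof -
    let ?c = "w - 2 * of_real pi * \<i> * of_int m"
    \<comment> \<open>In this integrand the character is attached to y + x instead of x; the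
      constant factor exp (2 pi i m y) makes up for the difference.\<close>
    have "has_bochner_integral lborel (\<lambda>x. exp (?c * of_real (y + 1 * x) - of_real \<tau> * (of_real (y + 1 * x))\<^sup>2))
        ((of_real (sqrt (pi / \<tau>)) * exp (?c\<^sup>2 / (4 * of_real \<tau>))) /\<^sub>R \<bar>1\<bar>)"
      by (subst lborel_has_bochner_integral_real_affine_iff[symmetric]) (auto intro: has_bochner_integral_gaussian[OF assms])
    then have "has_bochner_integral lborel (\<lambda>x. exp (2 * of_real pi * \<i> * of_int m * of_real y) *
        exp (?c * of_real (y + 1 * x) - of_real \<tau> * (of_real (y + 1 * x))\<^sup>2))
       (exp (2 * of_real pi * \<i> * of_int m * of_real y) * ((of_real (sqrt (pi / \<tau>)) * exp (?c\<^sup>2 / (4 * of_real \<tau>))) /\<^sub>R \<bar>1\<bar>))"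
      by (rule has_bochner_integral_mult_right)
    moreover have "exp (2 * of_real pi * \<i> * of_int m * of_real y) *
        exp (?c * of_real (y + 1 * x) - of_real \<tau> * (of_real (y + 1 * x))\<^sup>2) = G x" for x
      unfolding G_def g_def e_def exp_add[symmetric] by (simp add: algebra_simps)
    ultimately show ?thesis by simp
  qed
  from LIMSEQ_integral_symmetric_interval[OF this]
  have lim: "(\<lambda>M. integral {- real M..real M} G) \<longlonglongrightarrow> ?R" .
  \<comment> \<open>The n-th terms of the two halves are paired; they cover [n, n+1] and [-n-1, -n],
    so that M pairs tile [-M, M].\<close>
  define f where "f n x = G (x + real n) + G (x - real (Suc n))" for n x
  have cf: "continuous_on A (f n)" for A n unfolding f_def
    by (intro continuous_intros continuous_on_compose2[OF cG[of UNIV]]) auto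
  have f_eq: "f n x = (g (of_real (y + x) + of_nat n) + g (of_real (y + x) - of_nat (Suc n))) * e x" for n x
    using e_per[of x "int n"] e_per[of x "- int (Suc n)"] by (simp add: f_def G_def algebra_simps)
  have part: "integral {0..1} (\<lambda>x. \<Sum>n<M. f n x) = integral {- real M..real M} G" for M
  proof (induction M)
    case (Suc M)
    have "integral {0..1} (\<lambda>x. G (x + real M)) = integral {real M..real (Suc M)} G"
      using integral_shift[OF cG, of 0 1 "real M"] by (simp add: add.commute o_def)
    moreover have "integral {0..1} (\<lambda>x. G (x - real (Suc M))) = integral {- real (Suc M)..- real M} G"
      using integral_shift[OF cG, of 0 1 "- real (Suc M)"] by (simp add: add.commute o_def algebra_simps)
    moreover have "integral {0..1} (f M) = integral {0..1} (\<lambda>x. G (x + real M)) + integral {0..1} (\<lambda>x. G (x - real (Suc M)))"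
      unfolding f_def by (intro integral_add integrable_continuous_real continuous_on_compose2[OF cG[of UNIV]] continuous_intros) auto
    moreover have "integral {- real (Suc M)..real (Suc M)} G = integral {- real (Suc M)..- real M} G + integral {- real M..real M} G
        + integral {real M..real (Suc M)} G"
    proof -
      have ii: "G integrable_on A" if "A = {a..b}" for A a b using that cG by (auto intro: integrable_continuous_real)
      have "integral {- real (Suc M)..- real M} G + integral {- real M..real M} G = integral {- real (Suc M)..real M} G"
        by (rule Henstock_Kurzweil_Integration.integral_combine) (auto intro: ii)
      moreover have "integral {- real (Suc M)..real M} G + integral {real M..real (Suc M)} G = integral {- real (Suc M)..real (Suc M)} G"
        by (rule Henstock_Kurzweil_Integration.integral_combine) (auto intro: ii)
      ultimately show ?thesis by simp
    qed
    moreover have "integral {0..1} (\<lambda>x. \<Sum>n<Suc M. f n x) = integral {0..1} (\<lambda>x. \<Sum>n<M. f n x) + integral {0..1} (f M)"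
      unfolding sum.lessThan_Suc
      by (intro integral_add integrable_continuous_real continuous_intros cf)
    ultimately show ?case using Suc by simp
  qed simp
  have K: "compact ((\<lambda>x. complex_of_real (y + x)) ` {0..1})"
    by (intro compact_continuous_image continuous_intros) auto
  have K2: "compact ((\<lambda>x. 1 - complex_of_real (y + x)) ` {0..1})"
    by (intro compact_continuous_image continuous_intros) auto
  obtain M1 where M1: "summable M1" "\<And>n x. x \<in> {0..1} \<Longrightarrow> norm (g (of_real (y + x) + of_nat n)) \<le> M1 n"
    using partial_theta_summable_bound[OF assms K, of w] unfolding g_def
    by (metis (no_types, lifting) add.commute imageI)
  obtain M2 where M2: "summable M2" "\<And>n x. x \<in> {0..1} \<Longrightarrow> norm (g (of_real (y + x) - of_nat (Suc n))) \<le> M2 n"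
  proof -
    obtain M2 where M2: "summable M2"
      "\<And>n x. x \<in> {0..1} \<Longrightarrow> norm (exp (- w * (of_nat n + (1 - complex_of_real (y + x))) - of_real \<tau> * (of_nat n + (1 - complex_of_real (y + x)))\<^sup>2)) \<le> M2 n"
      using partial_theta_summable_bound[OF assms K2, of "-w"] by (metis (no_types, lifting) imageI)
    have "- w * (of_nat n + (1 - z)) - of_real \<tau> * (of_nat n + (1 - z))\<^sup>2
       = w * (z - of_nat (Suc n)) - of_real \<tau> * (z - of_nat (Suc n))\<^sup>2" for n z
      by (simp add: power2_eq_square algebra_simps)
    with M2 show ?thesis by (intro that[of M2]) (simp_all only: g_def)
  qed
  have "uniform_limit {0..1} (\<lambda>M x. \<Sum>n<M. f n x) (\<lambda>x. \<Sum>n. f n x) sequentially"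
  proof (rule Weierstrass_m_test)
    show "summable (\<lambda>n. M1 n + M2 n)" by (intro summable_add M1 M2)
    show "norm (f n x) \<le> M1 n + M2 n" if "x \<in> {0..1}" for n x
      unfolding f_eq norm_mult ne using M1(2)[OF that, of n] M2(2)[OF that, of n]
        norm_triangle_ineq[of "g (of_real (y + x) + of_nat n)" "g (of_real (y + x) - of_nat (Suc n))"] by linarith
  qed
  moreover have "(\<Sum>n. f n x) = full_theta \<tau> w (of_real (y + x)) * e x" for x
    unfolding f_eq g_def by (intro sums_unique[symmetric] sums_mult2 full_theta_sums[OF assms])
  ultimately have u: "uniform_limit {0..1} (\<lambda>M x. \<Sum>n<M. f n x) (\<lambda>x. full_theta \<tau> w (of_real (y + x)) * e x) sequentially"
    by simp
  obtain I J where IJ: "\<And>M. ((\<lambda>x. \<Sum>n<M. f n x) has_integral I M) {0..1}"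
    "((\<lambda>x. full_theta \<tau> w (of_real (y + x)) * e x) has_integral J) {0..1}" "I \<longlonglongrightarrow> J"
    by (rule uniform_limit_integral[OF u]) (auto intro!: continuous_on_sum cf)
  have "I M = integral {- real M..real M} G" for M
    using integral_unique[OF IJ(1)[of M]] part[of M] by simp
  then have "I = (\<lambda>M. integral {- real M..real M} G)" by blast
  then have "J = ?R" using LIMSEQ_unique[OF IJ(3)] lim by simp
  then show ?thesis using IJ(2) by (simp add: e_def integral_unique)
qed

text \<open>Subtracting the value at \<open>y\<close> gives a periodic entire function that vanishes
  at 0, as division by e^(2 pi i z) - 1 requires; the subtraction changes the zeroth Fourier
  coefficient alone.\<close>

theorem full_theta_poisson:
  fixes \<tau> y :: real
  assumes "\<tau> > 0"
  shows "(\<lambda>M. \<Sum>m\<in>{- int M<..int M}. exp (2 * of_real pi * \<i> * of_int m * of_real y) * (of_real (sqrt (pi / \<tau>))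
        * exp ((w - 2 * of_real pi * \<i> * of_int m)\<^sup>2 / (4 * of_real \<tau>)))) \<longlonglongrightarrow> full_theta \<tau> w (of_real y)"
proof -
  define c where "c m = exp (2 * of_real pi * \<i> * of_int m * of_real y) * (of_real (sqrt (pi / \<tau>))
        * exp ((w - 2 * of_real pi * \<i> * of_int m)\<^sup>2 / (4 * of_real \<tau>)))" for m :: int
  define \<theta> where "\<theta> = full_theta \<tau> w (of_real y)"
  define f where "f z = full_theta \<tau> w (of_real y + z) - \<theta>" for z
  define e where "e m x = exp (- (2 * of_real pi * \<i> * of_int m * of_real x))" for m :: int and x :: real
  have hol: "f holomorphic_on A" for A
    unfolding f_def full_theta_def by (intro holomorphic_intros assms)
  have lim: "(\<lambda>M. \<Sum>m\<in>{- int M<..int M}. integral {0..1} (\<lambda>x. f (of_real x) * e m x)) \<longlonglongrightarrow> 0"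
    unfolding e_def
  proof (rule fourier_series_at_zero)
    show "f (z + 1) = f z" for z
      using full_theta_plus_1[OF assms, of w "of_real y + z"] by (simp add: f_def add.assoc)
  qed (use hol in \<open>simp_all add: f_def[of 0] \<theta>_def\<close>)
  have ie: "integral {0..1} (e m) = (if m = 0 then 1 else 0)" for m
  proof (cases "m = 0")
    case False
    define l where "l = 2 * of_real pi * \<i> * of_int m"
    have "l \<noteq> 0" using False by (simp add: l_def)
    have "((\<lambda>z. exp (- (l * z)) / (- l)) has_field_derivative exp (- (l * z))) (at z)" for z
      using \<open>l \<noteq> 0\<close> by (auto intro!: derivative_eq_intros)
    then have "((\<lambda>x. exp (- (l * of_real x)) / (- l)) has_vector_derivative exp (- (l * of_real x))) (at x within {0..1})" for x
      using has_vector_derivative_real_field[of "\<lambda>z. exp (- (l * z)) / (- l)"] by blast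
    from fundamental_theorem_of_calculus[OF _ this]
    have "(e m has_integral (exp (- l) / (- l) - 1 / (- l))) {0..1}"
      by (simp add: e_def[abs_def] l_def)
    moreover have "exp (- l) = 1" using exp_2pi_i_eq_1_iff[of "of_int (-m)"] by (simp add: l_def)
    ultimately show ?thesis using False by (simp add: integral_unique)
  qed (simp add: e_def[abs_def])
  have coeff: "integral {0..1} (\<lambda>x. f (of_real x) * e m x) = c m - (if m = 0 then \<theta> else 0)" for m
  proof -
    have ce: "continuous_on {0..1} (e m)" unfolding e_def[abs_def] by (intro continuous_intros)
    have "continuous_on UNIV (\<lambda>z. f z + \<theta>)"
      by (intro continuous_intros holomorphic_on_imp_continuous_on hol)
    then have cf: "continuous_on {0..1} (\<lambda>x. full_theta \<tau> w (of_real (y + x)))"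
      unfolding f_def by (simp, elim continuous_on_compose2[where g="\<lambda>z. full_theta \<tau> w (of_real y + z)"])
         (auto intro!: continuous_intros)
    have "integral {0..1} (\<lambda>x. f (of_real x) * e m x)
       = integral {0..1} (\<lambda>x. full_theta \<tau> w (of_real (y + x)) * e m x - \<theta> * e m x)"
      by (simp add: f_def algebra_simps)
    also have "\<dots> = integral {0..1} (\<lambda>x. full_theta \<tau> w (of_real (y + x)) * e m x) - integral {0..1} (\<lambda>x. \<theta> * e m x)"
      by (intro integral_diff integrable_continuous_real continuous_intros cf ce)
    also have "\<dots> = c m - (if m = 0 then \<theta> else 0)"
      using full_theta_fourier_coeff[OF assms, of w y m] by (simp add: c_def ie e_def[symmetric])
    finally show ?thesis .
  qed
  have "(\<lambda>M. (\<Sum>m\<in>{- int M<..int M}. integral {0..1} (\<lambda>x. f (of_real x) * e m x)) + \<theta>) \<longlonglongrightarrow> 0 + \<theta>"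
    by (intro tendsto_intros lim)
  \<comment> \<open>For M > 0 the index 0, which carries the subtracted value, lies in the
    range.\<close>
  moreover have "\<forall>\<^sub>F M in sequentially. (\<Sum>m\<in>{- int M<..int M}. integral {0..1} (\<lambda>x. f (of_real x) * e m x)) + \<theta> = (\<Sum>m\<in>{- int M<..int M}. c m)"
    using eventually_gt_at_top[of 0] by eventually_elim (simp add: coeff sum_subtractf)
  ultimately have "(\<lambda>M. \<Sum>m\<in>{- int M<..int M}. c m) \<longlonglongrightarrow> 0 + \<theta>"
    by (rule Lim_transform_eventually)
  then show ?thesis by (simp add: c_def \<theta>_def)
qed

section \<open>Expansion in the left half plane\<close>

text \<open>Lagrange's remainder is taken at a negative point, where exp is at most 1, so the first
  omitted term bounds the error.\<close>

lemma exp_minus_taylor: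
  fixes s :: real
  assumes "s \<ge> 0"
  shows "\<bar>exp (- s) - (\<Sum>a\<le>N. (- s) ^ a / fact a)\<bar> \<le> s ^ (N + 1) / fact (N + 1)"
proof (cases "s = 0")
  case True
  have "(\<Sum>a\<le>N. (0::real) ^ a / fact a) = (\<Sum>a\<le>N. if a = 0 then 1 else 0)"
    by (intro sum.cong) auto
  then show ?thesis using True by simp
next
  case False
  have "\<exists>t. - s < t \<and> t < 0 \<and> exp (- s) = (\<Sum>m<Suc N. exp 0 / fact m * (- s) ^ m) + exp t / fact (Suc N) * (- s) ^ Suc N"
    using assms False by (intro Maclaurin_minus[where diff="\<lambda>_. exp"]) auto
  then obtain t where t: "t < 0" "exp (- s) = (\<Sum>m<Suc N. exp 0 / fact m * (- s) ^ m) + exp t / fact (Suc N) * (- s) ^ Suc N"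
    by blast
  then have "exp (- s) - (\<Sum>a\<le>N. (- s) ^ a / fact a) = exp t / fact (Suc N) * (- s) ^ Suc N"
    by (simp add: lessThan_Suc_atMost del: sum.lessThan_Suc)
  also have "\<bar>\<dots>\<bar> = exp t / fact (Suc N) * s ^ Suc N" using assms by (simp add: abs_mult power_abs)
  also have "\<dots> \<le> 1 / fact (Suc N) * s ^ Suc N"
    using t(1) assms by (intro mult_right_mono divide_right_mono) auto
  finally show ?thesis by simp
qed

lemma exp_ge_power_div_fact: "(x::real) \<ge> 0 \<Longrightarrow> x ^ j / fact j \<le> exp x"
proof -
  assume "x \<ge> 0"
  then have "(\<Sum>n\<in>{j}. inverse (fact n) *\<^sub>R x ^ n) \<le> exp x"
    unfolding exp_def by (intro sum_le_suminf summable_exp_generic) auto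
  then show ?thesis by (simp add: field_simps)
qed

text \<open>Half of the decay exp (-u n) is spent on the polynomial factor, the other half is left
  as a geometric factor. Letting \<open>v\<close> range over [u, U] makes the bound uniform, as
  termwise differentiation on a ball needs; exp (U |x|) allows for shifts of either sign.\<close>

lemma power_times_exp_bound:
  fixes u x :: real and j n :: nat
  assumes "0 < u" "u \<le> v" "v \<le> U"
  shows "\<bar>real n + x\<bar> ^ j * exp (- v * (real n + x))
     \<le> (1 + \<bar>x\<bar>) ^ j * (fact j * (2 / u) ^ j * exp (u / 2)) * exp (U * \<bar>x\<bar>) * exp (- u / 2) ^ n"
proof -
  have "\<bar>real n + x\<bar> \<le> (1 + \<bar>x\<bar>) * (real n + 1)"
    by (simp add: algebra_simps abs_le_iff) (smt (verit) mult_nonneg_nonneg of_nat_0_le_iff)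
  then have 1: "\<bar>real n + x\<bar> ^ j \<le> (1 + \<bar>x\<bar>) ^ j * (real n + 1) ^ j"
    by (metis abs_ge_zero power_mono power_mult_distrib)
  have "(u / 2 * (real n + 1)) ^ j / fact j \<le> exp (u / 2 * (real n + 1))"
    using assms by (intro exp_ge_power_div_fact) auto
  then have 2: "(real n + 1) ^ j \<le> fact j * (2 / u) ^ j * exp (u / 2 * (real n + 1))"
    using assms unfolding power_mult_distrib power_divide by (simp add: field_simps)
  have "- v * (real n + x) \<le> U * \<bar>x\<bar> - u * real n"
  proof -
    have "u * real n \<le> v * real n" using assms by (intro mult_right_mono) auto
    moreover have "- (v * x) \<le> v * \<bar>x\<bar>" using assms by (smt (verit) mult_minus_right mult_left_mono)
    moreover have "v * \<bar>x\<bar> \<le> U * \<bar>x\<bar>" using assms by (intro mult_right_mono) auto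
    ultimately show ?thesis by (simp add: algebra_simps)
  qed
  then have 3: "exp (- v * (real n + x)) \<le> exp (U * \<bar>x\<bar> - u * real n)" by simp
  have "\<bar>real n + x\<bar> ^ j * exp (- v * (real n + x))
    \<le> ((1 + \<bar>x\<bar>) ^ j * (fact j * (2 / u) ^ j * exp (u / 2 * (real n + 1)))) * exp (U * \<bar>x\<bar> - u * real n)"
    using 1 2 3 assms by (intro mult_mono order_trans[OF 1] mult_left_mono) auto
  also have "exp (u / 2 * (real n + 1)) = exp (u / 2) * exp (u / 2 * real n)"
    by (simp add: exp_add[symmetric] algebra_simps)
  also have "exp (U * \<bar>x\<bar> - u * real n) = exp (U * \<bar>x\<bar>) * exp (- u * real n)" by (simp add: exp_add[symmetric])
  also have "(1 + \<bar>x\<bar>) ^ j * (fact j * (2 / u) ^ j * (exp (u / 2) * exp (u / 2 * real n))) * (exp (U * \<bar>x\<bar>) * exp (- u * real n))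
     = (1 + \<bar>x\<bar>) ^ j * (fact j * (2 / u) ^ j * exp (u / 2)) * exp (U * \<bar>x\<bar>) * (exp (u / 2 * real n) * exp (- u * real n))"
    by simp
  also have "exp (u / 2 * real n) * exp (- u * real n) = exp (- u / 2) ^ n"
    by (simp add: exp_add[symmetric] exp_of_nat_mult[symmetric] algebra_simps)
  finally show ?thesis .
qed

text \<open>Absorbing the power costs u^(-j), and the geometric series of ratio exp (-u/2) costs one
  more factor 1/u.\<close>

lemma suminf_power_times_exp_bound:
  fixes x U :: real and j :: nat
  assumes "U > 0"
  obtains C where "C \<ge> 0" "\<And>u. 0 < u \<Longrightarrow> u \<le> U \<Longrightarrow> summable (\<lambda>n. \<bar>real n + x\<bar> ^ j * exp (- u * (real n + x)))"
    "\<And>u. 0 < u \<Longrightarrow> u \<le> U \<Longrightarrow> (\<Sum>n. \<bar>real n + x\<bar> ^ j * exp (- u * (real n + x))) \<le> C / u ^ (j + 1)"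
proof -
  define K where "K = (1 + \<bar>x\<bar>) ^ j * (fact j * 2 ^ j * exp (U / 2)) * exp (U * \<bar>x\<bar>)"
  have "K \<ge> 0" by (simp add: K_def)
  have *: "summable (\<lambda>n. \<bar>real n + x\<bar> ^ j * exp (- u * (real n + x)))"
    "(\<Sum>n. \<bar>real n + x\<bar> ^ j * exp (- u * (real n + x))) \<le> K * (U + 2) / u ^ (j + 1)" if u: "0 < u" "u \<le> U" for u
  proof -
    define z where "z = exp (- u / 2)"
    have z: "0 < z" "z < 1" using u by (auto simp: z_def)
    have b: "\<bar>real n + x\<bar> ^ j * exp (- u * (real n + x)) \<le> K / u ^ j * z ^ n" for n
    proof -
      have "(1 + \<bar>x\<bar>) ^ j * (fact j * (2 / u) ^ j * exp (u / 2)) * exp (U * \<bar>x\<bar>) \<le> (1 + \<bar>x\<bar>) ^ j * (fact j * (2 / u) ^ j * exp (U / 2)) * exp (U * \<bar>x\<bar>)"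
        using u by (intro mult_right_mono mult_left_mono) auto
      also have "\<dots> = K / u ^ j" by (simp add: K_def power_divide)
      finally show ?thesis using power_times_exp_bound[of u u U n x j] u z unfolding z_def
        by (meson order_refl order_trans mult_right_mono exp_ge_zero zero_le_power)
    qed
    have sz: "summable (\<lambda>n. K / u ^ j * z ^ n)" using z by (intro summable_mult summable_geometric) auto
    show s: "summable (\<lambda>n. \<bar>real n + x\<bar> ^ j * exp (- u * (real n + x)))"
      by (rule summable_comparison_test'[OF sz, of 0]) (use b in auto)
    have "(\<Sum>n. \<bar>real n + x\<bar> ^ j * exp (- u * (real n + x))) \<le> (\<Sum>n. K / u ^ j * z ^ n)"
      by (intro suminf_le b s sz)
    also have "\<dots> = K / u ^ j * (1 / (1 - z))"
      using z by (subst suminf_mult) (auto simp: suminf_geometric summable_geometric)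
    also have "\<dots> \<le> K / u ^ j * ((U + 2) / u)"
    proof (intro mult_left_mono)
      \<comment> \<open>This inequality yields 1/(1 - z) \<le> (u + 2)/u.\<close>
      have "1 + u / 2 \<le> exp (u / 2)" by simp
      then have "z * (1 + u / 2) \<le> 1"
        unfolding z_def by (simp add: exp_minus field_simps)
      then have "u \<le> (1 - z) * (u + 2)" by (simp add: algebra_simps)
      also have "\<dots> \<le> (1 - z) * (U + 2)" using u z by (intro mult_left_mono) auto
      finally show "1 / (1 - z) \<le> (U + 2) / u" using u z by (simp add: field_simps)
    qed (use \<open>K \<ge> 0\<close> u in auto)
    finally show "(\<Sum>n. \<bar>real n + x\<bar> ^ j * exp (- u * (real n + x))) \<le> K * (U + 2) / u ^ (j + 1)"
      by (simp add: field_simps)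
  qed
  show ?thesis using \<open>K \<ge> 0\<close> assms * by (intro that[of "K * (U + 2)"]) auto
qed

text \<open>The geometric series of exp (w (n + x)), that is the partial theta function at \<tau> =
  0, continued beyond Re w < 0. It is -1/w times the generating function of the Bernoulli
  polynomials at \<open>x\<close>, with simple poles at the points 2 pi i n.\<close>

definition exp_quot :: "real \<Rightarrow> complex \<Rightarrow> complex" where
  "exp_quot x w = exp (w * of_real x) / (1 - exp w)"

lemma higher_deriv_exp_quot_sums:
  fixes x :: real
  assumes "Re w < 0"
  shows "(\<lambda>n. of_real (real n + x) ^ j * exp (w * of_real (real n + x))) sums (deriv ^^ j) (exp_quot x) w"
  using assms
proof (induction j arbitrary: w)
  case 0
  have "norm (exp w) < 1" using 0 by simp
  then have "(\<lambda>n. exp (w * of_real x) * exp w ^ n) sums (exp (w * of_real x) * (1 / (1 - exp w)))"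
    by (intro sums_mult geometric_sums)
  then show ?case
    by (simp add: exp_quot_def exp_of_nat_mult[symmetric] exp_add[symmetric] algebra_simps)
next
  case (Suc j)
  define S where "S = {w. Re w < 0}"
  define f where "f n w = of_real (real n + x) ^ j * exp (w * of_real (real n + x))" for n and w :: complex
  define f' where "f' n w = of_real (real n + x) ^ Suc j * exp (w * of_real (real n + x))" for n and w :: complex
  have S: "open S" unfolding S_def by (rule open_halfspace_Re_lt)
  have "\<exists>g g'. \<forall>x \<in> S. ((\<lambda>n. f n x) sums g x) \<and> ((\<lambda>n. f' n x) sums g' x) \<and> (g has_field_derivative g' x) (at x)"
  proof (rule series_and_derivative_comparison_local[OF S])
    show "(f n has_field_derivative f' n w) (at w)" for n w
      unfolding f_def f'_def by (auto intro!: derivative_eq_intros simp: algebra_simps)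
    fix w assume "w \<in> S"
    \<comment> \<open>With half the distance to the axis as radius, every y in the ball satisfies u
      \<le> -Re y \<le> 3u, so one majorant serves the whole ball.\<close>
    define u where "u = - Re w / 2"
    have u: "u > 0" using \<open>w \<in> S\<close> by (simp add: u_def S_def)
    have "norm (f n y) \<le> (1 + \<bar>x\<bar>) ^ j * (fact j * (2 / u) ^ j * exp (u / 2)) * exp (3 * u * \<bar>x\<bar>) * exp (- u / 2) ^ n"
      if "y \<in> ball w u" for n y
    proof -
      have "\<bar>Re (w - y)\<bar> < u" using that abs_Re_le_cmod[of "w - y"] by (simp add: dist_norm)
      then have "u \<le> - Re y" "- Re y \<le> 3 * u" by (auto simp: u_def)
      from power_times_exp_bound[OF u this, of n x j] show ?thesis
        unfolding f_def norm_mult norm_power by (simp only: norm_of_real norm_exp_eq_Re) simp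
    qed
    moreover have "summable (\<lambda>n. (1 + \<bar>x\<bar>) ^ j * (fact j * (2 / u) ^ j * exp (u / 2)) * exp (3 * u * \<bar>x\<bar>) * exp (- u / 2) ^ n)"
      using u by (intro summable_mult summable_geometric) auto
    ultimately show "\<exists>d h. 0 < d \<and> summable h \<and> (\<forall>\<^sub>F n in sequentially. \<forall>y\<in>ball w d \<inter> S. norm (f n y) \<le> h n)"
      using u by (intro exI[of _ u] exI[of _ "\<lambda>n. (1 + \<bar>x\<bar>) ^ j * (fact j * (2 / u) ^ j * exp (u / 2)) * exp (3 * u * \<bar>x\<bar>) * exp (- u / 2) ^ n"]) (auto intro!: always_eventually)
  qed
  then obtain g g' where g: "\<And>w. w \<in> S \<Longrightarrow> (\<lambda>n. f n w) sums g w" "\<And>w. w \<in> S \<Longrightarrow> (\<lambda>n. f' n w) sums g' w"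
    "\<And>w. w \<in> S \<Longrightarrow> (g has_field_derivative g' w) (at w)" by blast
  have w: "w \<in> S" using Suc.prems by (simp add: S_def)
  have eq: "g w = (deriv ^^ j) (exp_quot x) w" if "w \<in> S" for w
    using g(1)[OF that] Suc.IH[of w] that unfolding f_def S_def by (auto dest: sums_unique2)
  have "((deriv ^^ j) (exp_quot x) has_field_derivative g' w) (at w)"
    by (rule has_field_derivative_transform_within_open[OF g(3)[OF w] S w eq])
  then have "(deriv ^^ Suc j) (exp_quot x) w = g' w" by (simp add: DERIV_imp_deriv)
  then show ?case using g(2)[OF w] by (simp add: f'_def)
qed

text \<open>The first omitted Taylor term in \<tau> carries the power 2N+2 of n + x; summing it
  against exp (w (n + x)) costs the power 2N+3 of 1/|Re w|. The constant does not depend on Im w and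
  stays valid up to the axis, both of which matter on the circle later.\<close>

lemma partial_theta_expansion:
  fixes x U :: real and N :: nat
  assumes "U > 0"
  obtains C where "C \<ge> 0" "\<And>\<tau> w. \<tau> > 0 \<Longrightarrow> Re w < 0 \<Longrightarrow> - Re w \<le> U \<Longrightarrow>
     norm (partial_theta \<tau> w (of_real x) - (\<Sum>a\<le>N. (deriv ^^ (2 * a)) (exp_quot x) w * of_real ((- \<tau>) ^ a / fact a)))
       \<le> C * \<tau> ^ (N + 1) / (- Re w) ^ (2 * N + 3)"
proof -
  obtain C where C: "C \<ge> 0" "\<And>u. 0 < u \<Longrightarrow> u \<le> U \<Longrightarrow> summable (\<lambda>n. \<bar>real n + x\<bar> ^ (2 * N + 2) * exp (- u * (real n + x)))"
    "\<And>u. 0 < u \<Longrightarrow> u \<le> U \<Longrightarrow> (\<Sum>n. \<bar>real n + x\<bar> ^ (2 * N + 2) * exp (- u * (real n + x))) \<le> C / u ^ (2 * N + 2 + 1)"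
    using suminf_power_times_exp_bound[OF assms] by blast
  have "norm (partial_theta \<tau> w (of_real x) - (\<Sum>a\<le>N. (deriv ^^ (2 * a)) (exp_quot x) w * of_real ((- \<tau>) ^ a / fact a)))
       \<le> C * \<tau> ^ (N + 1) / (- Re w) ^ (2 * N + 3)" if \<tau>: "\<tau> > 0" and w: "Re w < 0" "- Re w \<le> U" for \<tau> w
  proof -
    define u where "u = - Re w"
    have u: "0 < u" "u \<le> U" using w by (auto simp: u_def)
    define y where "y n = real n + x" for n
    define R where "R n = exp (w * of_real (y n)) * of_real (exp (- (\<tau> * (y n)\<^sup>2)) - (\<Sum>a\<le>N. (- (\<tau> * (y n)\<^sup>2)) ^ a / fact a))" for n
    have 1: "(\<lambda>n. exp (w * (of_nat n + of_real x) - of_real \<tau> * (of_nat n + of_real x)\<^sup>2)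
       - (\<Sum>a\<le>N. of_real (y n) ^ (2 * a) * exp (w * of_real (y n)) * of_real ((- \<tau>) ^ a / fact a))) sums
       (partial_theta \<tau> w (of_real x) - (\<Sum>a\<le>N. (deriv ^^ (2 * a)) (exp_quot x) w * of_real ((- \<tau>) ^ a / fact a)))"
      unfolding y_def by (intro sums_diff partial_theta_sums \<tau> sums_sum sums_mult2 higher_deriv_exp_quot_sums w)
    have 2: "exp (w * (of_nat n + of_real x) - of_real \<tau> * (of_nat n + of_real x)\<^sup>2)
       - (\<Sum>a\<le>N. of_real (y n) ^ (2 * a) * exp (w * of_real (y n)) * of_real ((- \<tau>) ^ a / fact a)) = R n" for n
    proof -
      have "of_nat n + of_real x = complex_of_real (y n)" by (simp add: y_def)
      moreover have "exp (w * of_real (y n) - of_real \<tau> * (of_real (y n))\<^sup>2) = exp (w * of_real (y n)) * of_real (exp (- (\<tau> * (y n)\<^sup>2)))"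
        by (simp add: exp_of_real[symmetric] exp_add[symmetric])
      moreover have "(\<Sum>a\<le>N. of_real (y n) ^ (2 * a) * exp (w * of_real (y n)) * of_real ((- \<tau>) ^ a / fact a))
         = exp (w * of_real (y n)) * of_real (\<Sum>a\<le>N. (- (\<tau> * (y n)\<^sup>2)) ^ a / fact a)"
        unfolding of_real_sum sum_distrib_left
        by (intro sum.cong refl) (simp add: power_mult power_minus[of "of_real _"] power_minus[of "_ * _"] power_mult_distrib mult_ac flip: power_mult)
      ultimately show ?thesis unfolding R_def by (simp only: of_real_diff right_diff_distrib)
    qed
    have 3: "norm (R n) \<le> \<tau> ^ (N + 1) / fact (N + 1) * (\<bar>real n + x\<bar> ^ (2 * N + 2) * exp (- u * (real n + x)))" for n
    proof -
      have "norm (R n) = exp (- u * y n) * \<bar>exp (- (\<tau> * (y n)\<^sup>2)) - (\<Sum>a\<le>N. (- (\<tau> * (y n)\<^sup>2)) ^ a / fact a)\<bar>"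
        unfolding R_def norm_mult norm_of_real by (simp add: u_def)
      also have "\<dots> \<le> exp (- u * y n) * ((\<tau> * (y n)\<^sup>2) ^ (N + 1) / fact (N + 1))"
        using \<tau> by (intro mult_left_mono exp_minus_taylor) auto
      also have "(\<tau> * (y n)\<^sup>2) ^ (N + 1) = \<tau> ^ (N + 1) * \<bar>y n\<bar> ^ (2 * N + 2)"
      proof -
        have "\<bar>y n\<bar> ^ (2 * (N + 1)) = ((y n)\<^sup>2) ^ (N + 1)" by (simp only: power_mult power2_abs)
        then show ?thesis by (simp only: power_mult_distrib distrib_left mult_1_right)
      qed
      finally show ?thesis by (simp add: y_def algebra_simps)
    qed
    have "norm (partial_theta \<tau> w (of_real x) - (\<Sum>a\<le>N. (deriv ^^ (2 * a)) (exp_quot x) w * of_real ((- \<tau>) ^ a / fact a)))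
       \<le> \<tau> ^ (N + 1) / fact (N + 1) * (\<Sum>n. \<bar>real n + x\<bar> ^ (2 * N + 2) * exp (- u * (real n + x)))"
      by (rule norm_sums_le[OF 1[unfolded 2] _ 3]) (intro sums_mult summable_sums C u)
    also have "\<dots> \<le> \<tau> ^ (N + 1) / 1 * (C / u ^ (2 * N + 2 + 1))"
      using \<tau> C(3)[OF u] by (intro mult_mono divide_left_mono suminf_nonneg C(2) u) (auto simp: fact_ge_1 simp del: fact_Suc)
    finally show ?thesis by (simp add: u_def mult.commute eval_nat_numeral)
  qed
  then show ?thesis using C(1) that by blast
qed

section \<open>Exponentially small terms\<close>

text \<open>Up to a factor, the bounded quantity is the negative exponent of the m-th Gaussian.
  Growth linear in |m| turns the tail into a geometric series. A minimum over finitely many indices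
  gives the constant; for the others m^2/4 dominates.\<close>

lemma quadratic_gap:
  fixes A u :: real
  obtains c where "c > 0" "\<And>m::int. \<bar>A - of_int m\<bar> > \<bar>u\<bar> \<Longrightarrow> (A - of_int m)\<^sup>2 - u\<^sup>2 \<ge> c * (1 + \<bar>of_int m\<bar>)"
proof -
  define f where "f m = (A - real_of_int m)\<^sup>2 - u\<^sup>2" for m
  \<comment> \<open>2|A| ensures |A - m| \<ge> |m|/2, and u^2 + 8 ensures x^2/4 \<ge> 2x \<ge> 1 + x
    + u^2 for x = |m|.\<close>
  define M0 where "M0 = 2 * \<bar>A\<bar> + u\<^sup>2 + 8"
  define S where "S = {m::int. \<bar>m\<bar> \<le> \<lceil>M0\<rceil> \<and> \<bar>A - of_int m\<bar> > \<bar>u\<bar>}"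
  have fin: "finite S" by (rule finite_subset[of _ "{- \<lceil>M0\<rceil>..\<lceil>M0\<rceil>}"]) (auto simp: S_def)
  have pos: "f m > 0" if "\<bar>A - of_int m\<bar> > \<bar>u\<bar>" for m
    using that abs_le_square_iff[of "A - of_int m" u] by (simp add: f_def)
  \<comment> \<open>Inserting 1 covers the large indices and also an empty \<open>S\<close>.\<close>
  define c where "c = Min (insert 1 ((\<lambda>m. f m / (1 + \<bar>of_int m\<bar>)) ` S))"
  have "c > 0" unfolding c_def using fin pos by (subst Min_gr_iff) (auto simp: S_def intro!: divide_pos_pos)
  moreover have "f m \<ge> c * (1 + \<bar>of_int m\<bar>)" if m: "\<bar>A - of_int m\<bar> > \<bar>u\<bar>" for m
  proof (cases "m \<in> S")
    case True
    then have "c \<le> f m / (1 + \<bar>of_int m\<bar>)" unfolding c_def using fin by (intro Min_le) auto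
    then show ?thesis by (simp add: pos_le_divide_eq)
  next
    case False
    define x where "x = \<bar>real_of_int m\<bar>"
    have "\<bar>m\<bar> > \<lceil>M0\<rceil>" using False m by (auto simp: S_def)
    then have x: "x > M0" unfolding x_def by linarith
    have "c \<le> 1" unfolding c_def using fin by (intro Min_le) auto
    then have "c * (1 + x) \<le> 1 * (1 + x)" by (intro mult_right_mono) (auto simp: x_def)
    also have "\<dots> \<le> (x / 2)\<^sup>2 - u\<^sup>2"
    proof -
      have "x \<ge> 8" using x unfolding M0_def by (smt (verit) zero_le_power2)
      then have "8 * x \<le> x\<^sup>2" by (simp add: power2_eq_square)
      moreover have "x \<ge> 1 + u\<^sup>2" using x unfolding M0_def by (smt (verit))
      ultimately show ?thesis unfolding power_divide by simp
    qed
    also have "\<dots> \<le> f m"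
    proof -
      have "x / 2 \<le> \<bar>A - of_int m\<bar>" using x zero_le_power2[of u] unfolding M0_def x_def by linarith
      then have "(x / 2)\<^sup>2 \<le> (A - of_int m)\<^sup>2" by (metis abs_ge_zero abs_le_square_iff abs_of_nonneg divide_nonneg_nonneg x_def zero_le_numeral)
      then show ?thesis by (simp add: f_def)
    qed
    finally show ?thesis by (simp add: x_def)
  qed
  ultimately show ?thesis using that unfolding f_def by blast
qed

lemma exp_minus_le_inverse_power:
  fixes x :: real
  assumes "x > 0"
  shows "exp (- x) \<le> fact k * inverse x ^ k"
  using exp_ge_power_div_fact[of x k] assms by (simp add: exp_minus field_simps)

section \<open>Uniform truncation of the Poisson sum\<close>

definition poisson_term :: "real \<Rightarrow> complex \<Rightarrow> real \<Rightarrow> int \<Rightarrow> complex" where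
  "poisson_term \<tau> w y m = exp (2 * of_real pi * \<i> * of_int m * of_real y) * (of_real (sqrt (pi / \<tau>))
        * exp ((w - 2 * of_real pi * \<i> * of_int m)\<^sup>2 / (4 * of_real \<tau>)))"

lemma norm_poisson_term:
  assumes "\<tau> > 0"
  shows "norm (poisson_term \<tau> w y m) = sqrt (pi / \<tau>) * exp (- ((Im w - 2 * pi * of_int m)\<^sup>2 - (Re w)\<^sup>2) / (4 * \<tau>))"
proof -
  have "(w - 2 * of_real pi * \<i> * of_int m)\<^sup>2 / (4 * of_real \<tau>) = (w - 2 * of_real pi * \<i> * of_int m)\<^sup>2 / of_real (4 * \<tau>)"
    by simp
  then have "Re ((w - 2 * of_real pi * \<i> * of_int m)\<^sup>2 / (4 * of_real \<tau>)) = - ((Im w - 2 * pi * of_int m)\<^sup>2 - (Re w)\<^sup>2) / (4 * \<tau>)"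
    by (simp only: Re_divide_of_real) (simp add: power2_eq_square)
  then show ?thesis using assms unfolding poisson_term_def norm_mult norm_exp_eq_Re by simp
qed

lemma sum_power_abs_le:
  fixes z :: real and M :: nat
  assumes "0 < z" "z < 1" "A \<subseteq> {- int M<..int M}"
  shows "(\<Sum>m\<in>A. z ^ nat \<bar>m\<bar>) \<le> 2 / (1 - z)"
proof -
  have s: "(\<Sum>n\<le>M. z ^ n) \<le> 1 / (1 - z)"
    using assms sum_le_suminf[of "\<lambda>n. z ^ n" "{..M}"] by (simp add: suminf_geometric summable_geometric)
  have "(\<Sum>m\<in>A. z ^ nat \<bar>m\<bar>) \<le> (\<Sum>m\<in>int ` {..M} \<union> (\<lambda>n. - int n) ` {..M}. z ^ nat \<bar>m\<bar>)"
  proof (intro sum_mono2)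
    show "A \<subseteq> int ` {..M} \<union> (\<lambda>n. - int n) ` {..M}"
    proof
      fix m assume "m \<in> A"
      then have m: "- int M < m" "m \<le> int M" using assms(3) by auto
      show "m \<in> int ` {..M} \<union> (\<lambda>n. - int n) ` {..M}"
      proof (cases "m \<ge> 0")
        case True
        then show ?thesis using m by (intro UnI1 image_eqI[of _ _ "nat m"]) auto
      next
        case False
        then show ?thesis using m by (intro UnI2 image_eqI[of _ _ "nat (- m)"]) auto
      qed
    qed
  qed (use assms in auto)
  also have "\<dots> \<le> (\<Sum>m\<in>int ` {..M}. z ^ nat \<bar>m\<bar>) + (\<Sum>m\<in>(\<lambda>n. - int n) ` {..M}. z ^ nat \<bar>m\<bar>)"
    using assms by (subst sum.union_inter[symmetric]) (auto intro!: sum_nonneg)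
  also have "\<dots> = 2 * (\<Sum>n\<le>M. z ^ n)"
    by (subst (1 2) sum.reindex) (auto simp: inj_on_def o_def)
  finally show ?thesis using s by simp
qed

text \<open>Uniformity is the point: the constant depends on the gap \<open>c\<close> and on
  \<open>n\<close>, but not on w, y or the set \<open>T\<close> of retained indices. In exp (-c (1 +
  |m|) / (4 \<tau>)) the part exp (-c / (4 \<tau>)) beats every power of \<tau>, and the rest, by
  \<tau> \<le> 1, leaves a geometric series in |m|.\<close>

lemma full_theta_minus_poisson_terms:
  fixes c :: real and n :: nat
  assumes "c > 0"
  obtains C where "C \<ge> 0" "\<And>\<tau> w y T. 0 < \<tau> \<Longrightarrow> \<tau> \<le> 1 \<Longrightarrow> finite T \<Longrightarrow>
    (\<And>m::int. m \<notin> T \<Longrightarrow> (Im w - 2 * pi * of_int m)\<^sup>2 - (Re w)\<^sup>2 \<ge> c * (1 + \<bar>of_int m\<bar>)) \<Longrightarrow>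
    norm (full_theta \<tau> w (of_real y) - (\<Sum>m\<in>T. poisson_term \<tau> w y m)) \<le> C * \<tau> ^ n"
proof -
  define z where "z = exp (- c / 4)"
  have z: "0 < z" "z < 1" using assms by (auto simp: z_def)
  define C where "C = sqrt pi * (fact (n + 1) * (4 / c) ^ (n + 1)) * (2 / (1 - z))"
  have "norm (full_theta \<tau> w (of_real y) - (\<Sum>m\<in>T. poisson_term \<tau> w y m)) \<le> C * \<tau> ^ n"
    if \<tau>: "0 < \<tau>" "\<tau> \<le> 1" and T: "finite T"
      and gap: "\<And>m::int. m \<notin> T \<Longrightarrow> (Im w - 2 * pi * of_int m)\<^sup>2 - (Re w)\<^sup>2 \<ge> c * (1 + \<bar>of_int m\<bar>)" for \<tau> w y T
  proof -
    have b: "norm (poisson_term \<tau> w y m) \<le> sqrt (pi / \<tau>) * exp (- c / (4 * \<tau>)) * z ^ nat \<bar>m\<bar>" if "m \<notin> T" for m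
    proof -
      have "- ((Im w - 2 * pi * of_int m)\<^sup>2 - (Re w)\<^sup>2) / (4 * \<tau>) \<le> - (c * (1 + \<bar>of_int m\<bar>)) / (4 * \<tau>)"
        using gap[OF that] \<tau> by (intro divide_right_mono) auto
      also have "\<dots> = - c / (4 * \<tau>) + - (c * \<bar>of_int m\<bar> / (4 * \<tau>))"
        by (simp add: add_divide_distrib diff_divide_distrib algebra_simps)
      also have "- (c * \<bar>of_int m\<bar> / (4 * \<tau>)) \<le> - (c * \<bar>of_int m\<bar> / 4)"
        using \<tau> assms by (intro le_imp_neg_le divide_left_mono) auto
      finally have "exp (- ((Im w - 2 * pi * of_int m)\<^sup>2 - (Re w)\<^sup>2) / (4 * \<tau>)) \<le> exp (- c / (4 * \<tau>) + - (c * \<bar>of_int m\<bar> / 4))"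
        by (simp only: exp_le_cancel_iff add_left_mono)
      also have "\<dots> = exp (- c / (4 * \<tau>)) * z ^ nat \<bar>m\<bar>"
      proof -
        have "\<bar>real_of_int m\<bar> = real (nat \<bar>m\<bar>)" by simp
        then have "- (c * \<bar>of_int m\<bar> / 4) = real (nat \<bar>m\<bar>) * (- c / 4)" by (simp del: of_nat_nat)
        then show ?thesis unfolding z_def by (simp only: exp_add exp_of_nat_mult)
      qed
      finally show ?thesis using \<tau> unfolding norm_poisson_term[OF \<tau>(1)] mult.assoc by (intro mult_left_mono) auto
    qed
    define B where "B = sqrt (pi / \<tau>) * exp (- c / (4 * \<tau>)) * (2 / (1 - z))"
    have lim: "(\<lambda>M. norm ((\<Sum>m\<in>{- int M<..int M}. poisson_term \<tau> w y m) - (\<Sum>m\<in>T. poisson_term \<tau> w y m)))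
       \<longlonglongrightarrow> norm (full_theta \<tau> w (of_real y) - (\<Sum>m\<in>T. poisson_term \<tau> w y m))"
      using full_theta_poisson[OF \<tau>(1), of y w] unfolding poisson_term_def by (intro tendsto_intros)
    have "\<forall>\<^sub>F M in sequentially. T \<subseteq> {- int M<..int M}"
    proof -
      obtain K where K: "\<And>m. m \<in> T \<Longrightarrow> \<bar>m\<bar> \<le> K" using T finite_abs_int_segment
        by (metis Max_ge finite_imageI imageI)
      show ?thesis using eventually_gt_at_top[of "nat K"]
        by eventually_elim (auto dest!: K)
    qed
    then have "\<forall>\<^sub>F M in sequentially. norm ((\<Sum>m\<in>{- int M<..int M}. poisson_term \<tau> w y m) - (\<Sum>m\<in>T. poisson_term \<tau> w y m)) \<le> B"
    proof eventually_elim
      case (elim M)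
      have "(\<Sum>m\<in>{- int M<..int M}. poisson_term \<tau> w y m) - (\<Sum>m\<in>T. poisson_term \<tau> w y m)
         = (\<Sum>m\<in>{- int M<..int M} - T. poisson_term \<tau> w y m)"
        using elim by (subst sum_diff) auto
      also have "norm \<dots> \<le> (\<Sum>m\<in>{- int M<..int M} - T. sqrt (pi / \<tau>) * exp (- c / (4 * \<tau>)) * z ^ nat \<bar>m\<bar>)"
        by (intro sum_norm_le b) auto
      also have "\<dots> = sqrt (pi / \<tau>) * exp (- c / (4 * \<tau>)) * (\<Sum>m\<in>{- int M<..int M} - T. z ^ nat \<bar>m\<bar>)"
        by (simp add: sum_distrib_left)
      also have "\<dots> \<le> B" unfolding B_def
        using \<tau> z by (intro mult_left_mono sum_power_abs_le[of z _ M]) auto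
      finally show ?case .
    qed
    then have "norm (full_theta \<tau> w (of_real y) - (\<Sum>m\<in>T. poisson_term \<tau> w y m)) \<le> B"
      by (intro tendsto_upperbound[OF lim]) auto
    also have "B \<le> C * \<tau> ^ n"
    proof -
      \<comment> \<open>The prefactor of size \<tau>^(-1/2) is estimated by 1/\<tau>; the
        exponential is therefore bounded with the power n + 1.\<close>
      have "\<tau> \<le> sqrt \<tau>" using \<tau> real_le_rsqrt[of \<tau> \<tau>] by (simp add: power2_eq_square mult_left_le)
      then have s: "sqrt (pi / \<tau>) \<le> sqrt pi / \<tau>" using \<tau> unfolding real_sqrt_divide by (intro divide_left_mono) auto
      have "exp (- (c / (4 * \<tau>))) \<le> fact (n + 1) * inverse (c / (4 * \<tau>)) ^ (n + 1)"
        using \<tau> assms by (intro exp_minus_le_inverse_power) auto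
      also have "inverse (c / (4 * \<tau>)) = 4 / c * \<tau>" by simp
      finally have e: "exp (- c / (4 * \<tau>)) \<le> fact (n + 1) * (4 / c) ^ (n + 1) * \<tau> ^ (n + 1)"
        by (simp only: power_mult_distrib minus_divide_left mult.assoc)
      have "B \<le> sqrt pi / \<tau> * (fact (n + 1) * (4 / c) ^ (n + 1) * \<tau> ^ (n + 1)) * (2 / (1 - z))"
        unfolding B_def using s e z \<tau> by (intro mult_right_mono mult_mono) auto
      also have "\<dots> = C * \<tau> ^ n" using \<tau> by (simp add: C_def)
      finally show ?thesis .
    qed
    finally show ?thesis .
  qed
  moreover have "C \<ge> 0" unfolding C_def using z assms by (intro mult_nonneg_nonneg) auto
  ultimately show ?thesis using that by blast
qed

section \<open>The imaginary axis\<close>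

definition theta_remainder :: "nat \<Rightarrow> real \<Rightarrow> real \<Rightarrow> complex \<Rightarrow> complex" where
  "theta_remainder N \<tau> x w = partial_theta \<tau> w (of_real x)
     - (\<Sum>a\<le>N. (deriv ^^ (2 * a)) (exp_quot x) w * of_real ((- \<tau>) ^ a / fact a))"

text \<open>Multiply numerator and denominator by e^(-w). Formally the geometric series over all
  integers sums to zero, so its two halves have opposite continuations.\<close>

lemma exp_quot_reflect: "exp_quot x w = - exp_quot (1 - x) (- w)"
proof -
  have "exp (- w * of_real (1 - x)) = exp (w * of_real x) * exp (- w)"
    by (simp add: exp_add[symmetric] algebra_simps)
  moreover have "1 - exp (- w) = - exp (- w) * (1 - exp w)"
    by (simp add: algebra_simps exp_add[symmetric])
  ultimately show ?thesis unfolding exp_quot_def by simp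
qed

lemma holomorphic_on_exp_quot [holomorphic_intros]:
  "(\<And>w. w \<in> A \<Longrightarrow> exp w \<noteq> 1) \<Longrightarrow> exp_quot x holomorphic_on A"
  unfolding exp_quot_def[abs_def] by (intro holomorphic_intros) auto

lemma exp_neq_1_if_Re: "Re w \<noteq> 0 \<Longrightarrow> exp w \<noteq> 1"
  by (auto simp: exp_eq_1)

text \<open>Each derivative of the reflected function brings a factor -1, which disappears in even
  order.\<close>

lemma higher_deriv_even_exp_quot_reflect:
  assumes "Re w > 0"
  shows "(deriv ^^ (2 * a)) (exp_quot x) w = - (deriv ^^ (2 * a)) (exp_quot (1 - x)) (- w)"
proof -
  define S T where "S = {w::complex. Re w > 0}" and "T = {w::complex. Re w < 0}"
  have op: "open S" "open T" unfolding S_def T_def by (auto intro: open_halfspace_Re_gt open_halfspace_Re_lt)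
  have h: "exp_quot (1 - x) holomorphic_on T"
    unfolding T_def by (intro holomorphic_intros exp_neq_1_if_Re) auto
  have w: "w \<in> S" using assms by (simp add: S_def)
  have "(deriv ^^ (2 * a)) (exp_quot x) w = (deriv ^^ (2 * a)) (\<lambda>w. - exp_quot (1 - x) (- w)) w"
    using exp_quot_reflect by (metis (no_types, lifting) ext)
  also have "\<dots> = - (deriv ^^ (2 * a)) (\<lambda>w. exp_quot (1 - x) (- w)) w"
  proof (rule higher_deriv_uminus[OF _ op(1) w])
    show "(\<lambda>w. exp_quot (1 - x) (- w)) holomorphic_on S"
      by (rule holomorphic_on_compose_gen[OF _ h, unfolded o_def]) (auto simp: S_def T_def intro!: holomorphic_intros)
  qed
  also have "(deriv ^^ (2 * a)) (\<lambda>w. exp_quot (1 - x) (- w)) w = (- 1) ^ (2 * a) * (deriv ^^ (2 * a)) (exp_quot (1 - x)) (- 1 * w)"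
    using higher_deriv_compose_linear[OF h op w, of "- 1" "2 * a"] by (auto simp: S_def T_def)
  finally show ?thesis by simp
qed

lemma theta_remainder_left:
  fixes x U :: real and N :: nat
  assumes "U > 0"
  obtains C where "C \<ge> 0" "\<And>\<tau> w. \<tau> > 0 \<Longrightarrow> Re w < 0 \<Longrightarrow> - Re w \<le> U \<Longrightarrow>
     norm (theta_remainder N \<tau> x w) \<le> C * \<tau> ^ (N + 1) / \<bar>Re w\<bar> ^ (2 * N + 3)"
proof -
  obtain C where C: "C \<ge> 0" "\<And>\<tau> w. \<tau> > 0 \<Longrightarrow> Re w < 0 \<Longrightarrow> - Re w \<le> U \<Longrightarrow>
     norm (theta_remainder N \<tau> x w) \<le> C * \<tau> ^ (N + 1) / (- Re w) ^ (2 * N + 3)"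
    unfolding theta_remainder_def using partial_theta_expansion[OF assms, of x N] by blast
  show ?thesis
  proof (rule that[OF C(1)])
    fix \<tau> :: real and w :: complex assume *: "\<tau> > 0" "Re w < 0" "- Re w \<le> U"
    then have "\<bar>Re w\<bar> = - Re w" by simp
    with C(2)[OF *] show "norm (theta_remainder N \<tau> x w) \<le> C * \<tau> ^ (N + 1) / \<bar>Re w\<bar> ^ (2 * N + 3)" by simp
  qed
qed

text \<open>The polynomials in \<tau> subtracted at (x, w) and at (1 - x, -w) are opposite, hence
  they cancel in the sum of the two halves. This carries the estimate of the left half plane to the
  right one.\<close>

lemma theta_remainder_reflect:
  assumes "Re w > 0"
  shows "theta_remainder N \<tau> x w = full_theta \<tau> w (of_real x) - theta_remainder N \<tau> (1 - x) (- w)"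
  unfolding theta_remainder_def full_theta_def
  by (simp add: higher_deriv_even_exp_quot_reflect[OF assms] sum_negf)

lemma theta_remainder_right:
  fixes x U :: real and N :: nat
  assumes "U > 0"
  obtains C where "C \<ge> 0" "\<And>\<tau> w. \<tau> > 0 \<Longrightarrow> Re w > 0 \<Longrightarrow> Re w \<le> U \<Longrightarrow>
     norm (theta_remainder N \<tau> x w - full_theta \<tau> w (of_real x)) \<le> C * \<tau> ^ (N + 1) / \<bar>Re w\<bar> ^ (2 * N + 3)"
proof -
  obtain C where C: "C \<ge> 0" "\<And>\<tau> w. \<tau> > 0 \<Longrightarrow> Re w < 0 \<Longrightarrow> - Re w \<le> U \<Longrightarrow>
     norm (theta_remainder N \<tau> (1 - x) w) \<le> C * \<tau> ^ (N + 1) / \<bar>Re w\<bar> ^ (2 * N + 3)"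
    using theta_remainder_left[OF assms, of N "1 - x"] by blast
  show ?thesis
  proof (rule that[OF C(1)])
    fix \<tau> :: real and w :: complex assume *: "\<tau> > 0" "Re w > 0" "Re w \<le> U"
    then show "norm (theta_remainder N \<tau> x w - full_theta \<tau> w (of_real x)) \<le> C * \<tau> ^ (N + 1) / \<bar>Re w\<bar> ^ (2 * N + 3)"
      using C(2)[of \<tau> "- w"] by (simp add: theta_remainder_reflect)
  qed
qed

text \<open>The bounds of the two half planes blow up at the imaginary axis like a power of \<open>Re w\<close>.
  On a circle of radius \<open>\<delta>\<close> around a point \<open>w\<^sub>0\<close> of the axis, \<open>(w - w\<^sub>0)\<^sup>2 + \<delta>\<^sup>2\<close> has modulus \<open>2 \<delta> \<bar>Re w\<bar>\<close>,
  so a power of it compensates, and the maximum principle carries the estimate to the centre.\<close>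

lemma norm_sphere_factor:
  fixes w w0 :: complex
  assumes "Re w0 = 0" "norm (w - w0) = \<delta>"
  shows "norm ((w - w0)\<^sup>2 + of_real (\<delta>\<^sup>2)) = 2 * \<delta> * \<bar>Re w\<bar>"
proof -
  have "complex_of_real (\<delta>\<^sup>2) = (w - w0) * cnj (w - w0)"
    unfolding assms(2)[symmetric] by (rule complex_norm_square)
  then have "(w - w0)\<^sup>2 + of_real (\<delta>\<^sup>2) = (w - w0) * ((w - w0) + cnj (w - w0))"
    by (simp add: power2_eq_square algebra_simps)
  also have "(w - w0) + cnj (w - w0) = of_real (2 * Re w)"
    using assms(1) by (subst complex_add_cnj) simp
  finally show ?thesis using assms(2) by (simp add: norm_mult)
qed

text \<open>\<open>G\<close> extends the difference of the coefficient functions across a possible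
  pole at \<open>w0\<close>. If v is an integer, the Poisson term of index v is not small on a
  circle around \<open>w0\<close>; \<open>cancel\<close> makes its contributions at x and y equal.
  The residues at \<open>w0\<close> being -exp (w0 x) and -exp (w0 y), this is also the condition
  for such a \<open>G\<close> to exist.\<close>

lemma partial_theta_diff_on_axis:
  fixes v x y :: real and N :: nat and G :: "complex \<Rightarrow> complex"
  defines "w0 \<equiv> 2 * of_real pi * \<i> * of_real v"
  assumes S: "open S" "w0 \<in> S" and G: "G holomorphic_on S"
    and G_eq: "\<And>w. w \<in> S \<Longrightarrow> Re w \<noteq> 0 \<Longrightarrow> G w = exp_quot x w - exp_quot y w"
    and cancel: "\<And>m::int. v = of_int m \<Longrightarrow> exp (2 * of_real pi * \<i> * of_int m * of_real x) = exp (2 * of_real pi * \<i> * of_int m * of_real y)"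
  obtains C where "\<And>\<tau>. 0 < \<tau> \<Longrightarrow> \<tau> \<le> 1 \<Longrightarrow>
    norm (partial_theta \<tau> w0 (of_real x) - partial_theta \<tau> w0 (of_real y)
       - (\<Sum>a\<le>N. (deriv ^^ (2 * a)) G w0 * of_real ((- \<tau>) ^ a / fact a))) \<le> C * \<tau> ^ (N + 1)"
proof -
  define K where "K = 2 * N + 3"
  obtain c0 where c0: "c0 > 0" "\<And>m::int. \<bar>v - of_int m\<bar> > \<bar>0\<bar> \<Longrightarrow> (v - of_int m)\<^sup>2 - 0\<^sup>2 \<ge> c0 * (1 + \<bar>of_int m\<bar>)"
    using quadratic_gap[of 0 v] by blast
  obtain e where e: "e > 0" "cball w0 e \<subseteq> S" using S open_contains_cball by blast
  \<comment> \<open>Radius at most 1 lets the remainder bounds apply with \<open>U\<close> = 1. The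
    last bound gives 4 \<delta> \<le> D, where D is the distance of \<open>w0\<close> from 2 pi i m
    for m outside \<open>T\<close>; then (D - \<delta>)^2 - \<delta>^2 \<ge> D^2/2.\<close>
  define \<delta> where "\<delta> = min e (min 1 (pi / 2 * sqrt c0))"
  have \<delta>: "\<delta> > 0" "\<delta> \<le> 1" "\<delta> \<le> pi / 2 * sqrt c0" "cball w0 \<delta> \<subseteq> S"
    using e c0 by (auto simp: \<delta>_def)
  have Re0: "Re w0 = 0" by (simp add: w0_def)
  have Im0: "Im w0 = 2 * pi * v" by (simp add: w0_def)
  \<comment> \<open>Either empty or the single index v.\<close>
  define T where "T = {m::int. v = of_int m}"
  have T: "finite T" by (rule finite_subset[of _ "{\<lfloor>v\<rfloor>}"]) (auto simp: T_def)
  \<comment> \<open>From D^2/2 = 2 pi^2 (v - m)^2.\<close>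
  define c where "c = 2 * pi\<^sup>2 * c0"
  have "c > 0" using c0 by (simp add: c_def)
  have gap: "(Im w - 2 * pi * of_int m)\<^sup>2 - (Re w)\<^sup>2 \<ge> c * (1 + \<bar>of_int m\<bar>)"
    if w: "norm (w - w0) = \<delta>" and m: "m \<notin> T" for w m
  proof -
    define D where "D = 2 * pi * \<bar>v - of_int m\<bar>"
    have q: "(v - of_int m)\<^sup>2 \<ge> c0 * (1 + \<bar>of_int m\<bar>)" using c0(2)[of m] m by (simp add: T_def)
    have "c0 * 1 \<le> c0 * (1 + \<bar>of_int m\<bar>)" using c0 by (intro mult_left_mono) auto
    with q have "c0 \<le> (v - of_int m)\<^sup>2" by simp
    then have "sqrt c0 \<le> \<bar>v - of_int m\<bar>" using real_sqrt_le_mono by fastforce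
    then have "2 * pi * sqrt c0 \<le> D" unfolding D_def by (intro mult_left_mono) auto
    then have D: "4 * \<delta> \<le> D" using \<delta>(3) by simp
    have a: "\<bar>Im w - 2 * pi * v\<bar> \<le> \<delta>" using abs_Im_le_cmod[of "w - w0"] w Im0 by simp
    have b: "\<bar>Re w\<bar> \<le> \<delta>" using abs_Re_le_cmod[of "w - w0"] w Re0 by simp
    have "D = \<bar>2 * pi * v - 2 * pi * of_int m\<bar>"
      unfolding D_def by (simp add: abs_mult right_diff_distrib[symmetric])
    then have "D - \<delta> \<le> \<bar>Im w - 2 * pi * of_int m\<bar>" using a by linarith
    then have "(D - \<delta>)\<^sup>2 \<le> (Im w - 2 * pi * of_int m)\<^sup>2"
      using D \<delta>(1) by (intro abs_le_square_iff[THEN iffD1]) auto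
    moreover have "(Re w)\<^sup>2 \<le> \<delta>\<^sup>2" using b \<delta>(1) by (intro abs_le_square_iff[THEN iffD1]) auto
    moreover have "(D - \<delta>)\<^sup>2 - \<delta>\<^sup>2 \<ge> D\<^sup>2 / 2"
    proof -
      have "D * (4 * \<delta>) \<le> D * D" using D \<delta>(1) by (intro mult_left_mono) auto
      then show ?thesis by (simp add: power2_eq_square algebra_simps)
    qed
    moreover have "D\<^sup>2 / 2 \<ge> c * (1 + \<bar>of_int m\<bar>)"
    proof -
      have "D\<^sup>2 / 2 = 2 * pi\<^sup>2 * (v - of_int m)\<^sup>2" unfolding D_def power_mult_distrib by simp
      moreover have "2 * pi\<^sup>2 * (c0 * (1 + \<bar>of_int m\<bar>)) \<le> 2 * pi\<^sup>2 * (v - of_int m)\<^sup>2"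
        using q by (intro mult_left_mono) auto
      ultimately show ?thesis by (simp add: c_def mult.assoc)
    qed
    ultimately show ?thesis by linarith
  qed
  obtain Cx where Cx: "Cx \<ge> 0" "\<And>\<tau> w. \<tau> > 0 \<Longrightarrow> Re w < 0 \<Longrightarrow> - Re w \<le> 1 \<Longrightarrow> norm (theta_remainder N \<tau> x w) \<le> Cx * \<tau> ^ (N + 1) / \<bar>Re w\<bar> ^ (2 * N + 3)"
    using theta_remainder_left[of 1 N x] zero_less_one by blast
  obtain Cy where Cy: "Cy \<ge> 0" "\<And>\<tau> w. \<tau> > 0 \<Longrightarrow> Re w < 0 \<Longrightarrow> - Re w \<le> 1 \<Longrightarrow> norm (theta_remainder N \<tau> y w) \<le> Cy * \<tau> ^ (N + 1) / \<bar>Re w\<bar> ^ (2 * N + 3)"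
    using theta_remainder_left[of 1 N y] zero_less_one by blast
  obtain Dx where Dx: "Dx \<ge> 0" "\<And>\<tau> w. \<tau> > 0 \<Longrightarrow> Re w > 0 \<Longrightarrow> Re w \<le> 1 \<Longrightarrow> norm (theta_remainder N \<tau> x w - full_theta \<tau> w (of_real x)) \<le> Dx * \<tau> ^ (N + 1) / \<bar>Re w\<bar> ^ (2 * N + 3)"
    using theta_remainder_right[of 1 N x] zero_less_one by blast
  obtain Dy where Dy: "Dy \<ge> 0" "\<And>\<tau> w. \<tau> > 0 \<Longrightarrow> Re w > 0 \<Longrightarrow> Re w \<le> 1 \<Longrightarrow> norm (theta_remainder N \<tau> y w - full_theta \<tau> w (of_real y)) \<le> Dy * \<tau> ^ (N + 1) / \<bar>Re w\<bar> ^ (2 * N + 3)"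
    using theta_remainder_right[of 1 N y] zero_less_one by blast
  obtain P where P: "P \<ge> 0" "\<And>\<tau> w y T. 0 < \<tau> \<Longrightarrow> \<tau> \<le> 1 \<Longrightarrow> finite T \<Longrightarrow>
    (\<And>m::int. m \<notin> T \<Longrightarrow> (Im w - 2 * pi * of_int m)\<^sup>2 - (Re w)\<^sup>2 \<ge> c * (1 + \<bar>of_int m\<bar>)) \<Longrightarrow>
    norm (full_theta \<tau> w (of_real y) - (\<Sum>m\<in>T. poisson_term \<tau> w y m)) \<le> P * \<tau> ^ (N + 1)"
    using full_theta_minus_poisson_terms[OF \<open>c > 0\<close>, of "N + 1"] by blast
  define L where "L = Cx + Cy + Dx + Dy + 2 * P"
  have main: "norm (partial_theta \<tau> w0 (of_real x) - partial_theta \<tau> w0 (of_real y)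
       - (\<Sum>a\<le>N. (deriv ^^ (2 * a)) G w0 * of_real ((- \<tau>) ^ a / fact a))) \<le> (2 * \<delta>) ^ K * L / (\<delta>\<^sup>2) ^ K * \<tau> ^ (N + 1)"
    if \<tau>: "0 < \<tau>" "\<tau> \<le> 1" for \<tau>
  proof -
    define H where "H w = partial_theta \<tau> w (of_real x) - partial_theta \<tau> w (of_real y)
       - (\<Sum>a\<le>N. (deriv ^^ (2 * a)) G w * of_real ((- \<tau>) ^ a / fact a))" for w
    have H: "H holomorphic_on S" unfolding H_def
      by (intro holomorphic_intros \<tau> holomorphic_higher_deriv G S)
    have H_eq: "H w = theta_remainder N \<tau> x w - theta_remainder N \<tau> y w" if w: "w \<in> S" "Re w \<noteq> 0" for w
    proof -
      \<comment> \<open>\<open>G\<close> is given by the quotients only off the axis, so derivatives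
        are compared on an open set that avoids it.\<close>
      define S' where "S' = S \<inter> {w. Re w \<noteq> 0}"
      have S': "open S'" unfolding S'_def using S(1)
        by (intro open_Int open_Collect_neq continuous_intros)
      have wS': "w \<in> S'" using w by (simp add: S'_def)
      have "(deriv ^^ j) G w = (deriv ^^ j) (exp_quot x) w - (deriv ^^ j) (exp_quot y) w" for j
      proof -
        have h: "exp_quot z holomorphic_on S'" for z
          by (intro holomorphic_intros exp_neq_1_if_Re) (auto simp: S'_def)
        have "(deriv ^^ j) G w = (deriv ^^ j) (\<lambda>w. exp_quot x w - exp_quot y w) w"
          by (rule higher_deriv_transform_within_open[OF _ _ S' wS'])
             (use G_eq in \<open>auto intro!: holomorphic_intros h holomorphic_on_subset[OF G] simp: S'_def dest: exp_neq_1_if_Re\<close>)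
        also have "\<dots> = (deriv ^^ j) (exp_quot x) w - (deriv ^^ j) (exp_quot y) w"
          by (rule higher_deriv_diff[OF h h S' wS'])
        finally show ?thesis .
      qed
      then show ?thesis unfolding H_def theta_remainder_def
        by (simp only: left_diff_distrib sum_subtractf) (simp only: algebra_simps)
    qed
    define Q where "Q w = ((w - w0)\<^sup>2 + of_real (\<delta>\<^sup>2)) ^ K * H w" for w
    have Q: "Q holomorphic_on S" unfolding Q_def by (intro holomorphic_intros H)
    have "norm (Q w0) \<le> (2 * \<delta>) ^ K * L * \<tau> ^ (N + 1)"
    proof (rule maximum_modulus_frontier[where S="cball w0 \<delta>" and f=Q and \<xi>=w0])
      show "Q holomorphic_on interior (cball w0 \<delta>)"
        using \<delta>(4) interior_subset by (intro holomorphic_on_subset[OF Q]) blast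
      show "continuous_on (closure (cball w0 \<delta>)) Q"
        using \<delta>(4) by (intro continuous_on_subset[OF holomorphic_on_imp_continuous_on[OF Q]]) auto
      show "w0 \<in> cball w0 \<delta>" using \<delta>(1) by simp
      fix w assume "w \<in> frontier (cball w0 \<delta>)"
      then have w: "norm (w - w0) = \<delta>" by (simp add: dist_norm norm_minus_commute)
      then have wS: "w \<in> S" using \<delta>(4) by (auto simp: dist_norm norm_minus_commute)
      have nf: "norm (((w - w0)\<^sup>2 + of_real (\<delta>\<^sup>2)) ^ K) = (2 * \<delta>) ^ K * \<bar>Re w\<bar> ^ K"
        unfolding norm_power norm_sphere_factor[OF Re0 w] by (simp add: power_mult_distrib)
      have b: "\<bar>Re w\<bar> \<le> 1" using abs_Re_le_cmod[of "w - w0"] w Re0 \<delta>(2) by simp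
      have "\<bar>Re w\<bar> ^ K * norm (H w) \<le> L * \<tau> ^ (N + 1)"
      proof -
        consider "Re w = 0" | "Re w < 0" | "Re w > 0" by linarith
        then show ?thesis
        proof cases
          case 1
          \<comment> \<open>At the two points of the circle on the axis no bound for
            \<open>H\<close> is available; the factor vanishes there because K > 0.\<close>
          then have z: "\<bar>Re w\<bar> ^ K = 0" by (simp add: K_def power_0_left)
          have "L \<ge> 0" using Cx(1) Cy(1) Dx(1) Dy(1) P(1) by (simp add: L_def)
          then show ?thesis unfolding z using \<tau> by simp
        next
          case 2
          have "norm (H w) \<le> norm (theta_remainder N \<tau> x w) + norm (theta_remainder N \<tau> y w)"
            using 2 by (subst H_eq[OF wS]) (auto intro: norm_triangle_ineq4)
          also have "\<dots> \<le> Cx * \<tau> ^ (N + 1) / \<bar>Re w\<bar> ^ K + Cy * \<tau> ^ (N + 1) / \<bar>Re w\<bar> ^ K"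
            using 2 b \<tau> unfolding K_def by (intro add_mono Cx Cy) auto
          finally have "\<bar>Re w\<bar> ^ K * norm (H w) \<le> \<bar>Re w\<bar> ^ K * (Cx * \<tau> ^ (N + 1) / \<bar>Re w\<bar> ^ K + Cy * \<tau> ^ (N + 1) / \<bar>Re w\<bar> ^ K)"
            by (intro mult_left_mono) auto
          also have "\<dots> = (Cx + Cy) * \<tau> ^ (N + 1)" using 2 by (simp only: distrib_left distrib_right) simp
          also have "\<dots> \<le> L * \<tau> ^ (N + 1)" using \<tau> Dx Dy P by (intro mult_right_mono) (auto simp: L_def)
          finally show ?thesis .
        next
          case 3
          have pt: "(\<Sum>m\<in>T. poisson_term \<tau> w x m) = (\<Sum>m\<in>T. poisson_term \<tau> w y m)"
            by (intro sum.cong refl) (auto simp: T_def poisson_term_def cancel)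
          have "H w = (theta_remainder N \<tau> x w - full_theta \<tau> w (of_real x)) - (theta_remainder N \<tau> y w - full_theta \<tau> w (of_real y))
              + ((full_theta \<tau> w (of_real x) - (\<Sum>m\<in>T. poisson_term \<tau> w x m)) - (full_theta \<tau> w (of_real y) - (\<Sum>m\<in>T. poisson_term \<tau> w y m)))"
            using 3 unfolding pt by (subst H_eq[OF wS]) auto
          also have "norm \<dots> \<le> (norm (theta_remainder N \<tau> x w - full_theta \<tau> w (of_real x)) + norm (theta_remainder N \<tau> y w - full_theta \<tau> w (of_real y)))
              + (norm (full_theta \<tau> w (of_real x) - (\<Sum>m\<in>T. poisson_term \<tau> w x m)) + norm (full_theta \<tau> w (of_real y) - (\<Sum>m\<in>T. poisson_term \<tau> w y m)))"
            by (intro order_trans[OF norm_triangle_ineq] add_mono norm_triangle_ineq4)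
          also have "\<dots> \<le> (Dx * \<tau> ^ (N + 1) / \<bar>Re w\<bar> ^ K + Dy * \<tau> ^ (N + 1) / \<bar>Re w\<bar> ^ K) + (P * \<tau> ^ (N + 1) + P * \<tau> ^ (N + 1))"
            using 3 b \<tau> gap[OF w] unfolding K_def by (intro add_mono Dx Dy P T) auto
          finally have "\<bar>Re w\<bar> ^ K * norm (H w) \<le> \<bar>Re w\<bar> ^ K * ((Dx * \<tau> ^ (N + 1) / \<bar>Re w\<bar> ^ K + Dy * \<tau> ^ (N + 1) / \<bar>Re w\<bar> ^ K) + (P * \<tau> ^ (N + 1) + P * \<tau> ^ (N + 1)))"
            by (intro mult_left_mono) auto
          also have "\<dots> = (Dx + Dy) * \<tau> ^ (N + 1) + \<bar>Re w\<bar> ^ K * (P * \<tau> ^ (N + 1) + P * \<tau> ^ (N + 1))"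
            using 3 by (simp only: distrib_left[of "_ ^ K" "_ + _"] distrib_left[of "_ ^ K" "_ / _"] distrib_right) simp
          also have "\<dots> \<le> (Dx + Dy) * \<tau> ^ (N + 1) + 1 * (P * \<tau> ^ (N + 1) + P * \<tau> ^ (N + 1))"
            using b \<tau> P(1) by (intro add_left_mono mult_right_mono power_le_one) auto
          also have "\<dots> = (Dx + Dy + 2 * P) * \<tau> ^ (N + 1)" by (simp add: algebra_simps)
          also have "\<dots> \<le> L * \<tau> ^ (N + 1)" using \<tau> Cx Cy by (intro mult_right_mono) (auto simp: L_def)
          finally show ?thesis .
        qed
      qed
      then have "(2 * \<delta>) ^ K * (\<bar>Re w\<bar> ^ K * norm (H w)) \<le> (2 * \<delta>) ^ K * (L * \<tau> ^ (N + 1))"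
        using \<delta>(1) by (intro mult_left_mono) auto
      then show "norm (Q w) \<le> (2 * \<delta>) ^ K * L * \<tau> ^ (N + 1)"
        unfolding Q_def norm_mult nf by (simp only: mult.assoc)
    qed auto
    \<comment> \<open>At the centre the factor is the constant \<delta>^(2K), so dividing it out
      costs no power of \<tau>.\<close>
    moreover have "norm (Q w0) = (\<delta>\<^sup>2) ^ K * norm (H w0)"
      unfolding Q_def norm_mult norm_power by (simp add: norm_power)
    ultimately have "norm (H w0) \<le> (2 * \<delta>) ^ K * L * \<tau> ^ (N + 1) / (\<delta>\<^sup>2) ^ K"
      using \<delta>(1) by (simp add: pos_le_divide_eq mult.commute)
    then show ?thesis by (simp add: H_def)
  qed
  then show ?thesis using that by blast
qed

section \<open>Bernoulli polynomials\<close>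

lemma bernoulli_poly_gf_complex:
  "Abs_fps (\<lambda>n. complex_of_real (bernoulli_poly n x / fact n)) * (fps_exp 1 - 1) = fps_X * fps_exp (of_real x)"
proof (rule fps_ext)
  fix n
  have "fps_nth (Abs_fps (\<lambda>n. bernoulli_poly n x / fact n) * (fps_exp 1 - 1)) n = fps_nth (fps_X * fps_exp x) n"
    by (simp only: bernoulli_poly_gf)
  then have "(\<Sum>i=0..n. bernoulli_poly i x / fact i * (fps_exp 1 - 1 :: real fps) $ (n - i))
      = (if n = 0 then 0 else fps_exp x $ (n - 1))"
    unfolding fps_mult_nth[of "Abs_fps _"] fps_X_mult_nth fps_nth_Abs_fps .
  then have "complex_of_real (\<Sum>i=0..n. bernoulli_poly i x / fact i * (fps_exp 1 - 1 :: real fps) $ (n - i))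
      = of_real (if n = 0 then 0 else fps_exp x $ (n - 1))"
    by (rule arg_cong)
  moreover have "complex_of_real ((fps_exp 1 - 1 :: real fps) $ j) = (fps_exp 1 - 1) $ j" for j
    by simp
  then have "complex_of_real (\<Sum>i=0..n. bernoulli_poly i x / fact i * (fps_exp 1 - 1 :: real fps) $ (n - i))
     = (\<Sum>i=0..n. of_real (bernoulli_poly i x / fact i) * (fps_exp 1 - 1) $ (n - i))"
    by (simp only: of_real_sum of_real_mult)
  moreover have "complex_of_real (if n = 0 then 0 else fps_exp x $ (n - 1)) = (if n = 0 then 0 else fps_exp (of_real x) $ (n - 1))"
    by simp
  ultimately show "fps_nth (Abs_fps (\<lambda>n. complex_of_real (bernoulli_poly n x / fact n)) * (fps_exp 1 - 1)) n = fps_nth (fps_X * fps_exp (of_real x)) n"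
    unfolding fps_mult_nth[of "Abs_fps _"] fps_X_mult_nth fps_nth_Abs_fps by simp
qed

lemma fps_exp_minus_1_neq_0: "fps_exp 1 - 1 \<noteq> (0 :: 'a :: field_char_0 fps)"
proof
  assume "fps_exp 1 - 1 = (0 :: 'a fps)"
  then have "fps_nth (fps_exp 1 - 1 :: 'a fps) 1 = 0" by simp
  then show False by simp
qed

text \<open>Substituting -X in the generating function and multiplying by -e^X restores the
  denominator and turns e^(-xX) into e^((1-x)X).\<close>

lemma bernoulli_poly_reflect: "bernoulli_poly n (1 - x) = (- 1) ^ n * bernoulli_poly n x"
proof -
  define b where "b x = Abs_fps (\<lambda>n. bernoulli_poly n x / fact n)" for x :: real
  define M where "M = fps_const (- 1 :: real) * fps_X"
  have M0: "M $ 0 = 0" by (simp add: M_def)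
  have "(b x * (fps_exp 1 - 1)) oo M = (fps_X * fps_exp x) oo M"
    unfolding b_def bernoulli_poly_gf ..
  then have "(b x oo M) * (fps_exp (- 1) - 1) = M * fps_exp (- x)"
    unfolding fps_compose_mult_distrib[OF M0] fps_compose_sub_distrib
    by (simp add: M_def fps_exp_compose_linear fps_X_fps_compose_startby0 M0)
  then have "(b x oo M) * (fps_exp (- 1) - 1) * (- fps_exp 1) = M * fps_exp (- x) * (- fps_exp 1)"
    by simp
  moreover have "(fps_exp (- 1) - 1) * (- fps_exp (1::real)) = fps_exp 1 - 1"
    by (simp add: algebra_simps flip: fps_exp_add_mult)
  moreover have "M * fps_exp (- x) * (- fps_exp 1) = fps_X * fps_exp (1 - x)"
    by (simp add: M_def algebra_simps flip: fps_exp_add_mult fps_const_neg)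
  ultimately have "(b x oo M) * (fps_exp 1 - 1) = fps_X * fps_exp (1 - x)"
    by (simp only: mult.assoc)
  also have "\<dots> = b (1 - x) * (fps_exp 1 - 1)" unfolding b_def bernoulli_poly_gf ..
  finally have "b x oo M = b (1 - x)" using fps_exp_minus_1_neq_0 by (simp add: mult_cancel_right)
  then have "fps_nth (b x oo M) n = fps_nth (b (1 - x)) n" by simp
  then show ?thesis by (simp add: M_def fps_compose_linear b_def)
qed

lemma exp_neq_1_near_0:
  fixes w :: complex
  assumes "norm w < 1" "w \<noteq> 0"
  shows "exp w \<noteq> 1"
proof
  assume "exp w = 1"
  then obtain n where n: "Re w = 0" "Im w = of_int (2 * n) * pi" by (auto simp: exp_eq_1)
  have "\<bar>of_int (2 * n) * pi\<bar> < 1" using assms abs_Im_le_cmod[of w] n by simp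
  then have "\<bar>of_int n\<bar> * (2 * pi) < 1" by (simp add: abs_mult mult_ac)
  moreover have "\<bar>real_of_int n\<bar> * (2 * pi) \<ge> 1 * (2 * pi)" if "n \<noteq> 0"
    using that by (intro mult_right_mono) auto
  moreover have "2 * pi > 1" using pi_gt3 by simp
  ultimately have "n = 0" by fastforce
  with n assms(2) show False by (auto simp: complex_eq_iff)
qed

text \<open>The multiplied form of the equation avoids dividing at 0, where both sides vanish.
  Radius 1 stays clear of the other zeros 2 pi i n of the denominator.\<close>

lemma exp_difference_quotient:
  fixes x y :: complex
  obtains Q where "Q holomorphic_on ball 0 1"
    "\<And>w. w \<in> ball 0 1 \<Longrightarrow> Q w * (exp w - 1) = exp (w * x) - exp (w * y)"
proof -
  define f where "f w = exp (w * x) - exp (w * y)" for w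
  define E :: "complex \<Rightarrow> complex" where "E w = exp w - 1" for w
  define Q where "Q w = (if w = 0 then x - y else f w / E w)" for w
  have E0: "E w \<noteq> 0" if "w \<in> ball 0 1 - {0}" for w
    using exp_neq_1_near_0[of w] that by (auto simp: E_def)
  have lim: "((\<lambda>w. f w / E w) \<longlongrightarrow> x - y) (at 0)"
  proof -
    have "(f has_field_derivative (x - y)) (at 0)" unfolding f_def by (auto intro!: derivative_eq_intros)
    then have 1: "((\<lambda>z. f z / z) \<longlongrightarrow> x - y) (at 0)" by (simp add: has_field_derivative_iff f_def)
    have "(E has_field_derivative 1) (at 0)" unfolding E_def by (auto intro!: derivative_eq_intros)
    then have 2: "((\<lambda>z. E z / z) \<longlongrightarrow> 1) (at 0)" by (simp add: has_field_derivative_iff E_def)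
    have "((\<lambda>z. (f z / z) / (E z / z)) \<longlongrightarrow> (x - y) / 1) (at 0)" by (intro tendsto_intros 1 2) auto
    then have "((\<lambda>z. f z / E z) \<longlongrightarrow> (x - y) / 1) (at 0)"
      by (rule Lim_transform_eventually) (auto simp: eventually_at_filter)
    then show ?thesis by simp
  qed
  have "Q holomorphic_on ball 0 1"
  proof (rule no_isolated_singularity'[where K="{0}"])
    fix z :: complex assume "z \<in> {0}"
    have "(Q \<longlongrightarrow> x - y) (at 0)"
      by (rule Lim_transform_eventually[OF lim]) (auto simp: eventually_at_filter Q_def)
    then show "(Q \<longlongrightarrow> Q z) (at z within ball 0 1)"
      using \<open>z \<in> {0}\<close> by (auto intro: tendsto_within_subset simp: Q_def)
  next
    have "(\<lambda>w. f w / E w) holomorphic_on (ball 0 1 - {0})"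
      using E0 unfolding f_def E_def by (intro holomorphic_intros) auto
    then show "Q holomorphic_on (ball 0 1 - {0})"
      by (rule holomorphic_transform) (auto simp: Q_def)
  qed auto
  moreover have "Q w * (exp w - 1) = exp (w * x) - exp (w * y)" if "w \<in> ball 0 1" for w
    using E0[of w] that by (auto simp: Q_def f_def E_def)
  ultimately show ?thesis using that by blast
qed

text \<open>Multiplying by X identifies X q with the difference of two Bernoulli generating
  functions; the shift from n to n+1 comes from that X, the denominator n+1 from fact n / fact
  (n+1).\<close>

lemma higher_deriv_exp_difference_quotient:
  fixes x y :: real
  assumes Q: "Q holomorphic_on S" "open S" "0 \<in> S"
    and eq: "\<And>w. w \<in> S \<Longrightarrow> Q w * (exp w - 1) = exp (w * of_real x) - exp (w * of_real y)"
  shows "(deriv ^^ n) Q 0 = of_real ((bernoulli_poly (n + 1) x - bernoulli_poly (n + 1) y) / real (n + 1))"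
proof -
  define b where "b x = Abs_fps (\<lambda>n. complex_of_real (bernoulli_poly n x / fact n))" for x :: real
  define q where "q = fps_expansion Q 0"
  have q: "Q has_fps_expansion q" unfolding q_def using Q by blast
  have e: "(\<lambda>w. exp (of_real x * w)) has_fps_expansion fps_exp (of_real x :: complex)" for x
    by (rule has_fps_expansion_exp)
  have 1: "(\<lambda>w. Q w * (exp (1 * w) - 1)) has_fps_expansion q * (fps_exp 1 - 1)"
    by (intro fps_expansion_intros q has_fps_expansion_exp)
  have 2: "(\<lambda>w. exp (of_real x * w) - exp (of_real y * w)) has_fps_expansion fps_exp (of_real x) - fps_exp (of_real y :: complex)"
    by (intro fps_expansion_intros e)
  have "eventually (\<lambda>w. w \<in> S) (nhds 0)" using Q by (simp add: eventually_nhds_in_open)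
  then have "eventually (\<lambda>w. Q w * (exp (1 * w) - 1) = exp (of_real x * w) - exp (of_real y * w)) (nhds 0)"
    by eventually_elim (use eq in \<open>simp add: mult.commute\<close>)
  from has_fps_expansion_cong[OF this refl] 1
  have "(\<lambda>w. exp (of_real x * w) - exp (of_real y * w)) has_fps_expansion q * (fps_exp 1 - 1)" by blast
  from fps_expansion_unique_complex[OF this 2]
  have "q * (fps_exp 1 - 1) = fps_exp (of_real x) - fps_exp (of_real y)" .
  then have "fps_X * q * (fps_exp 1 - 1) = fps_X * fps_exp (of_real x) - fps_X * fps_exp (of_real y)"
    by (simp only: mult.assoc) (simp only: right_diff_distrib)
  also have "\<dots> = (b x - b y) * (fps_exp 1 - 1)"
    unfolding left_diff_distrib b_def bernoulli_poly_gf_complex ..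
  finally have "fps_X * q = b x - b y" using fps_exp_minus_1_neq_0 by (simp add: mult_cancel_right)
  then have "fps_nth (fps_X * q) (Suc n) = fps_nth (b x - b y) (Suc n)" by simp
  then have "(deriv ^^ n) Q 0 / fact n = of_real (bernoulli_poly (n + 1) x / fact (n + 1)) - of_real (bernoulli_poly (n + 1) y / fact (n + 1))"
    using fps_nth_fps_expansion[OF q, of n] by (simp add: b_def)
  then have "(deriv ^^ n) Q 0 = fact n * (of_real (bernoulli_poly (n + 1) x / fact (n + 1)) - of_real (bernoulli_poly (n + 1) y / fact (n + 1)))"
    by (simp add: field_simps)
  also have "\<dots> = of_real (fact n * (bernoulli_poly (n + 1) x / fact (n + 1) - bernoulli_poly (n + 1) y / fact (n + 1)))"
    by simp
  also have "fact n * (bernoulli_poly (n + 1) x / fact (n + 1) - bernoulli_poly (n + 1) y / fact (n + 1))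
      = (bernoulli_poly (n + 1) x - bernoulli_poly (n + 1) y) / real (n + 1)"
  proof -
    have "fact (n + 1) = real (n + 1) * fact n" by (simp add: fact_Suc)
    then show ?thesis by (simp add: diff_divide_distrib right_diff_distrib del: fact_Suc)
  qed
  finally show ?thesis .
qed

section \<open>The singlet character as a partial theta function\<close>

text \<open>Writing the summation variable as m = 2p (n + x) gives m^2/(4p) = p (n + x)^2, whence
  \<tau> = 2 pi p t, and the linear exponent w (n + x).\<close>

lemma singlet_C_conv_partial_theta:
  fixes p s :: nat and r :: int and t :: real and \<epsilon> w :: complex
  assumes "p > 0" "t > 0" and w: "w = 2 * of_real pi * of_real (sqrt (2 * real p)) * \<epsilon>"
  shows "singlet_C p r s \<epsilon> (\<i> * of_real t)
    = partial_theta (2 * pi * real p * t) w (of_real (1 - of_int r / 2 - real s / (2 * real p)))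
    - partial_theta (2 * pi * real p * t) w (of_real (1 - of_int r / 2 + real s / (2 * real p)))"
proof -
  define q where "q = sqrt (2 * real p)"
  have q: "q > 0" "q * q = 2 * real p" using assms(1) by (auto simp: q_def)
  have "2 * pi * real p * t > 0" using assms by simp
  have tm: "exp (2 * of_real pi * \<epsilon> / of_real (sqrt (2 * real p)) * of_real m) * qpow (\<i> * of_real t) (m\<^sup>2 / (4 * real p))
     = exp (w * (of_nat n + of_real x) - of_real (2 * pi * real p * t) * (of_nat n + of_real x)\<^sup>2)"
    if m: "m = 2 * real p * (real n + x)" for m x n
  proof -
    have "complex_of_real q * of_real q = of_real (q * q)" by simp
    also have "\<dots> = 2 * of_nat p" using q(2) by simp
    finally have qc: "complex_of_real q * of_real q = 2 * of_nat p" .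
    have "complex_of_real m = of_real q * of_real q * (of_nat n + of_real x)" unfolding m qc by simp
    then have 1: "2 * of_real pi * \<epsilon> / of_real (sqrt (2 * real p)) * of_real m = w * (of_nat n + of_real x)"
      using q(1) unfolding w q_def[symmetric] by simp
    have "m\<^sup>2 / (4 * real p) = real p * (real n + x)\<^sup>2" unfolding m using assms(1) by (simp add: power2_eq_square)
    then have 2: "2 * of_real pi * \<i> * of_real (m\<^sup>2 / (4 * real p)) * (\<i> * of_real t)
       = - (of_real (2 * pi * real p * t) * (of_nat n + of_real x)\<^sup>2)"
      by (simp add: algebra_simps)
    show ?thesis unfolding qpow_def 1 2 exp_add[symmetric] by simp
  qed
  have "2 * real p * real n - real s - real p * of_int r + 2 * real p = 2 * real p * (real n + (1 - of_int r / 2 - real s / (2 * real p)))"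
    "2 * real p * real n + real s - real p * of_int r + 2 * real p = 2 * real p * (real n + (1 - of_int r / 2 + real s / (2 * real p)))" for n
    using assms(1) by (simp_all add: field_simps)
  note tm[OF this(1)] tm[OF this(2)]
  then show ?thesis unfolding singlet_C_def Let_def
    by (simp only: sums_unique[OF sums_diff[OF partial_theta_sums partial_theta_sums], symmetric, OF \<open>2 * pi * real p * t > 0\<close> \<open>2 * pi * real p * t > 0\<close>])
qed

section \<open>Change of variable from \<epsilon> to w\<close>

lemma funpow_D_eps:
  assumes "f holomorphic_on S" "open S" "z \<in> S"
  shows "(D_eps ^^ j) f z = (1 / (2 * of_real pi * \<i>)) ^ j * (deriv ^^ j) f z"
  using assms(3)
proof (induction j arbitrary: z)
  case (Suc j)
  define c where "c = (1 / (2 * complex_of_real pi * \<i>))"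
  have "deriv ((D_eps ^^ j) f) z = deriv (\<lambda>z. c ^ j * (deriv ^^ j) f z) z"
    using Suc assms(2) unfolding c_def by (intro deriv_cong_ev refl) (auto simp: eventually_nhds)
  also have "\<dots> = c ^ j * deriv ((deriv ^^ j) f) z"
    using holomorphic_on_imp_differentiable_at[OF holomorphic_higher_deriv[OF assms(1,2)] assms(2) Suc.prems]
    by (rule deriv_cmult)
  finally show ?case by (simp add: D_eps_def[of "(D_eps ^^ j) f"] c_def)
qed simp

text \<open>The chain rule gives a factor \<open>l\<close> per derivative, and (l / (2 pi i))^2 =
  -2p. Two applications of \<open>D_eps\<close> thus turn the weight pi t into -\<tau> with \<tau> =
  2 pi p t.\<close>

lemma funpow_D_eps_even:
  fixes p :: nat
  defines "l \<equiv> 2 * complex_of_real pi * of_real (sqrt (2 * real p))"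
  assumes F: "F holomorphic_on T" "open T" and S: "open S" "\<epsilon> \<in> S"
    and f: "\<And>z. z \<in> S \<Longrightarrow> l * z \<in> T" "\<And>z. z \<in> S \<Longrightarrow> f z = F (l * z)"
  shows "(D_eps ^^ (2 * a)) f \<epsilon> * of_real ((pi * t) ^ a / fact a)
     = (deriv ^^ (2 * a)) F (l * \<epsilon>) * of_real ((- (2 * pi * real p * t)) ^ a / fact a)"
proof -
  have hF: "(\<lambda>z. F (l * z)) holomorphic_on S"
    by (rule holomorphic_on_compose_gen[OF _ F(1), unfolded o_def]) (use f in \<open>auto intro!: holomorphic_intros\<close>)
  then have hf: "f holomorphic_on S" by (rule holomorphic_transform) (use f in auto)
  have "(deriv ^^ (2 * a)) f \<epsilon> = (deriv ^^ (2 * a)) (\<lambda>z. F (l * z)) \<epsilon>"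
    by (rule higher_deriv_transform_within_open[OF hf hF S f(2)])
  also have "\<dots> = l ^ (2 * a) * (deriv ^^ (2 * a)) F (l * \<epsilon>)"
    by (rule higher_deriv_compose_linear[OF F(1) S(1) F(2) S(2) f(1)])
  finally have "(D_eps ^^ (2 * a)) f \<epsilon> = ((1 / (2 * of_real pi * \<i>)) ^ (2 * a) * l ^ (2 * a)) * (deriv ^^ (2 * a)) F (l * \<epsilon>)"
    using funpow_D_eps[OF hf S] by simp
  also have "(1 / (2 * of_real pi * \<i>)) ^ (2 * a) * l ^ (2 * a) = ((l / (2 * of_real pi * \<i>))\<^sup>2) ^ a"
    by (simp add: power_divide flip: power_mult)
  also have "l / (2 * of_real pi * \<i>) = of_real (sqrt (2 * real p)) / \<i>" by (simp add: l_def)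
  also have "(of_real (sqrt (2 * real p)) / \<i>)\<^sup>2 = - (2 * of_nat p)"
  proof -
    have "(complex_of_real (sqrt (2 * real p)))\<^sup>2 = of_real ((sqrt (2 * real p))\<^sup>2)" by (simp only: of_real_power)
    then show ?thesis unfolding power_divide by simp
  qed
  finally have "(D_eps ^^ (2 * a)) f \<epsilon> * of_real ((pi * t) ^ a / fact a) =
     (deriv ^^ (2 * a)) F (l * \<epsilon>) * ((- (2 * of_nat p)) ^ a * of_real ((pi * t) ^ a / fact a))"
    by simp
  also have "(- (2 * of_nat p)) ^ a * of_real ((pi * t) ^ a / fact a) = complex_of_real ((- (2 * pi * real p * t)) ^ a / fact a)"
  proof -
    have "(- (2 * of_nat p)) ^ a * of_real ((pi * t) ^ a / fact a) = complex_of_real ((- (2 * real p)) ^ a * ((pi * t) ^ a / fact a))"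
      by simp
    also have "(- (2 * real p)) ^ a * ((pi * t) ^ a / fact a) = (- (2 * pi * real p * t)) ^ a / fact a"
      by (simp flip: power_mult_distrib add: mult_ac)
    finally show ?thesis .
  qed
  finally show ?thesis .
qed

text \<open>Pull e^(w/2) out of 1 - e^w. Where the denominators vanish, both sides are 0 by the
  convention for division by zero.\<close>

lemma sinh_quot_conv_exp_quot:
  fixes p s :: nat and r :: int and \<epsilon> :: complex
  assumes "p > 0"
  defines "w \<equiv> 2 * of_real pi * of_real (sqrt (2 * real p)) * \<epsilon>"
  shows "sinh_quot p r s \<epsilon> = exp_quot (1 - of_int r / 2 - real s / (2 * real p)) w
      - exp_quot (1 - of_int r / 2 + real s / (2 * real p)) w"
proof -
  define B where "B = w * of_real (real s / (2 * real p))"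
  have e1: "of_real pi * of_real (sqrt (2 * real p)) * (1 - of_int r) * \<epsilon> = w * (1 - of_int r) / 2"
    by (simp add: w_def)
  have "sqrt (2 / real p) = sqrt (2 * real p) / real p"
  proof -
    have "sqrt (2 * real p) / real p = sqrt (2 * real p) / sqrt (real p ^ 2)" by simp
    also have "\<dots> = sqrt (2 / real p)" unfolding real_sqrt_divide[symmetric] by (simp add: power2_eq_square)
    finally show ?thesis by simp
  qed
  then have e2: "of_real (sqrt (2 / real p)) * of_real pi * of_nat s * \<epsilon> = B"
    by (simp add: w_def B_def)
  have e3: "of_real (sqrt (2 * real p)) * of_real pi * \<epsilon> = w / 2" by (simp add: w_def)
  have sh: "1 - exp w = - 2 * exp (w / 2) * sinh (w / 2)"
    by (simp add: sinh_field_def algebra_simps exp_add[symmetric])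
  have q: "exp_quot (1 - of_int r / 2 + \<sigma>) w = - exp (w * (1 - of_int r) / 2) * exp (w * of_real \<sigma>) / (2 * sinh (w / 2))" for \<sigma>
  proof -
    have "exp (w * of_real (1 - of_int r / 2 + \<sigma>)) = exp (w / 2) * (exp (w * (1 - of_int r) / 2) * exp (w * of_real \<sigma>))"
      unfolding exp_add[symmetric] by (simp add: field_simps)
    then show ?thesis unfolding exp_quot_def sh by simp
  qed
  have "exp_quot (1 - of_int r / 2 - real s / (2 * real p)) w = - exp (w * (1 - of_int r) / 2) * exp (- B) / (2 * sinh (w / 2))"
    using q[of "- (real s / (2 * real p))"] by (simp add: B_def)
  moreover have "exp_quot (1 - of_int r / 2 + real s / (2 * real p)) w = - exp (w * (1 - of_int r) / 2) * exp B / (2 * sinh (w / 2))"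
    using q[of "real s / (2 * real p)"] by (simp add: B_def)
  moreover have "sinh B = (exp B - exp (- B)) / 2" by (simp add: sinh_field_def)
  moreover have "- X * b / (2 * Y) - (- X * a / (2 * Y)) = X * ((a - b) / 2) / Y" for X Y a b :: complex
    by (cases "Y = 0") (simp_all add: field_simps)
  ultimately show ?thesis unfolding sinh_quot_def e1 e2 e3 by (simp only:)
qed

text \<open>The expansions are bounded in \<tau> = b t for \<tau> \<le> 1; the 1 added to the
  constant keeps it positive even for C = 0.\<close>

lemma bigo_at_right_0I:
  fixes f :: "real \<Rightarrow> complex"
  assumes "b > 0" and bound: "\<And>t. 0 < t \<Longrightarrow> b * t \<le> 1 \<Longrightarrow> norm (f t) \<le> C * (b * t) ^ n"
  shows "f \<in> O[at_right 0](\<lambda>t. of_real (t ^ n))"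
proof (rule landau_o.bigI)
  have "eventually (\<lambda>t. t \<in> {0<..<1 / b}) (at_right (0::real))"
    using assms(1) by (intro eventually_at_right_real) auto
  then show "eventually (\<lambda>t. norm (f t) \<le> (\<bar>C\<bar> * b ^ n + 1) * norm (complex_of_real (t ^ n))) (at_right 0)"
  proof eventually_elim
    case (elim t)
    then have t: "0 < t" "b * t \<le> 1" using assms(1) by (auto simp: field_simps)
    have "norm (f t) \<le> C * (b * t) ^ n" by (rule bound[OF t])
    also have "\<dots> \<le> \<bar>C\<bar> * (b * t) ^ n" using t assms(1) by (intro mult_right_mono) auto
    also have "\<dots> = \<bar>C\<bar> * b ^ n * t ^ n" by (simp add: power_mult_distrib)
    also have "\<dots> \<le> (\<bar>C\<bar> * b ^ n + 1) * t ^ n" using t by (intro mult_right_mono) auto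
    finally show ?case using t by (simp add: norm_power)
  qed
  show "\<bar>C\<bar> * b ^ n + 1 > 0" using assms(1) by (intro add_nonneg_pos) auto
qed

section \<open>The Gaussian main terms\<close>

lemma exp_2pi_i_half_integer:
  "exp (2 * of_real pi * \<i> * of_int m * of_real (1 - of_int r / 2 + \<sigma>)) = (- 1) powi (r * m) * exp (2 * of_real pi * \<i> * of_int m * of_real \<sigma>)"
proof -
  have "exp (2 * of_real pi * \<i> * of_int m * of_real (1 - of_int r / 2 + \<sigma>))
     = exp (2 * of_real pi * \<i> * of_int m) * (exp (of_int (r * m) * (- (of_real pi * \<i>))) * exp (2 * of_real pi * \<i> * of_int m * of_real \<sigma>))"
    unfolding exp_add[symmetric] by (simp add: algebra_simps)
  also have "exp (2 * of_real pi * \<i> * of_int m) = (1::complex)" by (simp add: exp_2pi_i_eq_1_iff)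
  also have "exp (of_int (r * m) * (- (of_real pi * \<i>))) = (exp (- (complex_of_real pi * \<i>))) powi (r * m)"
    by (simp only: exp_power_int)
  also have "exp (- (complex_of_real pi * \<i>)) = - 1" by (simp add: exp_minus)
  finally show ?thesis by simp
qed

lemma minus_one_powi_add_even: "(- 1 :: complex) powi (i + 2 * j) = (- 1) powi i"
  by (simp add: power_int_add power_int_mult)

lemma sqrt_pi_over: "t > 0 \<Longrightarrow> p > 0 \<Longrightarrow> sqrt (pi / (2 * pi * real p * t)) = (2 * real p * t) powr (- 1 / 2)"
proof -
  assume "t > 0" "p > 0"
  then have "sqrt (pi / (2 * pi * real p * t)) = sqrt (inverse (2 * real p * t))" by (simp add: field_simps)
  also have "\<dots> = inverse ((2 * real p * t) powr (1 / 2))"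
    using \<open>t > 0\<close> by (subst powr_half_sqrt) (simp_all only: real_sqrt_inverse, simp)
  also have "\<dots> = (2 * real p * t) powr (- 1 / 2)" by (simp add: powr_minus[symmetric])
  finally show ?thesis .
qed

text \<open>With n = k - m the exponent depends on \<epsilon>0 + i n only. The two shifts differ in
  the sign of s/(2p), so their phases combine to the sine, while 1 - r/2 contributes the
  sign.\<close>

lemma theta_main_conv_poisson_term:
  fixes p s :: nat and r k :: int and u0 v0 t :: real and w :: complex
  assumes "p > 0" "t > 0" and w: "w = 2 * of_real pi * (of_real u0 + \<i> * of_real v0 + \<i> * of_int k)"
  shows "theta_main p r s k u0 v0 t = (\<Sum>m | \<bar>of_int (k - m) + v0\<bar> \<le> \<bar>u0\<bar>.
     poisson_term (2 * pi * real p * t) w (1 - of_int r / 2 - real s / (2 * real p)) m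
     - poisson_term (2 * pi * real p * t) w (1 - of_int r / 2 + real s / (2 * real p)) m)"
proof -
  define e0 where "e0 = complex_of_real u0 + \<i> * of_real v0"
  define D where "D = complex_of_real (2 * real p * t)"
  have D: "D \<noteq> 0" using assms by (simp add: D_def)
  define A where "A = complex_of_real ((2 * real p * t) powr (- 1 / 2))"
  have "poisson_term (2 * pi * real p * t) w (1 - of_int r / 2 - real s / (2 * real p)) m
     - poisson_term (2 * pi * real p * t) w (1 - of_int r / 2 + real s / (2 * real p)) m
     = - 2 * \<i> * A * exp (of_real pi * e0\<^sup>2 / D) * ((- 1) powi (r * (k + n)) * of_real (sin (pi * real s * of_int (k - n) / real p))
             * exp (- of_real pi * (of_int n)\<^sup>2 / D + 2 * of_real pi * \<i> * e0 * of_int n / D))" if m: "n = k - m" for m n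
  proof -
    define \<phi> where "\<phi> = pi * real s * of_int m / real p"
    have x1: "exp (2 * of_real pi * \<i> * of_int m * of_real (1 - of_int r / 2 - real s / (2 * real p))) = (- 1) powi (r * m) * exp (- (\<i> * of_real \<phi>))"
      using exp_2pi_i_half_integer[of m r "- (real s / (2 * real p))"] by (simp add: \<phi>_def mult_ac)
    have x2: "exp (2 * of_real pi * \<i> * of_int m * of_real (1 - of_int r / 2 + real s / (2 * real p))) = (- 1) powi (r * m) * exp (\<i> * of_real \<phi>)"
      using exp_2pi_i_half_integer[of m r "real s / (2 * real p)"] by (simp add: \<phi>_def mult_ac)
    have sn: "exp (- (\<i> * of_real \<phi>)) - exp (\<i> * of_real \<phi>) = - 2 * \<i> * of_real (sin \<phi>)"
      by (simp add: sin_of_real[symmetric] sin_exp_eq)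
    \<comment> \<open>As m = k - n, the exponent r (k + n) exceeds r m by the even number 2 r
      n.\<close>
    have sg: "(- 1 :: complex) powi (r * m) = (- 1) powi (r * (k + n))"
      using minus_one_powi_add_even[of "r * m" "r * n"] by (simp add: m algebra_simps)
    have "w - 2 * of_real pi * \<i> * of_int m = 2 * of_real pi * (e0 + \<i> * of_int n)"
      by (simp add: w e0_def m algebra_simps)
    moreover have "4 * complex_of_real (2 * pi * real p * t) = 4 * of_real pi * D" by (simp add: D_def)
    ultimately have "(w - 2 * of_real pi * \<i> * of_int m)\<^sup>2 / (4 * of_real (2 * pi * real p * t)) = of_real pi * (e0 + \<i> * of_int n)\<^sup>2 / D"
      by (simp add: power_mult_distrib power2_eq_square)
    also have "\<dots> = of_real pi * e0\<^sup>2 / D + (- of_real pi * (of_int n)\<^sup>2 / D + 2 * of_real pi * \<i> * e0 * of_int n / D)"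
      using D by (simp add: power2_eq_square field_simps)
    finally have ex: "exp ((w - 2 * of_real pi * \<i> * of_int m)\<^sup>2 / (4 * of_real (2 * pi * real p * t)))
       = exp (of_real pi * e0\<^sup>2 / D) * exp (- of_real pi * (of_int n)\<^sup>2 / D + 2 * of_real pi * \<i> * e0 * of_int n / D)"
      by (simp only: exp_add)
    have sq: "complex_of_real (sqrt (pi / (2 * pi * real p * t))) = A"
      unfolding A_def sqrt_pi_over[OF assms(2,1)] ..
    have "poisson_term (2 * pi * real p * t) w (1 - of_int r / 2 - real s / (2 * real p)) m
     - poisson_term (2 * pi * real p * t) w (1 - of_int r / 2 + real s / (2 * real p)) m
     = (- 1) powi (r * (k + n)) * (exp (- (\<i> * of_real \<phi>)) - exp (\<i> * of_real \<phi>)) * (A * (exp (of_real pi * e0\<^sup>2 / D) * exp (- of_real pi * (of_int n)\<^sup>2 / D + 2 * of_real pi * \<i> * e0 * of_int n / D)))"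
      unfolding poisson_term_def x1 x2 sq ex sg by (simp only: left_diff_distrib right_diff_distrib)
    moreover have "\<phi> = pi * real s * of_int (k - n) / real p" by (simp add: \<phi>_def m)
    ultimately show ?thesis unfolding sn by (simp only: mult_ac)
  qed
  note tm = this
  have "(\<Sum>m | \<bar>of_int (k - m) + v0\<bar> \<le> \<bar>u0\<bar>.
     poisson_term (2 * pi * real p * t) w (1 - of_int r / 2 - real s / (2 * real p)) m
     - poisson_term (2 * pi * real p * t) w (1 - of_int r / 2 + real s / (2 * real p)) m)
    = (\<Sum>n | \<bar>of_int n + v0\<bar> \<le> \<bar>u0\<bar>. - 2 * \<i> * A * exp (of_real pi * e0\<^sup>2 / D) * ((- 1) powi (r * (k + n)) * of_real (sin (pi * real s * of_int (k - n) / real p))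
             * exp (- of_real pi * (of_int n)\<^sup>2 / D + 2 * of_real pi * \<i> * e0 * of_int n / D)))"
    by (rule sum.reindex_bij_witness[of _ "\<lambda>n. k - n" "\<lambda>m. k - m"]) (auto simp: tm)
  also have "\<dots> = theta_main p r s k u0 v0 t"
    unfolding theta_main_def Let_def e0_def[symmetric] D_def[symmetric] A_def[symmetric] sum_distrib_left[symmetric] ..
  finally show ?thesis by simp
qed

text \<open>At these points e^(w n) = 1, so the integer case reduces to w = 0 for each of the two
  shifts separately.\<close>

lemma partial_theta_2pi_i:
  assumes "\<tau> > 0"
  shows "partial_theta \<tau> (2 * of_real pi * \<i> * of_int k) (of_real x)
     = exp (2 * of_real pi * \<i> * of_int k * of_real x) * partial_theta \<tau> 0 (of_real x)"
proof -
  have "exp (2 * of_real pi * \<i> * of_int k * (of_nat n + of_real x) - of_real \<tau> * (of_nat n + of_real x)\<^sup>2)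
     = exp (2 * of_real pi * \<i> * of_int k * of_real x) * exp (0 * (of_nat n + of_real x) - of_real \<tau> * (of_nat n + of_real x)\<^sup>2)" for n
  proof -
    have "exp (2 * of_real pi * \<i> * (of_int k * of_nat n)) = (1::complex)"
      by (subst exp_2pi_i_eq_1_iff) auto
    moreover have "2 * of_real pi * \<i> * of_int k * (of_nat n + of_real x) - of_real \<tau> * (of_nat n + of_real x)\<^sup>2
      = 2 * of_real pi * \<i> * (of_int k * of_nat n) + (2 * of_real pi * \<i> * of_int k * of_real x + (0 * (of_nat n + of_real x) - of_real \<tau> * (of_nat n + of_real x)\<^sup>2))"
      by (simp add: algebra_simps)
    ultimately show ?thesis by (simp only: exp_add mult_1_left)
  qed
  then show ?thesis unfolding partial_theta_def[of \<tau> "2 * of_real pi * \<i> * of_int k"]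
    using sums_unique[OF sums_mult[OF partial_theta_sums[OF assms, of 0 "of_real x"], of "exp (2 * of_real pi * \<i> * of_int k * of_real x)"]]
    by simp
qed

text \<open>Half the sum plus half the difference of the functions at x and 1 - x. In the sum only
  the Poisson term m = 0 survives and gives sqrt (pi/\<tau>); in the difference the odd Bernoulli
  polynomials, antisymmetric under x |-> 1 - x, double.\<close>

lemma partial_theta_at_0_expansion:
  fixes x :: real and N :: nat
  obtains C where "\<And>\<tau>. 0 < \<tau> \<Longrightarrow> \<tau> \<le> 1 \<Longrightarrow>
    norm (partial_theta \<tau> 0 (of_real x) - (of_real (sqrt (pi / \<tau>)) / 2
      - (\<Sum>a\<le>N. of_real (bernoulli_poly (2 * a + 1) x / real (2 * a + 1)) * of_real ((- \<tau>) ^ a / fact a)))) \<le> C * \<tau> ^ (N + 1)"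
proof -
  obtain Q where Q: "Q holomorphic_on ball 0 1"
    "\<And>w. w \<in> ball 0 1 \<Longrightarrow> Q w * (exp w - 1) = exp (w * of_real x) - exp (w * of_real (1 - x))"
    using exp_difference_quotient[of "of_real x" "of_real (1 - x)"] by blast
  \<comment> \<open>The sign arises because \<open>exp_quot\<close> has the denominator 1 - e^w, but
    \<open>Q\<close> has e^w - 1.\<close>
  have G_eq: "- Q w = exp_quot x w - exp_quot (1 - x) w" if w: "w \<in> ball 0 1" "Re w \<noteq> 0" for w
  proof -
    have "exp w \<noteq> 1" using w by (intro exp_neq_1_if_Re)
    have "exp_quot x w - exp_quot (1 - x) w = (Q w * (exp w - 1)) / (1 - exp w)"
      unfolding exp_quot_def Q(2)[OF w(1)] by (simp add: diff_divide_distrib)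
    also have "\<dots> = - Q w" using \<open>exp w \<noteq> 1\<close> by (simp add: field_simps)
    finally show ?thesis by simp
  qed
  have dG: "(deriv ^^ (2 * a)) (\<lambda>w. - Q w) 0 = - 2 * of_real (bernoulli_poly (2 * a + 1) x / real (2 * a + 1))" for a
  proof -
    have "(deriv ^^ (2 * a)) (\<lambda>w. - Q w) 0 = - (deriv ^^ (2 * a)) Q 0"
      by (rule higher_deriv_uminus[OF Q(1)]) auto
    also have "(deriv ^^ (2 * a)) Q 0 = of_real ((bernoulli_poly (2 * a + 1) x - bernoulli_poly (2 * a + 1) (1 - x)) / real (2 * a + 1))"
      by (rule higher_deriv_exp_difference_quotient[OF Q(1) _ _ Q(2)]) auto
    also have "bernoulli_poly (2 * a + 1) (1 - x) = - bernoulli_poly (2 * a + 1) x"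
      by (simp add: bernoulli_poly_reflect)
    finally show ?thesis by (simp add: field_simps)
  qed
  obtain C where C: "\<And>\<tau>. 0 < \<tau> \<Longrightarrow> \<tau> \<le> 1 \<Longrightarrow>
    norm (partial_theta \<tau> 0 (of_real x) - partial_theta \<tau> 0 (of_real (1 - x))
       - (\<Sum>a\<le>N. (deriv ^^ (2 * a)) (\<lambda>w. - Q w) 0 * of_real ((- \<tau>) ^ a / fact a))) \<le> C * \<tau> ^ (N + 1)"
  \<comment> \<open>For v = 0 the cancellation condition concerns m = 0 only, where both
    exponentials are 1.\<close>
  proof (rule partial_theta_diff_on_axis[where v=0 and x=x and y="1-x" and S="ball 0 1" and G="\<lambda>w. - Q w" and N=N,
        unfolded of_real_0 mult_zero_right])
    show "(\<lambda>w. - Q w) holomorphic_on ball 0 1" by (intro holomorphic_intros Q(1))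
  qed (use G_eq in auto)
  \<comment> \<open>Since 4 pi^2 m^2 \<ge> 1 + |m| for integers m \<noteq> 0, a gap of 1 will
    do.\<close>
  define c :: real where "c = 1"
  have "c > 0" by (simp add: c_def)
  obtain P where P: "P \<ge> 0" "\<And>\<tau> w y T. 0 < \<tau> \<Longrightarrow> \<tau> \<le> 1 \<Longrightarrow> finite T \<Longrightarrow>
    (\<And>m::int. m \<notin> T \<Longrightarrow> (Im w - 2 * pi * of_int m)\<^sup>2 - (Re w)\<^sup>2 \<ge> c * (1 + \<bar>of_int m\<bar>)) \<Longrightarrow>
    norm (full_theta \<tau> w (of_real y) - (\<Sum>m\<in>T. poisson_term \<tau> w y m)) \<le> P * \<tau> ^ (N + 1)"
    using full_theta_minus_poisson_terms[OF \<open>c > 0\<close>, of "N + 1"] by blast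
  have gap: "(Im 0 - 2 * pi * of_int m)\<^sup>2 - (Re 0)\<^sup>2 \<ge> c * (1 + \<bar>of_int m\<bar>)" if "m \<notin> {0}" for m :: int
  proof -
    define z where "z = \<bar>real_of_int m\<bar>"
    have z: "z \<ge> 1" using that by (simp add: z_def)
    have "z * 1 \<le> z * z" using z by (intro mult_left_mono) auto
    then have "1 + z \<le> 2 * (z * z)" using z by linarith
    also have "\<dots> \<le> (2 * pi) * (2 * pi) * (z * z)"
    proof -
      have "2 \<le> (2 * pi) * (2 * pi)" using mult_mono[of 2 "2 * pi" 1 "2 * pi"] pi_gt3 by simp
      from mult_right_mono[OF this, of "z * z"] show ?thesis using z by simp
    qed
    finally show ?thesis by (simp add: z_def c_def power2_eq_square algebra_simps)
  qed
  have "norm (partial_theta \<tau> 0 (of_real x) - (of_real (sqrt (pi / \<tau>)) / 2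
      - (\<Sum>a\<le>N. of_real (bernoulli_poly (2 * a + 1) x / real (2 * a + 1)) * of_real ((- \<tau>) ^ a / fact a)))) \<le> (P + C) / 2 * \<tau> ^ (N + 1)"
    if \<tau>: "0 < \<tau>" "\<tau> \<le> 1" for \<tau>
  proof -
    define B where "B = (\<Sum>a\<le>N. of_real (bernoulli_poly (2 * a + 1) x / real (2 * a + 1)) * complex_of_real ((- \<tau>) ^ a / fact a))"
    have "(\<Sum>a\<le>N. (deriv ^^ (2 * a)) (\<lambda>w. - Q w) 0 * of_real ((- \<tau>) ^ a / fact a)) = - 2 * B"
      unfolding dG B_def sum_distrib_left by (simp only: mult.assoc)
    with C[OF \<tau>] have pc: "norm (partial_theta \<tau> 0 (of_real x) - partial_theta \<tau> 0 (of_real (1 - x)) + 2 * B) \<le> C * \<tau> ^ (N + 1)"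
      by simp
    have p: "norm (full_theta \<tau> 0 (of_real x) - of_real (sqrt (pi / \<tau>))) \<le> P * \<tau> ^ (N + 1)"
      using P(2)[OF \<tau>, of "{0}" 0 x] gap by (simp add: poisson_term_def)
    have "partial_theta \<tau> 0 (of_real x) - (of_real (sqrt (pi / \<tau>)) / 2 - B)
      = ((full_theta \<tau> 0 (of_real x) - of_real (sqrt (pi / \<tau>)))
        + (partial_theta \<tau> 0 (of_real x) - partial_theta \<tau> 0 (of_real (1 - x)) + 2 * B)) / 2"
      unfolding full_theta_def by (simp add: field_simps)
    also have "norm \<dots> \<le> (norm (full_theta \<tau> 0 (of_real x) - of_real (sqrt (pi / \<tau>)))
        + norm (partial_theta \<tau> 0 (of_real x) - partial_theta \<tau> 0 (of_real (1 - x)) + 2 * B)) / 2"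
      unfolding norm_divide norm_numeral by (intro divide_right_mono norm_triangle_ineq) simp
    also have "\<dots> \<le> (P * \<tau> ^ (N + 1) + C * \<tau> ^ (N + 1)) / 2"
      by (intro divide_right_mono add_mono pc p) simp
    finally show ?thesis unfolding B_def by (simp add: algebra_simps add_divide_distrib)
  qed
  then show ?thesis using that by blast
qed

text \<open>The two real factors of W in the exponents differ by the integer r - 2, which is why the
  singularities are removable. This form exhibits the function as a difference quotient of the kind
  whose derivatives are Bernoulli differences.\<close>

lemma sinh_quot_corr_integrand:
  fixes p s :: nat and r :: int and z :: complex
  assumes "p > 0"
  defines "W \<equiv> 2 * complex_of_real pi * of_real (sqrt (2 * real p)) * z"
  shows "exp (2 * of_real pi * z * ((of_nat s - of_nat p) / of_real (sqrt (2 * real p))))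
       * (sinh (of_real (sqrt (2 * real p)) * (of_int r - 2) * of_real pi * z)
            / sinh (of_real (sqrt (2 * real p)) * of_real pi * z))
    = (exp (W * of_real ((real s + real p * (of_int r - 2)) / (2 * real p))) - exp (W * of_real (1 - of_int r / 2 + real s / (2 * real p)))) / (exp W - 1)"
proof -
  define q where "q = complex_of_real (sqrt (2 * real p))"
  have q: "q \<noteq> 0" using assms(1) by (simp add: q_def)
  have "q * q = of_real (sqrt (2 * real p) * sqrt (2 * real p))" unfolding q_def by (simp only: of_real_mult)
  then have qq: "q * q = 2 * of_nat p" by simp
  have W: "W = 2 * of_real pi * q * z" by (simp add: W_def q_def)
  have pc: "(of_nat p :: complex) \<noteq> 0" using assms(1) by simp
  have "W * ((of_nat s - of_nat p) / (2 * of_nat p)) = 2 * of_real pi * z * ((of_nat s - of_nat p) / q)"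
    unfolding W qq[symmetric] using q by simp
  then have e1: "2 * of_real pi * z * ((of_nat s - of_nat p) / q) = W * ((of_nat s - of_nat p) / (2 * of_nat p))" ..
  have e2: "q * (of_int r - 2) * of_real pi * z = (of_int r - 2) * W / 2" by (simp add: W)
  have e3: "q * of_real pi * z = W / 2" by (simp add: W)
  have sh: "sinh u = exp (- u) * (exp (2 * u) - 1) / 2" for u :: complex
    by (simp add: sinh_field_def right_diff_distrib flip: exp_add)
  have s1: "sinh ((of_int r - 2) * W / 2) = exp (- ((of_int r - 2) * W / 2)) * (exp ((of_int r - 2) * W) - 1) / 2"
    using sh[of "(of_int r - 2) * W / 2"] by simp
  have s2: "sinh (W / 2) = exp (- (W / 2)) * (exp W - 1) / 2"
    using sh[of "W / 2"] by simp
  define h where "h = complex_of_nat s / (2 * of_nat p)"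
  define c where "c = W * ((of_nat s - of_nat p) / (2 * of_nat p))"
  have ch: "c = W * h - W / 2" unfolding c_def h_def using pc by (simp add: field_simps)
  have xh: "complex_of_real (1 - of_int r / 2 + real s / (2 * real p)) = 1 - of_int r / 2 + h" by (simp add: h_def)
  have yh: "complex_of_real ((real s + real p * (of_int r - 2)) / (2 * real p)) = h + (of_int r - 2) / 2"
    unfolding h_def using pc by (simp add: field_simps)
  have x: "exp (W * of_real (1 - of_int r / 2 + real s / (2 * real p))) = exp c * (exp (- ((of_int r - 2) * W / 2)) * exp (W / 2))"
    unfolding exp_add[symmetric] ch xh by (simp add: algebra_simps diff_divide_distrib add_divide_distrib)
  have y: "exp (W * of_real ((real s + real p * (of_int r - 2)) / (2 * real p))) = exp c * (exp (- ((of_int r - 2) * W / 2)) * exp (W / 2)) * exp ((of_int r - 2) * W)"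
    unfolding exp_add[symmetric] ch yh by (simp add: algebra_simps diff_divide_distrib add_divide_distrib)
  have "exp c * (exp (- ((of_int r - 2) * W / 2)) * (exp ((of_int r - 2) * W) - 1) / 2 / (exp (- (W / 2)) * (exp W - 1) / 2))
    = (exp c * (exp (- ((of_int r - 2) * W / 2)) * exp (W / 2)) * exp ((of_int r - 2) * W) - exp c * (exp (- ((of_int r - 2) * W / 2)) * exp (W / 2))) / (exp W - 1)"
  proof -
    have "a * (b * (d - 1) / 2 / (inverse e * f / 2)) = (a * (b * e) * d - a * (b * e)) / f" if "e \<noteq> 0" for a b d e f :: complex
      using that by (cases "f = 0") (simp_all add: field_simps)
    then show ?thesis unfolding exp_minus[of "W / 2"] by simp
  qed
  then show ?thesis unfolding q_def[symmetric] e1 e2 e3 c_def[symmetric] s1 s2 x y .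
qed

text \<open>Near \<epsilon> the variable W = l z is near 2 pi i k. Because x and y differ by an
  integer, both exponentials acquire the same factor at that point, so the difference quotient at 0
  describes the function locally.\<close>

lemma funpow_D_eps_sinh_quot_corr:
  fixes p s :: nat and r k :: int and t :: real and \<epsilon> :: complex
  assumes "p > 0" and eps: "\<epsilon> = \<i> * of_int k / of_real (sqrt (2 * real p))"
  defines "x \<equiv> 1 - of_int r / 2 + real s / (2 * real p)" and "y \<equiv> (real s + real p * (of_int r - 2)) / (2 * real p)"
  shows "(D_eps ^^ (2 * a)) (sinh_quot_corr p r s) \<epsilon> * of_real ((pi * t) ^ a / fact a)
    = - exp (2 * of_real pi * \<i> * of_int k * of_real x)
       * of_real ((bernoulli_poly (2 * a + 1) x - bernoulli_poly (2 * a + 1) y) / real (2 * a + 1))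
       * of_real ((- (2 * pi * real p * t)) ^ a / fact a)"
proof -
  define l where "l = 2 * complex_of_real pi * of_real (sqrt (2 * real p))"
  define w0 where "w0 = 2 * complex_of_real pi * \<i> * of_int k"
  define \<kappa> where "\<kappa> = exp (2 * of_real pi * \<i> * of_int k * of_real x)"
  have l: "l \<noteq> 0" using assms(1) by (simp add: l_def)
  have le: "l * \<epsilon> = w0" using assms(1) by (simp add: l_def w0_def eps)
  obtain Q where Q: "Q holomorphic_on ball 0 1"
    "\<And>w. w \<in> ball 0 1 \<Longrightarrow> Q w * (exp w - 1) = exp (w * of_real x) - exp (w * of_real y)"
    using exp_difference_quotient[of "of_real x" "of_real y"] by blast
  define F where "F W = (- \<kappa>) * Q (1 * W + (- w0))" for W
  \<comment> \<open>The unit ball around \<open>w0\<close>, pulled back: it contains no singular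
    point besides \<epsilon>.\<close>
  define S where "S = {z. l * z \<in> ball w0 1}"
  have S: "open S"
    using open_vimage[of "ball w0 1" "\<lambda>z. l * z"] by (auto simp: S_def vimage_def intro!: continuous_intros)
  have eS: "\<epsilon> \<in> S" by (simp add: S_def le)
  have hQ: "(\<lambda>W. Q (1 * W + (- w0))) holomorphic_on ball w0 1"
    by (rule holomorphic_on_compose_gen[OF _ Q(1), unfolded o_def]) (auto intro!: holomorphic_intros simp: dist_norm norm_minus_commute)
  have hF: "F holomorphic_on ball w0 1" unfolding F_def by (intro holomorphic_intros hQ)
  define g where "g z = exp (2 * of_real pi * z * ((of_nat s - of_nat p) / of_real (sqrt (2 * real p))))
       * (sinh (of_real (sqrt (2 * real p)) * (of_int r - 2) * of_real pi * z)
            / sinh (of_real (sqrt (2 * real p)) * of_real pi * z))" for z :: complex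
  have g_eq: "g z = F (l * z)" if z: "z \<in> S" "z \<noteq> \<epsilon>" for z
  proof -
    define w where "w = l * z - w0"
    have w: "w \<in> ball 0 1" "w \<noteq> 0" using z l le by (auto simp: w_def S_def dist_norm norm_minus_commute)
    have W: "l * z = w0 + w" by (simp add: w_def)
    have per: "exp w0 = 1" by (simp add: w0_def exp_2pi_i_eq_1_iff)
    have "exp w \<noteq> 1" using exp_neq_1_near_0[of w] w by simp
    \<comment> \<open>Here y = x + (r - 2) and e^(w0 (r - 2)) = 1.\<close>
    have ky: "exp (w0 * of_real y) = \<kappa>"
    proof -
      have "exp (w0 * of_real (x + of_int (r - 2))) = \<kappa> * exp (2 * of_real pi * \<i> * (of_int k * of_int (r - 2)))"
        unfolding \<kappa>_def w0_def exp_add[symmetric] by (simp add: algebra_simps)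
      also have "exp (2 * of_real pi * \<i> * (of_int k * of_int (r - 2))) = (1::complex)"
        by (subst exp_2pi_i_eq_1_iff) auto
      finally show ?thesis unfolding x_def y_def using assms(1) by (simp add: field_simps)
    qed
    have kx: "exp (w0 * of_real x) = \<kappa>" by (simp add: \<kappa>_def w0_def)
    have "g z = (exp (l * z * of_real y) - exp (l * z * of_real x)) / (exp (l * z) - 1)"
      unfolding g_def x_def y_def l_def by (rule sinh_quot_corr_integrand[OF assms(1)])
    also have "\<dots> = (\<kappa> * exp (w * of_real y) - \<kappa> * exp (w * of_real x)) / (exp w - 1)"
      unfolding W distrib_right exp_add per kx ky by simp
    also have "\<dots> = - \<kappa> * (Q w * (exp w - 1)) / (exp w - 1)"
      unfolding Q(2)[OF w(1)] by (simp add: algebra_simps)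
    also have "\<dots> = F (l * z)" using \<open>exp w \<noteq> 1\<close> by (simp add: F_def w_def)
    finally show ?thesis .
  qed
  \<comment> \<open>\<open>remove_sings\<close> takes the limit at each point of \<open>S\<close>;
    \<open>g\<close> agrees with the continuous \<open>F (l * z)\<close> off \<epsilon>, so this
    limit is the value of the latter.\<close>
  have f_eq: "sinh_quot_corr p r s z = F (l * z)" if z: "z \<in> S" for z
  proof -
    have "isCont (\<lambda>z. F (l * z)) z"
    proof (rule isCont_o2[where f="\<lambda>z. l * z" and g=F])
      show "isCont F (l * z)"
        using hF z by (intro continuous_on_interior[of "ball w0 1"] holomorphic_on_imp_continuous_on) (auto simp: S_def)
    qed (auto intro!: continuous_intros)
    then have "((\<lambda>z. F (l * z)) \<longlongrightarrow> F (l * z)) (at z)" by (simp add: isCont_def)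
    moreover have "eventually (\<lambda>z'. F (l * z') = g z') (at z)"
    proof -
      have "eventually (\<lambda>z'. z' \<in> S) (at z)" using S z by (rule eventually_at_in_open')
      moreover have "eventually (\<lambda>z'. z' \<noteq> \<epsilon>) (at z)" by (rule eventually_neq_at_within)
      ultimately show ?thesis by eventually_elim (simp add: g_eq)
    qed
    ultimately have "(g \<longlongrightarrow> F (l * z)) (at z)" by (rule Lim_transform_eventually)
    then show ?thesis unfolding sinh_quot_corr_def g_def by (rule remove_sings_eqI)
  qed
  have "(D_eps ^^ (2 * a)) (sinh_quot_corr p r s) \<epsilon> * of_real ((pi * t) ^ a / fact a)
     = (deriv ^^ (2 * a)) F (l * \<epsilon>) * of_real ((- (2 * pi * real p * t)) ^ a / fact a)"
    unfolding l_def by (rule funpow_D_eps_even[OF hF open_ball S eS]) (use f_eq in \<open>auto simp: S_def l_def\<close>)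
  also have "(deriv ^^ (2 * a)) F (l * \<epsilon>) = (- \<kappa>) * (deriv ^^ (2 * a)) (\<lambda>W. Q (1 * W + (- w0))) w0"
    unfolding F_def le by (rule higher_deriv_cmult[OF hQ]) auto
  also have "(deriv ^^ (2 * a)) (\<lambda>W. Q (1 * W + (- w0))) w0 = 1 ^ (2 * a) * (deriv ^^ (2 * a)) Q (1 * w0 + (- w0))"
    by (rule higher_deriv_compose_linear'[OF Q(1), of "ball w0 1"]) (auto simp: dist_norm norm_minus_commute)
  also have "\<dots> = (deriv ^^ (2 * a)) Q 0" by simp
  also have "\<dots> = of_real ((bernoulli_poly (2 * a + 1) x - bernoulli_poly (2 * a + 1) y) / real (2 * a + 1))"
    by (rule higher_deriv_exp_difference_quotient[OF Q(1) _ _ Q(2)]) auto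
  finally show ?thesis by (simp only: \<kappa>_def)
qed

section \<open>Asymptotic expansions\<close>

lemma finite_int_abs_le: "finite {m::int. \<bar>of_int (k - m) + v\<bar> \<le> (u::real)}"
proof (rule finite_subset)
  show "{m::int. \<bar>of_int (k - m) + v\<bar> \<le> u} \<subseteq> {\<lfloor>of_int k + v - u\<rfloor>..\<lceil>of_int k + v + u\<rceil>}"
    by (auto simp: abs_le_iff) linarith+
qed simp

text \<open>Two forms for two uses: off the axis the remainders at the two shifts are estimated one
  by one, on the axis only their difference is estimated.\<close>

lemma singlet_C_diff_exp_quot:
  fixes p s :: nat and r :: int and t :: real and \<epsilon> w :: complex
  assumes "p > 0" "t > 0" "w = 2 * of_real pi * of_real (sqrt (2 * real p)) * \<epsilon>" "exp w \<noteq> 1"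
  defines "xm \<equiv> 1 - of_int r / 2 - real s / (2 * real p)" and "xp \<equiv> 1 - of_int r / 2 + real s / (2 * real p)"
  shows "singlet_C p r s \<epsilon> (\<i> * of_real t)
      - (\<Sum>a\<le>N. (D_eps ^^ (2 * a)) (sinh_quot p r s) \<epsilon> * of_real ((pi * t) ^ a / fact a))
    = partial_theta (2 * pi * real p * t) w (of_real xm) - partial_theta (2 * pi * real p * t) w (of_real xp)
      - (\<Sum>a\<le>N. (deriv ^^ (2 * a)) (\<lambda>w. exp_quot xm w - exp_quot xp w) w * of_real ((- (2 * pi * real p * t)) ^ a / fact a))"
    and "singlet_C p r s \<epsilon> (\<i> * of_real t)
      - (\<Sum>a\<le>N. (D_eps ^^ (2 * a)) (sinh_quot p r s) \<epsilon> * of_real ((pi * t) ^ a / fact a))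
    = theta_remainder N (2 * pi * real p * t) xm w - theta_remainder N (2 * pi * real p * t) xp w"
proof -
  define l where "l = 2 * complex_of_real pi * of_real (sqrt (2 * real p))"
  define T where "T = {w::complex. exp w \<noteq> 1}"
  have T: "open T" unfolding T_def by (intro open_Collect_neq continuous_intros)
  have h: "exp_quot x holomorphic_on T" for x by (intro holomorphic_intros) (auto simp: T_def)
  have hd: "(\<lambda>w. exp_quot xm w - exp_quot xp w) holomorphic_on T" by (intro holomorphic_intros h)
  have w: "w \<in> T" "w = l * \<epsilon>" using assms by (auto simp: T_def l_def)
  define S where "S = {z. l * z \<in> T}"
  have S: "open S" using open_vimage[OF T, of "\<lambda>z. l * z"] by (auto simp: S_def vimage_def intro!: continuous_intros)
  have "(D_eps ^^ (2 * a)) (sinh_quot p r s) \<epsilon> * of_real ((pi * t) ^ a / fact a)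
     = (deriv ^^ (2 * a)) (\<lambda>w. exp_quot xm w - exp_quot xp w) w * of_real ((- (2 * pi * real p * t)) ^ a / fact a)" for a
    unfolding w(2) l_def
    by (rule funpow_D_eps_even[OF hd T S])
       (use w sinh_quot_conv_exp_quot[OF assms(1)] in \<open>auto simp: S_def l_def xm_def xp_def\<close>)
  then show 1: "singlet_C p r s \<epsilon> (\<i> * of_real t)
      - (\<Sum>a\<le>N. (D_eps ^^ (2 * a)) (sinh_quot p r s) \<epsilon> * of_real ((pi * t) ^ a / fact a))
    = partial_theta (2 * pi * real p * t) w (of_real xm) - partial_theta (2 * pi * real p * t) w (of_real xp)
      - (\<Sum>a\<le>N. (deriv ^^ (2 * a)) (\<lambda>w. exp_quot xm w - exp_quot xp w) w * of_real ((- (2 * pi * real p * t)) ^ a / fact a))"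
    unfolding singlet_C_conv_partial_theta[OF assms(1-3)] xm_def xp_def by (simp only:)
  have "(deriv ^^ j) (\<lambda>w. exp_quot xm w - exp_quot xp w) w = (deriv ^^ j) (exp_quot xm) w - (deriv ^^ j) (exp_quot xp) w" for j
    by (rule higher_deriv_diff[OF h h T w(1)])
  then show "singlet_C p r s \<epsilon> (\<i> * of_real t)
      - (\<Sum>a\<le>N. (D_eps ^^ (2 * a)) (sinh_quot p r s) \<epsilon> * of_real ((pi * t) ^ a / fact a))
    = theta_remainder N (2 * pi * real p * t) xm w - theta_remainder N (2 * pi * real p * t) xp w"
    unfolding 1 theta_remainder_def
    by (simp only: left_diff_distrib sum_subtractf) (simp only: algebra_simps)
qed

lemma singlet_C_expansion_left:
  fixes p s :: nat and r :: int and \<epsilon> :: complex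
  assumes "p > 0" "Re \<epsilon> < 0"
  shows "(\<lambda>t. singlet_C p r s \<epsilon> (\<i> * of_real t)
      - (\<Sum>a\<le>N. (D_eps ^^ (2 * a)) (sinh_quot p r s) \<epsilon> * of_real ((pi * t) ^ a / fact a)))
     \<in> O[at_right 0](\<lambda>t::real. of_real (t ^ (N + 1)))"
proof -
  define w where "w = 2 * of_real pi * of_real (sqrt (2 * real p)) * \<epsilon>"
  have "Re w = (2 * pi * sqrt (2 * real p)) * Re \<epsilon>" by (simp add: w_def)
  then have Re: "Re w < 0" using assms by (simp add: mult_pos_neg)
  define xm where "xm = 1 - of_int r / 2 - real s / (2 * real p)"
  define xp where "xp = 1 - of_int r / 2 + real s / (2 * real p)"
  define K where "K = \<bar>Re w\<bar> ^ (2 * N + 3)"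
  have "- Re w > 0" using Re by simp
  obtain C1 where C1: "C1 \<ge> 0" "\<And>\<tau> w'. \<tau> > 0 \<Longrightarrow> Re w' < 0 \<Longrightarrow> - Re w' \<le> - Re w \<Longrightarrow> norm (theta_remainder N \<tau> xm w') \<le> C1 * \<tau> ^ (N + 1) / \<bar>Re w'\<bar> ^ (2 * N + 3)"
    using theta_remainder_left[OF \<open>- Re w > 0\<close>, of N xm] by blast
  obtain C2 where C2: "C2 \<ge> 0" "\<And>\<tau> w'. \<tau> > 0 \<Longrightarrow> Re w' < 0 \<Longrightarrow> - Re w' \<le> - Re w \<Longrightarrow> norm (theta_remainder N \<tau> xp w') \<le> C2 * \<tau> ^ (N + 1) / \<bar>Re w'\<bar> ^ (2 * N + 3)"
    using theta_remainder_left[OF \<open>- Re w > 0\<close>, of N xp] by blast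
  show ?thesis
  proof (rule bigo_at_right_0I[where b="2 * pi * real p" and C="C1 / K + C2 / K"])
    fix t :: real assume t: "0 < t" "2 * pi * real p * t \<le> 1"
    define \<tau> where "\<tau> = 2 * pi * real p * t"
    have "\<tau> > 0" using t assms by (simp add: \<tau>_def)
    have "exp w \<noteq> 1" using Re by (intro exp_neq_1_if_Re) auto
    then have "singlet_C p r s \<epsilon> (\<i> * of_real t) - (\<Sum>a\<le>N. (D_eps ^^ (2 * a)) (sinh_quot p r s) \<epsilon> * of_real ((pi * t) ^ a / fact a))
      = theta_remainder N \<tau> xm w - theta_remainder N \<tau> xp w"
      unfolding \<tau>_def xm_def xp_def by (intro singlet_C_diff_exp_quot(2) assms t) (auto simp: w_def)
    also have "norm \<dots> \<le> norm (theta_remainder N \<tau> xm w) + norm (theta_remainder N \<tau> xp w)"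
      by (rule norm_triangle_ineq4)
    also have "\<dots> \<le> C1 * \<tau> ^ (N + 1) / K + C2 * \<tau> ^ (N + 1) / K"
      unfolding K_def using \<open>\<tau> > 0\<close> Re by (intro add_mono C1 C2) auto
    finally show "norm (singlet_C p r s \<epsilon> (\<i> * of_real t) - (\<Sum>a\<le>N. (D_eps ^^ (2 * a)) (sinh_quot p r s) \<epsilon> * of_real ((pi * t) ^ a / fact a)))
       \<le> (C1 / K + C2 / K) * (2 * pi * real p * t) ^ (N + 1)"
      unfolding \<tau>_def[symmetric] by (simp add: algebra_simps)
  qed (use assms in simp)
qed

text \<open>If |n + v0| = |u0|, the Gaussian has modulus sqrt (pi/\<tau>), which does not decay, so
  the boundary indices belong to the main term. All others share a common gap by
  \<open>quadratic_gap\<close>.\<close>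

lemma singlet_C_expansion_right:
  fixes p s :: nat and r k :: int and u0 v0 :: real and \<epsilon> :: complex
  assumes "p > 0" "Re \<epsilon> > 0"
    and eps: "\<epsilon> = (of_real u0 + \<i> * of_real v0 + \<i> * of_int k) / of_real (sqrt (2 * real p))"
  shows "(\<lambda>t. singlet_C p r s \<epsilon> (\<i> * of_real t) - (theta_main p r s k u0 v0 t
      + (\<Sum>a\<le>N. (D_eps ^^ (2 * a)) (sinh_quot p r s) \<epsilon> * of_real ((pi * t) ^ a / fact a))))
     \<in> O[at_right 0](\<lambda>t::real. of_real (t ^ (N + 1)))"
proof -
  define w where "w = 2 * of_real pi * of_real (sqrt (2 * real p)) * \<epsilon>"
  have w: "w = 2 * of_real pi * (of_real u0 + \<i> * of_real v0 + \<i> * of_int k)"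
    using assms(1) by (simp add: w_def eps)
  have "Re w = (2 * pi * sqrt (2 * real p)) * Re \<epsilon>" by (simp add: w_def)
  then have Re: "Re w > 0" using assms(1,2) by simp
  have Rw: "Re w = 2 * pi * u0" and Iw: "Im w = 2 * pi * (v0 + of_int k)" by (simp_all add: w algebra_simps)
  define xm where "xm = 1 - of_int r / 2 - real s / (2 * real p)"
  define xp where "xp = 1 - of_int r / 2 + real s / (2 * real p)"
  define K where "K = \<bar>Re w\<bar> ^ (2 * N + 3)"
  define T where "T = {m::int. \<bar>of_int (k - m) + v0\<bar> \<le> \<bar>u0\<bar>}"
  have T: "finite T" unfolding T_def by (rule finite_int_abs_le)
  obtain c0 where c0: "c0 > 0" "\<And>m::int. \<bar>(v0 + of_int k) - of_int m\<bar> > \<bar>u0\<bar> \<Longrightarrow> ((v0 + of_int k) - of_int m)\<^sup>2 - u0\<^sup>2 \<ge> c0 * (1 + \<bar>of_int m\<bar>)"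
    using quadratic_gap[of u0 "v0 + of_int k"] by blast
  \<comment> \<open>Passing to \<open>w\<close> stretches lengths by 2 pi, hence the gap by 4
    pi^2.\<close>
  define c where "c = 4 * pi\<^sup>2 * c0"
  have "c > 0" using c0 by (simp add: c_def)
  have gap: "(Im w - 2 * pi * of_int m)\<^sup>2 - (Re w)\<^sup>2 \<ge> c * (1 + \<bar>of_int m\<bar>)" if "m \<notin> T" for m
  proof -
    have "\<bar>(v0 + of_int k) - of_int m\<bar> > \<bar>u0\<bar>" using that by (simp add: T_def algebra_simps)
    then have "4 * pi\<^sup>2 * (c0 * (1 + \<bar>of_int m\<bar>)) \<le> 4 * pi\<^sup>2 * (((v0 + of_int k) - of_int m)\<^sup>2 - u0\<^sup>2)"
      using c0(2) by (intro mult_left_mono) auto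
    also have "\<dots> = (2 * pi * ((v0 + of_int k) - of_int m))\<^sup>2 - (2 * pi * u0)\<^sup>2"
      unfolding power_mult_distrib by (simp add: right_diff_distrib)
    also have "2 * pi * ((v0 + of_int k) - of_int m) = Im w - 2 * pi * of_int m"
      unfolding Iw by (simp add: algebra_simps)
    finally show ?thesis unfolding Rw by (simp add: c_def mult.assoc)
  qed
  obtain C1 where C1: "C1 \<ge> 0" "\<And>\<tau> w'. \<tau> > 0 \<Longrightarrow> Re w' > 0 \<Longrightarrow> Re w' \<le> Re w \<Longrightarrow> norm (theta_remainder N \<tau> xm w' - full_theta \<tau> w' (of_real xm)) \<le> C1 * \<tau> ^ (N + 1) / \<bar>Re w'\<bar> ^ (2 * N + 3)"
    using theta_remainder_right[OF Re, of N xm] by blast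
  obtain C2 where C2: "C2 \<ge> 0" "\<And>\<tau> w'. \<tau> > 0 \<Longrightarrow> Re w' > 0 \<Longrightarrow> Re w' \<le> Re w \<Longrightarrow> norm (theta_remainder N \<tau> xp w' - full_theta \<tau> w' (of_real xp)) \<le> C2 * \<tau> ^ (N + 1) / \<bar>Re w'\<bar> ^ (2 * N + 3)"
    using theta_remainder_right[OF Re, of N xp] by blast
  obtain P where P: "P \<ge> 0" "\<And>\<tau> w y T. 0 < \<tau> \<Longrightarrow> \<tau> \<le> 1 \<Longrightarrow> finite T \<Longrightarrow>
    (\<And>m::int. m \<notin> T \<Longrightarrow> (Im w - 2 * pi * of_int m)\<^sup>2 - (Re w)\<^sup>2 \<ge> c * (1 + \<bar>of_int m\<bar>)) \<Longrightarrow>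
    norm (full_theta \<tau> w (of_real y) - (\<Sum>m\<in>T. poisson_term \<tau> w y m)) \<le> P * \<tau> ^ (N + 1)"
    using full_theta_minus_poisson_terms[OF \<open>c > 0\<close>, of "N + 1"] by blast
  show ?thesis
  proof (rule bigo_at_right_0I[where b="2 * pi * real p" and C="C1 / K + C2 / K + (P + P)"])
    fix t :: real assume t: "0 < t" "2 * pi * real p * t \<le> 1"
    define \<tau> where "\<tau> = 2 * pi * real p * t"
    have \<tau>: "\<tau> > 0" "\<tau> \<le> 1" using t assms by (auto simp: \<tau>_def)
    have "exp w \<noteq> 1" using Re by (intro exp_neq_1_if_Re) auto
    then have d: "singlet_C p r s \<epsilon> (\<i> * of_real t) - (\<Sum>a\<le>N. (D_eps ^^ (2 * a)) (sinh_quot p r s) \<epsilon> * of_real ((pi * t) ^ a / fact a))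
      = theta_remainder N \<tau> xm w - theta_remainder N \<tau> xp w"
      unfolding \<tau>_def xm_def xp_def by (intro singlet_C_diff_exp_quot(2) assms t) (auto simp: w_def)
    have m: "theta_main p r s k u0 v0 t = (\<Sum>m\<in>T. poisson_term \<tau> w xm m) - (\<Sum>m\<in>T. poisson_term \<tau> w xp m)"
      unfolding theta_main_conv_poisson_term[OF assms(1) t(1) w] sum_subtractf T_def \<tau>_def xm_def xp_def ..
    have "singlet_C p r s \<epsilon> (\<i> * of_real t) - (theta_main p r s k u0 v0 t
      + (\<Sum>a\<le>N. (D_eps ^^ (2 * a)) (sinh_quot p r s) \<epsilon> * of_real ((pi * t) ^ a / fact a)))
      = (singlet_C p r s \<epsilon> (\<i> * of_real t) - (\<Sum>a\<le>N. (D_eps ^^ (2 * a)) (sinh_quot p r s) \<epsilon> * of_real ((pi * t) ^ a / fact a))) - theta_main p r s k u0 v0 t"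
      by (simp only: algebra_simps)
    also have "\<dots> = ((theta_remainder N \<tau> xm w - full_theta \<tau> w (of_real xm)) - (theta_remainder N \<tau> xp w - full_theta \<tau> w (of_real xp)))
       + ((full_theta \<tau> w (of_real xm) - (\<Sum>m\<in>T. poisson_term \<tau> w xm m)) - (full_theta \<tau> w (of_real xp) - (\<Sum>m\<in>T. poisson_term \<tau> w xp m)))"
      unfolding d m by (simp only: algebra_simps)
    also have "norm \<dots> \<le> (norm (theta_remainder N \<tau> xm w - full_theta \<tau> w (of_real xm)) + norm (theta_remainder N \<tau> xp w - full_theta \<tau> w (of_real xp)))
       + (norm (full_theta \<tau> w (of_real xm) - (\<Sum>m\<in>T. poisson_term \<tau> w xm m)) + norm (full_theta \<tau> w (of_real xp) - (\<Sum>m\<in>T. poisson_term \<tau> w xp m)))"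
      by (intro order_trans[OF norm_triangle_ineq] add_mono norm_triangle_ineq4)
    also have "\<dots> \<le> (C1 * \<tau> ^ (N + 1) / K + C2 * \<tau> ^ (N + 1) / K) + (P * \<tau> ^ (N + 1) + P * \<tau> ^ (N + 1))"
      unfolding K_def using \<tau> Re by (intro add_mono C1 C2 P T gap) auto
    finally show "norm (singlet_C p r s \<epsilon> (\<i> * of_real t) - (theta_main p r s k u0 v0 t
      + (\<Sum>a\<le>N. (D_eps ^^ (2 * a)) (sinh_quot p r s) \<epsilon> * of_real ((pi * t) ^ a / fact a))))
       \<le> (C1 / K + C2 / K + (P + P)) * (2 * pi * real p * t) ^ (N + 1)"
      unfolding \<tau>_def[symmetric] by (simp add: algebra_simps)
  qed (use assms in simp)
qed

text \<open>Since 0 < |v0| \<le> 1/2, the number v0 + k is never an integer. The difference of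
  quotients is then holomorphic at \<open>w\<close> and serves as its own extension, and the
  cancellation condition is vacuous.\<close>

lemma singlet_C_expansion_axis:
  fixes p s :: nat and r k :: int and v0 :: real and \<epsilon> :: complex
  assumes "p > 0" "v0 \<noteq> 0" "\<bar>v0\<bar> \<le> 1 / 2"
    and eps: "\<epsilon> = (\<i> * of_real v0 + \<i> * of_int k) / of_real (sqrt (2 * real p))"
  shows "(\<lambda>t. singlet_C p r s \<epsilon> (\<i> * of_real t)
      - (\<Sum>a\<le>N. (D_eps ^^ (2 * a)) (sinh_quot p r s) \<epsilon> * of_real ((pi * t) ^ a / fact a)))
     \<in> O[at_right 0](\<lambda>t::real. of_real (t ^ (N + 1)))"
proof -
  define v where "v = v0 + of_int k"
  define w where "w = 2 * complex_of_real pi * \<i> * of_real v"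
  have w: "w = 2 * of_real pi * of_real (sqrt (2 * real p)) * \<epsilon>"
  proof -
    have "\<epsilon> = \<i> * of_real v / of_real (sqrt (2 * real p))" by (simp add: eps v_def distrib_left)
    then show ?thesis using assms(1) by (simp add: w_def)
  qed
  have v: "v \<noteq> of_int m" for m
  proof
    assume "v = of_int m"
    then have "v0 = of_int (m - k)" by (simp add: v_def)
    then have "m - k = 0" using assms(3) by linarith
    with \<open>v0 = of_int (m - k)\<close> assms(2) show False by simp
  qed
  have vc: "complex_of_real v \<noteq> of_int m" for m
    using v[of m] of_real_eq_iff[of v "of_int m", where ?'a=complex] by (simp del: of_real_eq_iff)
  have "complex_of_real v \<notin> \<int>"
  proof
    assume "complex_of_real v \<in> \<int>"
    then obtain m where "complex_of_real v = of_int m" by (rule Ints_cases)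
    with vc show False by blast
  qed
  then have exp_w: "exp w \<noteq> 1" unfolding w_def exp_2pi_i_eq_1_iff .
  define xm where "xm = 1 - of_int r / 2 - real s / (2 * real p)"
  define xp where "xp = 1 - of_int r / 2 + real s / (2 * real p)"
  define S where "S = {w::complex. exp w \<noteq> 1}"
  have S: "open S" unfolding S_def by (intro open_Collect_neq continuous_intros)
  obtain C where C: "\<And>\<tau>. 0 < \<tau> \<Longrightarrow> \<tau> \<le> 1 \<Longrightarrow>
    norm (partial_theta \<tau> w (of_real xm) - partial_theta \<tau> w (of_real xp)
       - (\<Sum>a\<le>N. (deriv ^^ (2 * a)) (\<lambda>w. exp_quot xm w - exp_quot xp w) w * of_real ((- \<tau>) ^ a / fact a))) \<le> C * \<tau> ^ (N + 1)"
  proof (rule partial_theta_diff_on_axis[where v=v and x=xm and y=xp and S=S and G="\<lambda>w. exp_quot xm w - exp_quot xp w" and N=N, folded w_def])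
    show "(\<lambda>w. exp_quot xm w - exp_quot xp w) holomorphic_on S"
      by (intro holomorphic_intros) (auto simp: S_def)
  qed (use S exp_w v in \<open>auto simp: S_def\<close>)
  show ?thesis
  proof (rule bigo_at_right_0I[where b="2 * pi * real p" and C=C])
    fix t :: real assume t: "0 < t" "2 * pi * real p * t \<le> 1"
    show "norm (singlet_C p r s \<epsilon> (\<i> * of_real t) - (\<Sum>a\<le>N. (D_eps ^^ (2 * a)) (sinh_quot p r s) \<epsilon> * of_real ((pi * t) ^ a / fact a)))
       \<le> C * (2 * pi * real p * t) ^ (N + 1)"
      unfolding singlet_C_diff_exp_quot(1)[OF assms(1) t(1) w exp_w] xm_def[symmetric] xp_def[symmetric]
      using t assms(1) by (intro C) auto
  qed (use assms in simp)
qed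

text \<open>The two expansions at 0, weighted with their phases, give the sine from the square roots
  and Bernoulli polynomials at \<open>xm\<close> and \<open>xp\<close>. The statement shows B at
  \<open>xm = - y\<close> directly; since \<open>xp = y - (r - 2)\<close>, the sum with
  \<open>sinh_quot_corr\<close> accounts for the difference between B at \<open>y\<close> and at
  \<open>xp\<close>.\<close>

lemma singlet_C_expansion_integer:
  fixes p s :: nat and r k :: int and \<epsilon> :: complex
  assumes "p > 0" and eps: "\<epsilon> = \<i> * of_int k / of_real (sqrt (2 * real p))"
  shows "(\<lambda>t. singlet_C p r s \<epsilon> (\<i> * of_real t)
             - (- \<i> * (- 1) powi (r * k) * of_real (sin (pi * of_int k * real s / real p))
                  * of_real ((2 * real p * t) powr (- 1 / 2))
                + (- 1) powi (k * r)
                  * (\<Sum>a\<le>N.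
                      (exp (of_real pi * \<i> * of_nat s * of_int k / of_nat p)
                         * of_real (bernoulli_poly (2 * a + 1)
                             ((real s + real p * (of_int r - 2)) / (2 * real p)))
                       - exp (- (of_real pi * \<i> * of_nat s * of_int k / of_nat p))
                         * of_real (bernoulli_poly (2 * a + 1)
                             (- ((real s + real p * (of_int r - 2)) / (2 * real p)))))
                      * of_real ((- 2 * pi * real p * t) ^ a / (real (2 * a + 1) * fact a)))
                - (\<Sum>a\<le>N. (D_eps ^^ (2 * a)) (sinh_quot_corr p r s) \<epsilon>
                      * of_real ((pi * t) ^ a / fact a))))
        \<in> O[at_right 0](\<lambda>t::real. of_real (t ^ (N + 1)))" (is "(\<lambda>t. _ - ?main t) \<in> _")
proof -
  define w where "w = 2 * complex_of_real pi * \<i> * of_int k"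
  have w: "w = 2 * of_real pi * of_real (sqrt (2 * real p)) * \<epsilon>"
    using assms(1) by (simp add: w_def eps)
  define xm where "xm = 1 - of_int r / 2 - real s / (2 * real p)"
  define xp where "xp = 1 - of_int r / 2 + real s / (2 * real p)"
  define y where "y = (real s + real p * (of_int r - 2)) / (2 * real p)"
  have my: "- y = xm" using assms(1) by (simp add: y_def xm_def field_simps)
  define \<sigma> where "\<sigma> = (- 1 :: complex) powi (r * k)"
  define \<theta> where "\<theta> = of_real pi * \<i> * of_nat s * of_int k / (of_nat p :: complex)"
  have km: "exp (w * of_real xm) = \<sigma> * exp (- \<theta>)"
    using exp_2pi_i_half_integer[of k r "- (real s / (2 * real p))"] by (simp add: w_def xm_def \<sigma>_def \<theta>_def mult_ac)
  have kp: "exp (w * of_real xp) = \<sigma> * exp \<theta>"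
    using exp_2pi_i_half_integer[of k r "real s / (2 * real p)"] by (simp add: w_def xp_def \<sigma>_def \<theta>_def mult_ac)
  define \<phi> where "\<phi> = pi * of_int k * real s / real p"
  have th: "\<theta> = \<i> * of_real \<phi>" by (simp add: \<theta>_def \<phi>_def mult_ac)
  have sn: "(exp (- \<theta>) - exp \<theta>) / 2 = - \<i> * of_real (sin \<phi>)"
  proof -
    have "exp (- \<theta>) - exp \<theta> = - 2 * \<i> * of_real (sin \<phi>)"
      unfolding th by (simp add: sin_of_real[symmetric] sin_exp_eq)
    then show ?thesis by simp
  qed
  define b where "b a x = complex_of_real (bernoulli_poly (2 * a + 1) x)" for a x
  define A where "A \<tau> x = complex_of_real (sqrt (pi / \<tau>)) / 2
      - (\<Sum>a\<le>N. of_real (bernoulli_poly (2 * a + 1) x / real (2 * a + 1)) * of_real ((- \<tau>) ^ a / fact a))" for \<tau> x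
  obtain C1 where C1: "\<And>\<tau>. 0 < \<tau> \<Longrightarrow> \<tau> \<le> 1 \<Longrightarrow> norm (partial_theta \<tau> 0 (of_real xm) - A \<tau> xm) \<le> C1 * \<tau> ^ (N + 1)"
    unfolding A_def using partial_theta_at_0_expansion[of xm N] by blast
  obtain C2 where C2: "\<And>\<tau>. 0 < \<tau> \<Longrightarrow> \<tau> \<le> 1 \<Longrightarrow> norm (partial_theta \<tau> 0 (of_real xp) - A \<tau> xp) \<le> C2 * \<tau> ^ (N + 1)"
    unfolding A_def using partial_theta_at_0_expansion[of xp N] by blast
  have main: "?main t = exp (w * of_real xm) * A (2 * pi * real p * t) xm - exp (w * of_real xp) * A (2 * pi * real p * t) xp" if "t > 0" for t
  proof -
    define q where "q a = complex_of_real ((- (2 * pi * real p * t)) ^ a / fact a) / of_nat (2 * a + 1)" for a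
    have A: "A (2 * pi * real p * t) x = of_real ((2 * real p * t) powr (- 1 / 2)) / 2 - (\<Sum>a\<le>N. b a x * q a)" for x
      unfolding A_def sqrt_pi_over[OF that assms(1)] q_def b_def by (simp add: field_simps)
    have c: "(D_eps ^^ (2 * a)) (sinh_quot_corr p r s) \<epsilon> * of_real ((pi * t) ^ a / fact a) = - (\<sigma> * exp \<theta>) * (b a xp - b a y) * q a" for a
      unfolding funpow_D_eps_sinh_quot_corr[OF assms] xp_def[symmetric] y_def[symmetric] w_def[symmetric] kp
      by (simp add: b_def q_def)
    have q: "complex_of_real ((- 2 * pi * real p * t) ^ a / (real (2 * a + 1) * fact a)) = q a" for a
      by (simp add: q_def)
    have "?main t = - \<i> * \<sigma> * of_real (sin \<phi>) * of_real ((2 * real p * t) powr (- 1 / 2))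
       + \<sigma> * (\<Sum>a\<le>N. (exp \<theta> * b a y - exp (- \<theta>) * b a xm) * q a) - (\<Sum>a\<le>N. - (\<sigma> * exp \<theta>) * (b a xp - b a y) * q a)"
      unfolding c q y_def[symmetric] my \<theta>_def[symmetric] b_def[symmetric] \<phi>_def[symmetric] mult.commute[of k r] \<sigma>_def[symmetric] ..
    also have "\<dots> = \<sigma> * ((exp (- \<theta>) - exp \<theta>) / 2) * of_real ((2 * real p * t) powr (- 1 / 2))
       + (\<sigma> * exp \<theta> * (\<Sum>a\<le>N. b a xp * q a) - \<sigma> * exp (- \<theta>) * (\<Sum>a\<le>N. b a xm * q a))"
    proof -
      have "\<sigma> * (\<Sum>a\<le>N. (exp \<theta> * b a y - exp (- \<theta>) * b a xm) * q a) - (\<Sum>a\<le>N. - (\<sigma> * exp \<theta>) * (b a xp - b a y) * q a)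
        = (\<Sum>a\<le>N. \<sigma> * ((exp \<theta> * b a y - exp (- \<theta>) * b a xm) * q a) - - (\<sigma> * exp \<theta>) * (b a xp - b a y) * q a)"
        by (simp only: sum_distrib_left sum_subtractf)
      \<comment> \<open>The terms with \<open>b a y\<close> cancel.\<close>
      also have "\<dots> = (\<Sum>a\<le>N. \<sigma> * exp \<theta> * (b a xp * q a) - \<sigma> * exp (- \<theta>) * (b a xm * q a))"
        by (intro sum.cong refl) (simp add: algebra_simps)
      also have "\<dots> = \<sigma> * exp \<theta> * (\<Sum>a\<le>N. b a xp * q a) - \<sigma> * exp (- \<theta>) * (\<Sum>a\<le>N. b a xm * q a)"
        by (simp only: sum_distrib_left sum_subtractf)
      finally show ?thesis unfolding sn by (simp add: algebra_simps)
    qed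
    also have "\<dots> = \<sigma> * exp (- \<theta>) * A (2 * pi * real p * t) xm - \<sigma> * exp \<theta> * A (2 * pi * real p * t) xp"
      unfolding A by (simp add: algebra_simps diff_divide_distrib)
    finally show ?thesis unfolding km kp .
  qed
  show ?thesis
  proof (rule bigo_at_right_0I[where b="2 * pi * real p" and C="norm (exp (w * of_real xm)) * C1 + norm (exp (w * of_real xp)) * C2"])
    fix t :: real assume t: "0 < t" "2 * pi * real p * t \<le> 1"
    define \<tau> where "\<tau> = 2 * pi * real p * t"
    have \<tau>: "\<tau> > 0" "\<tau> \<le> 1" using t assms by (auto simp: \<tau>_def)
    have "singlet_C p r s \<epsilon> (\<i> * of_real t) = exp (w * of_real xm) * partial_theta \<tau> 0 (of_real xm) - exp (w * of_real xp) * partial_theta \<tau> 0 (of_real xp)"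
      unfolding singlet_C_conv_partial_theta[OF assms(1) t(1) w] \<tau>_def[symmetric] xm_def[symmetric] xp_def[symmetric]
      unfolding w_def partial_theta_2pi_i[OF \<tau>(1)] ..
    then have "singlet_C p r s \<epsilon> (\<i> * of_real t) - ?main t
       = exp (w * of_real xm) * (partial_theta \<tau> 0 (of_real xm) - A \<tau> xm) - exp (w * of_real xp) * (partial_theta \<tau> 0 (of_real xp) - A \<tau> xp)"
      unfolding main[OF t(1)] \<tau>_def[symmetric] by (simp only:) (simp only: algebra_simps)
    also have "norm \<dots> \<le> norm (exp (w * of_real xm)) * norm (partial_theta \<tau> 0 (of_real xm) - A \<tau> xm) + norm (exp (w * of_real xp)) * norm (partial_theta \<tau> 0 (of_real xp) - A \<tau> xp)"
      unfolding norm_mult[symmetric] by (rule norm_triangle_ineq4)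
    also have "\<dots> \<le> norm (exp (w * of_real xm)) * (C1 * \<tau> ^ (N + 1)) + norm (exp (w * of_real xp)) * (C2 * \<tau> ^ (N + 1))"
      by (intro add_mono mult_left_mono C1 C2 \<tau>) auto
    finally show "norm (singlet_C p r s \<epsilon> (\<i> * of_real t) - ?main t)
       \<le> (norm (exp (w * of_real xm)) * C1 + norm (exp (w * of_real xp)) * C2) * (2 * pi * real p * t) ^ (N + 1)"
      unfolding \<tau>_def[symmetric] by (simp only: distrib_right mult.assoc)
  qed (use assms in simp)
qed

theorem theorem6p2:
  fixes p s N :: nat and r k :: int and u0 v0 :: real and \<epsilon>0 \<epsilon> :: complex
  assumes "p \<ge> 2" and "1 \<le> s" and "s \<le> p - 1"
    and "- 1 / 2 < v0" and "v0 \<le> 1 / 2"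
    and "\<epsilon>0 = of_real u0 + \<i> * of_real v0"
    and "\<epsilon> = (\<epsilon>0 + \<i> * of_int k) / of_real (sqrt (2 * real p))"
  shows
    "(Re \<epsilon> < 0 \<or> (Re \<epsilon> > 0 \<and> \<bar>v0\<bar> > \<bar>u0\<bar>) \<or> (u0 = 0 \<and> v0 \<noteq> 0) \<longrightarrow>
        (\<lambda>t. singlet_C p r s \<epsilon> (\<i> * of_real t)
             - (\<Sum>a\<le>N. (D_eps ^^ (2 * a)) (sinh_quot p r s) \<epsilon> * of_real ((pi * t) ^ a / fact a)))
        \<in> O[at_right 0](\<lambda>t::real. of_real (t ^ (N + 1))))
   \<and> (Re \<epsilon> > 0 \<and> \<bar>v0\<bar> \<le> \<bar>u0\<bar> \<longrightarrow>
        (\<lambda>t. singlet_C p r s \<epsilon> (\<i> * of_real t)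
             - (theta_main p r s k u0 v0 t
                + (\<Sum>a\<le>N. (D_eps ^^ (2 * a)) (sinh_quot p r s) \<epsilon> * of_real ((pi * t) ^ a / fact a))))
        \<in> O[at_right 0](\<lambda>t::real. of_real (t ^ (N + 1))))
   \<and> (\<epsilon>0 = 0 \<longrightarrow>
        (\<lambda>t. singlet_C p r s \<epsilon> (\<i> * of_real t)
             - (- \<i> * (- 1) powi (r * k) * of_real (sin (pi * of_int k * real s / real p))
                  * of_real ((2 * real p * t) powr (- 1 / 2))
                + (- 1) powi (k * r)
                  * (\<Sum>a\<le>N.
                      (exp (of_real pi * \<i> * of_nat s * of_int k / of_nat p)
                         * of_real (bernoulli_poly (2 * a + 1)
                             ((real s + real p * (of_int r - 2)) / (2 * real p)))
                       - exp (- (of_real pi * \<i> * of_nat s * of_int k / of_nat p))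
                         * of_real (bernoulli_poly (2 * a + 1)
                             (- ((real s + real p * (of_int r - 2)) / (2 * real p)))))
                      * of_real ((- 2 * pi * real p * t) ^ a / (real (2 * a + 1) * fact a)))
                - (\<Sum>a\<le>N. (D_eps ^^ (2 * a)) (sinh_quot_corr p r s) \<epsilon>
                      * of_real ((pi * t) ^ a / fact a))))
        \<in> O[at_right 0](\<lambda>t::real. of_real (t ^ (N + 1))))"
proof (intro conjI impI, goal_cases)
  case 1
  have p: "p > 0" and sq: "sqrt (2 * real p) > 0" using assms(1) by auto
  have Re: "Re \<epsilon> = u0 / sqrt (2 * real p)"
    unfolding assms(6,7) by (simp add: Re_divide_of_real)
  from 1 consider "Re \<epsilon> < 0" | "Re \<epsilon> > 0" "\<bar>v0\<bar> > \<bar>u0\<bar>" | "u0 = 0" "v0 \<noteq> 0" by blast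
  then show ?case
  proof cases
    case 1
    then show ?thesis by (rule singlet_C_expansion_left[OF p])
  next
    case 2
    \<comment> \<open>For n \<noteq> 0 one has |n + v0| \<ge> 1 - |v0| \<ge> |v0| > |u0|, and n = 0
      fails as well. With no Gaussian left, the expansion for the right half plane is the
      claim.\<close>
    have "{n::int. \<bar>of_int n + v0\<bar> \<le> \<bar>u0\<bar>} = {}"
    proof (intro equals0I)
      fix n :: int assume "n \<in> {n. \<bar>of_int n + v0\<bar> \<le> \<bar>u0\<bar>}"
      then have n: "\<bar>of_int n + v0\<bar> < \<bar>v0\<bar>" using 2 by simp
      then have "n \<noteq> 0" by auto
      then have "\<bar>real_of_int n\<bar> \<ge> 1" by simp
      then show False using n assms(4,5) by linarith
    qed
    then have "theta_main p r s k u0 v0 t = 0" for t by (simp add: theta_main_def)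
    then show ?thesis
      using singlet_C_expansion_right[OF p 2(1), of u0 v0 k r s N] assms(6,7) by simp
  next
    case 3
    then show ?thesis using assms(4-7) by (intro singlet_C_expansion_axis[OF p, of v0 _ k]) auto
  qed
next
  case 2
  then show ?case
    using singlet_C_expansion_right[of p \<epsilon> u0 v0 k r s N] assms(1,6,7) by simp
next
  case 3
  then show ?case using assms(1,7) by (intro singlet_C_expansion_integer) auto
qed

end
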